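(* Let $\mathcal A$ be as in the context, with finitely many two-sided cells, and let $F\in\mathcal K^b(\mathcal A)$ be twist-like, sharp and cell triangular, with associated shift functors $\Sigma_\lambda$. Suppose that for each two-sided cell $\lambda$ there exists a $\lambda$-equivalence $\alpha_\lambda\colon\Sigma_\lambda(\mathbf 1)\to F$. Then $$\mathrm{Cone}(\alpha_{\lambda_1})\otimes\mathrm{Cone}(\alpha_{\lambda_2})\otimes\cdots\otimes\mathrm{Cone}(\alpha_{\lambda_k})\simeq0$$ for an ordering $\lambda_1,\dots,\lambda_k$ of the set of two-sided cells such that every initial segment $\{\lambda_1,\dots,\lambda_m\}$ is an ideal (downward closed subset) of the poset of two-sided cells.
   Context: $\mathcal A$ is an additive monoidal Krull–Schmidt category with monoidal identity $\mathbf 1$, equipped with a strict action of an abelian group $\Gamma$ by grading shift functors $(i)$, $i\in\Gamma$, satisfying $A(i)\cong A\otimes\mathbf 1(i)\cong\mathbf 1(i)\otimes A$. For indecomposables write $B\le_{LR}B'$ if $B$ is a direct summand of $M\otimes B'\otimes N$ for some objects $M,N$; two-sided cells are the classes of the associated equivalence relation, with the induced partial order $\le$. An object or complex is "in cells $\le\lambda$" (etc.) if all indecomposable summands of (its chain objects) lie in such cells. Standing assumption on $\mathcal A$: for each indecomposable $B$ there is an object $B^\vee$ in the same two-sided cell such that $(-)\otimes B$ and $(-)\otimes B^\vee$ are left and right adjoint to each other, and there is an indecomposable $B'$ in the same cell as $B$ such that $B$ is a direct summand of $B\otimes B'$. Complexes are cohomological, $C[1]^k=C^{k+1}$; $\mathcal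 K^b(\mathcal A)$ is the bounded homotopy category. An invertible complex $F\in\mathcal K^b(\mathcal A)$ is twist-like if $F\otimes B\otimes F^{-1}$ is homotopy equivalent to an object of $\mathcal A$ in degree $0$, for all $B\in\mathcal A$. For such $F$ and $B\in\mathcal A$, $\mathbf n_F(B)$ is the smallest integer such that $F\otimes B$ is homotopy equivalent to a complex supported in homological degrees $\le\mathbf n_F(B)$; it depends only on the two-sided cell $\lambda$ of an indecomposable $B$, and is then denoted $\mathbf n_F(\lambda)$. $\mathbf m_F(\lambda)$ is the largest $k$ such that the image of $F$ in $\mathcal K^b(\mathcal A/\mathcal I_{\not\ge\lambda})$ is homotopy equivalent to a complex supported in degrees $\ge k$, where one quotients by the morphisms factoring through objects all of whose indecomposable summands lie in cells $\not\ge\lambda$. $F$ is sharp if $\mathbf n_F(\lambda)=\mathbf m_F(\lambda)$ for all $\lambda$, and increasing if $\mathbf m_F(\lambda)<\mathbf m_F(\mu)$ whenever $\lambda<\mu$. For $B$ indecomposable in cell $\lambda$, the head of $F\otimes B$ is the chain object in degree $\mathbf n_F(\lambda)$ of the minimal complex of $F\otimes B$ (the representative up to homotopy with no isomorphism as a summand of its differential), viewed as a complex in that degree. $F$ is cell triangular if it is twist-like, sharp and increasing and for each cell $\lambda$ there is a functor $\Sigma_\lambda=(a_\lambda)[b_\lambda]$, $a_\lambda\in\Gamma$, $b_\lambda\in\mathbb Z$, such that the head of $F\otimes B$ is isomorphic to $\Sigma_\lambda(B)$ for every indecomposable $B$ in cell $\lambda$. A chain map $\alpha_\lambda\colon\Sigma_\lambda(\mathbf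 1)\to F$ is a $\lambda$-equivalence if $\mathrm{Cone}(\alpha_\lambda)\otimes B$ is homotopy equivalent to a complex in cells $<\lambda$ for all $B$ in cell $\lambda$. *)

theory Defs
  imports "HOL-Algebra.Ring" "HOL-Algebra.AbelCoset"
begin

section \<open>Additive Krull-Schmidt categories\<close>

text \<open>
  A category enriched in abelian groups. Every element of the type \<open>'o\<close> is an object; morphisms are
  the elements of \<open>Arr C\<close>, each with one domain and one codomain. \<open>g \<bullet> f\<close> is \<open>g\<close> after \<open>f\<close>;
  it and \<open>Plus\<close> are meaningful only for composable, respectively parallel, morphisms.
\<close>

record ('o, 'm) cat =
  Arr :: "'m set"
  Dom :: "'m \<Rightarrow> 'o"
  Cod :: "'m \<Rightarrow> 'o"
  Ide :: "'o \<Rightarrow> 'm"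
  Comp :: "'m \<Rightarrow> 'm \<Rightarrow> 'm" (infixl \<open>\<bullet>\<index>\<close> 70)
  Zero :: "'o \<Rightarrow> 'o \<Rightarrow> 'm"
  Plus :: "'m \<Rightarrow> 'm \<Rightarrow> 'm"

definition Hom :: "('o, 'm, 'z) cat_scheme \<Rightarrow> 'o \<Rightarrow> 'o \<Rightarrow> 'm set" where
  "Hom C X Y = {f \<in> Arr C. Dom C f = X \<and> Cod C f = Y}"

text \<open>The hom-group as a HOL-Algebra record. Its multiplicative part is meaningful only for
  \<open>X = Y\<close>, where the record is the endomorphism ring of \<open>X\<close>.\<close>

definition homs :: "('o, 'm, 'z) cat_scheme \<Rightarrow> 'o \<Rightarrow> 'o \<Rightarrow> 'm ring" where
  "homs C X Y = \<lparr>carrier = Hom C X Y, mult = Comp C, one = Ide C X,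
     zero = Zero C X Y, add = Plus C\<rparr>"

locale preadditive_category =
  fixes C :: "('o, 'm, 'z) cat_scheme" (structure)
  assumes ide_in_hom: "Ide C X \<in> Hom C X X"
    and comp_in_hom: "\<lbrakk>f \<in> Hom C X Y; g \<in> Hom C Y Z\<rbrakk> \<Longrightarrow> g \<bullet> f \<in> Hom C X Z"
    and comp_assoc: "\<lbrakk>f \<in> Hom C W X; g \<in> Hom C X Y; h \<in> Hom C Y Z\<rbrakk>
      \<Longrightarrow> (h \<bullet> g) \<bullet> f = h \<bullet> (g \<bullet> f)"
    and comp_ide_right: "f \<in> Hom C X Y \<Longrightarrow> f \<bullet> Ide C X = f"
    and comp_ide_left: "f \<in> Hom C X Y \<Longrightarrow> Ide C Y \<bullet> f = f"
    and hom_abelian_group: "abelian_group (homs C X Y)"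
    and comp_plus_left: "\<lbrakk>f \<in> Hom C X Y; g \<in> Hom C Y Z; h \<in> Hom C Y Z\<rbrakk>
      \<Longrightarrow> Plus C g h \<bullet> f = Plus C (g \<bullet> f) (h \<bullet> f)"
    and comp_plus_right: "\<lbrakk>f \<in> Hom C X Y; g \<in> Hom C X Y; h \<in> Hom C Y Z\<rbrakk>
      \<Longrightarrow> h \<bullet> Plus C f g = Plus C (h \<bullet> f) (h \<bullet> g)"

definition is_iso :: "('o, 'm, 'z) cat_scheme \<Rightarrow> 'o \<Rightarrow> 'o \<Rightarrow> 'm \<Rightarrow> bool" where
  "is_iso C X Y f \<longleftrightarrow> f \<in> Hom C X Y \<and>
     (\<exists>g \<in> Hom C Y X. g \<bullet>\<^bsub>C\<^esub> f = Ide C X \<and> f \<bullet>\<^bsub>C\<^esub> g = Ide C Y)"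

definition is_zero_obj :: "('o, 'm, 'z) cat_scheme \<Rightarrow> 'o \<Rightarrow> bool" where
  "is_zero_obj C X \<longleftrightarrow> Ide C X = Zero C X X"

definition is_biproduct :: "('o, 'm, 'z) cat_scheme \<Rightarrow> 'i set \<Rightarrow> ('i \<Rightarrow> 'o) \<Rightarrow> 'o
    \<Rightarrow> ('i \<Rightarrow> 'm) \<Rightarrow> ('i \<Rightarrow> 'm) \<Rightarrow> bool" where
  "is_biproduct C I X S \<iota> \<pi> \<longleftrightarrow> finite I \<and>
     (\<forall>i\<in>I. \<iota> i \<in> Hom C (X i) S \<and> \<pi> i \<in> Hom C S (X i)) \<and>
     (\<forall>i\<in>I. \<forall>j\<in>I. \<pi> j \<bullet>\<^bsub>C\<^esub> \<iota> i = (if i = j then Ide C (X i) else Zero C (X i) (X j))) \<and>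
     finsum (homs C S S) (\<lambda>i. \<iota> i \<bullet>\<^bsub>C\<^esub> \<pi> i) I = Ide C S"

text \<open>Finite families are indexed by finite sets of integers throughout, because the families that
  occur come from complexes; the case of the empty family is a zero object.\<close>

locale additive_category = preadditive_category C
  for C :: "('o, 'm, 'z) cat_scheme" (structure) +
  assumes biproducts: "finite (I :: int set) \<Longrightarrow> \<exists>S \<iota> \<pi>. is_biproduct C I X S \<iota> \<pi>"

definition biprod :: "('o, 'm, 'z) cat_scheme \<Rightarrow> int set \<Rightarrow> (int \<Rightarrow> 'o)
    \<Rightarrow> 'o \<times> (int \<Rightarrow> 'm) \<times> (int \<Rightarrow> 'm)" where
  "biprod C I X = (SOME (S, \<iota>, \<pi>). is_biproduct C I X S \<iota> \<pi>)"

definition bp_obj :: "('o, 'm, 'z) cat_scheme \<Rightarrow> int set \<Rightarrow> (int \<Rightarrow> 'o) \<Rightarrow> 'o" where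
  "bp_obj C I X = fst (biprod C I X)"

definition bp_in :: "('o, 'm, 'z) cat_scheme \<Rightarrow> int set \<Rightarrow> (int \<Rightarrow> 'o) \<Rightarrow> int \<Rightarrow> 'm" where
  "bp_in C I X = fst (snd (biprod C I X))"

definition bp_pr :: "('o, 'm, 'z) cat_scheme \<Rightarrow> int set \<Rightarrow> (int \<Rightarrow> 'o) \<Rightarrow> int \<Rightarrow> 'm" where
  "bp_pr C I X = snd (snd (biprod C I X))"

definition zero_obj :: "('o, 'm, 'z) cat_scheme \<Rightarrow> 'o" where
  "zero_obj C = (SOME Z. is_zero_obj C Z)"

definition pair :: "'o \<Rightarrow> 'o \<Rightarrow> int \<Rightarrow> 'o" where
  "pair X Y i = (if i = 0 then X else Y)"

definition is_summand :: "('o, 'm, 'z) cat_scheme \<Rightarrow> 'o \<Rightarrow> 'o \<Rightarrow> bool" where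
  "is_summand C Y X \<longleftrightarrow> (\<exists>Z \<iota> \<pi>. is_biproduct C {0, 1} (pair Y Z) X \<iota> \<pi>)"

definition indecomposable :: "('o, 'm, 'z) cat_scheme \<Rightarrow> 'o \<Rightarrow> bool" where
  "indecomposable C X \<longleftrightarrow> \<not> is_zero_obj C X \<and>
     (\<forall>Y Z \<iota> \<pi>. is_biproduct C {0, 1} (pair Y Z) X \<iota> \<pi> \<longrightarrow> is_zero_obj C Y \<or> is_zero_obj C Z)"

text \<open>Local in the sense of not necessarily commutative rings: nonzero, and the non-units are
  closed under addition.\<close>

definition local_ring :: "('a, 'b) ring_scheme \<Rightarrow> bool" where
  "local_ring R \<longleftrightarrow> ring R \<and> \<one>\<^bsub>R\<^esub> \<noteq> \<zero>\<^bsub>R\<^esub> \<and>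
     (\<forall>a \<in> carrier R - Units R. \<forall>b \<in> carrier R - Units R. a \<oplus>\<^bsub>R\<^esub> b \<notin> Units R)"

locale krull_schmidt_category = additive_category C
  for C :: "('o, 'm, 'z) cat_scheme" (structure) +
  assumes krull_schmidt: "\<exists>(I :: int set) Y \<iota> \<pi>. is_biproduct C I Y X \<iota> \<pi> \<and>
    (\<forall>i\<in>I. local_ring (homs C (Y i) (Y i)))"

section \<open>Monoidal and graded structure\<close>

record ('o, 'm) mcat = "('o, 'm) cat" +
  TenO :: "'o \<Rightarrow> 'o \<Rightarrow> 'o" (infixl \<open>\<boxtimes>\<index>\<close> 75)
  TenM :: "'m \<Rightarrow> 'm \<Rightarrow> 'm" (infixl \<open>\<star>\<index>\<close> 75)
  Unit :: "'o"
  Assoc :: "'o \<Rightarrow> 'o \<Rightarrow> 'o \<Rightarrow> 'm"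
  LUnit :: "'o \<Rightarrow> 'm"
  RUnit :: "'o \<Rightarrow> 'm"

locale monoidal_krull_schmidt_category = krull_schmidt_category C
  for C :: "('o, 'm, 'z) mcat_scheme" (structure) +
  assumes ten_in_hom: "\<lbrakk>f \<in> Hom C X X'; g \<in> Hom C Y Y'\<rbrakk>
      \<Longrightarrow> f \<star> g \<in> Hom C (X \<boxtimes> Y) (X' \<boxtimes> Y')"
    and ten_ide: "Ide C X \<star> Ide C Y = Ide C (X \<boxtimes> Y)"
    and ten_comp: "\<lbrakk>f \<in> Hom C X X'; f' \<in> Hom C X' X''; g \<in> Hom C Y Y'; g' \<in> Hom C Y' Y''\<rbrakk>
      \<Longrightarrow> (f' \<bullet> f) \<star> (g' \<bullet> g) = (f' \<star> g') \<bullet> (f \<star> g)"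
    and ten_plus_left: "\<lbrakk>f \<in> Hom C X X'; f' \<in> Hom C X X'; g \<in> Hom C Y Y'\<rbrakk>
      \<Longrightarrow> Plus C f f' \<star> g = Plus C (f \<star> g) (f' \<star> g)"
    and ten_plus_right: "\<lbrakk>f \<in> Hom C X X'; g \<in> Hom C Y Y'; g' \<in> Hom C Y Y'\<rbrakk>
      \<Longrightarrow> f \<star> Plus C g g' = Plus C (f \<star> g) (f \<star> g')"
    and assoc_iso: "is_iso C ((X \<boxtimes> Y) \<boxtimes> Z) (X \<boxtimes> (Y \<boxtimes> Z)) (Assoc C X Y Z)"
    and lunit_iso: "is_iso C (Unit C \<boxtimes> X) X (LUnit C X)"
    and runit_iso: "is_iso C (X \<boxtimes> Unit C) X (RUnit C X)"
    and assoc_natural: "\<lbrakk>f \<in> Hom C X X'; g \<in> Hom C Y Y'; h \<in> Hom C Z Z'\<rbrakk>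
      \<Longrightarrow> Assoc C X' Y' Z' \<bullet> ((f \<star> g) \<star> h) = (f \<star> (g \<star> h)) \<bullet> Assoc C X Y Z"
    and lunit_natural: "f \<in> Hom C X Y \<Longrightarrow> LUnit C Y \<bullet> (Ide C (Unit C) \<star> f) = f \<bullet> LUnit C X"
    and runit_natural: "f \<in> Hom C X Y \<Longrightarrow> RUnit C Y \<bullet> (f \<star> Ide C (Unit C)) = f \<bullet> RUnit C X"
    and pentagon: "((Ide C W \<star> Assoc C X Y Z) \<bullet> Assoc C W (X \<boxtimes> Y) Z) \<bullet> (Assoc C W X Y \<star> Ide C Z)
      = Assoc C W X (Y \<boxtimes> Z) \<bullet> Assoc C (W \<boxtimes> X) Y Z"
    and triangle: "(Ide C X \<star> LUnit C Y) \<bullet> Assoc C X (Unit C) Y = RUnit C X \<star> Ide C Y"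

record ('o, 'm, 'g) gcat = "('o, 'm) mcat" +
  ShO :: "'g \<Rightarrow> 'o \<Rightarrow> 'o"
  ShM :: "'g \<Rightarrow> 'm \<Rightarrow> 'm"

text \<open>The isomorphisms \<open>A(i) \<cong> A \<otimes> 1(i) \<cong> 1(i) \<otimes> A\<close> are isomorphisms of functors in \<open>A\<close>. No further
  coherence between the shifts and the tensor product is imposed.\<close>

locale graded_monoidal_krull_schmidt_category = monoidal_krull_schmidt_category C
  for C :: "('o, 'm, 'g :: ab_group_add, 'z) gcat_scheme" (structure) +
  assumes shift_in_hom: "f \<in> Hom C X Y \<Longrightarrow> ShM C i f \<in> Hom C (ShO C i X) (ShO C i Y)"
    and shift_ide: "ShM C i (Ide C X) = Ide C (ShO C i X)"
    and shift_comp: "\<lbrakk>f \<in> Hom C X Y; g \<in> Hom C Y Z\<rbrakk>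
      \<Longrightarrow> ShM C i (g \<bullet> f) = ShM C i g \<bullet> ShM C i f"
    and shift_0_obj: "ShO C 0 X = X"
    and shift_0_mor: "f \<in> Arr C \<Longrightarrow> ShM C 0 f = f"
    and shift_add_obj: "ShO C i (ShO C j X) = ShO C (i + j) X"
    and shift_add_mor: "f \<in> Arr C \<Longrightarrow> ShM C i (ShM C j f) = ShM C (i + j) f"
    and shift_right: "\<exists>\<phi>. (\<forall>X. is_iso C (ShO C i X) (X \<boxtimes> ShO C i (Unit C)) (\<phi> X)) \<and>
      (\<forall>X Y. \<forall>f \<in> Hom C X Y.
         \<phi> Y \<bullet> ShM C i f = (f \<star> Ide C (ShO C i (Unit C))) \<bullet> \<phi> X)"
    and shift_left: "\<exists>\<phi>. (\<forall>X. is_iso C (ShO C i X) (ShO C i (Unit C) \<boxtimes> X) (\<phi> X)) \<and>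
      (\<forall>X Y. \<forall>f \<in> Hom C X Y.
         \<phi> Y \<bullet> ShM C i f = (Ide C (ShO C i (Unit C)) \<star> f) \<bullet> \<phi> X)"

section \<open>Two-sided cells\<close>

definition le_LR :: "('o, 'm, 'z) mcat_scheme \<Rightarrow> 'o \<Rightarrow> 'o \<Rightarrow> bool" where
  "le_LR C B B' \<longleftrightarrow> (\<exists>M N. is_summand C B ((M \<boxtimes>\<^bsub>C\<^esub> B') \<boxtimes>\<^bsub>C\<^esub> N))"

text \<open>A cell is a set of indecomposable objects, closed under isomorphism.\<close>

definition cell_of :: "('o, 'm, 'z) mcat_scheme \<Rightarrow> 'o \<Rightarrow> 'o set" where
  "cell_of C B = {B'. indecomposable C B' \<and> le_LR C B B' \<and> le_LR C B' B}"

definition cells :: "('o, 'm, 'z) mcat_scheme \<Rightarrow> 'o set set" where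
  "cells C = cell_of C ` {B. indecomposable C B}"

definition cell_le :: "('o, 'm, 'z) mcat_scheme \<Rightarrow> 'o set \<Rightarrow> 'o set \<Rightarrow> bool" where
  "cell_le C \<kappa> \<mu> \<longleftrightarrow> (\<exists>B\<in>\<kappa>. \<exists>B'\<in>\<mu>. le_LR C B B')"

definition cell_less :: "('o, 'm, 'z) mcat_scheme \<Rightarrow> 'o set \<Rightarrow> 'o set \<Rightarrow> bool" where
  "cell_less C \<kappa> \<mu> \<longleftrightarrow> cell_le C \<kappa> \<mu> \<and> \<kappa> \<noteq> \<mu>"

definition obj_in_cells :: "('o, 'm, 'z) mcat_scheme \<Rightarrow> ('o set \<Rightarrow> bool) \<Rightarrow> 'o \<Rightarrow> bool" where
  "obj_in_cells C P X \<longleftrightarrow> (\<forall>B. indecomposable C B \<and> is_summand C B X \<longrightarrow> P (cell_of C B))"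

definition cell_order_ideal :: "('o, 'm, 'z) mcat_scheme \<Rightarrow> 'o set set \<Rightarrow> bool" where
  "cell_order_ideal C L \<longleftrightarrow> L \<subseteq> cells C \<and> (\<forall>\<kappa>\<in>L. \<forall>\<mu>\<in>cells C. cell_le C \<mu> \<kappa> \<longrightarrow> \<mu> \<in> L)"

text \<open>The endofunctor \<open>(Lo, Lm)\<close> is left adjoint to \<open>(Ro, Rm)\<close>, by unit and counit.\<close>

definition is_adjoint :: "('o, 'm, 'z) cat_scheme \<Rightarrow> ('o \<Rightarrow> 'o) \<Rightarrow> ('m \<Rightarrow> 'm)
    \<Rightarrow> ('o \<Rightarrow> 'o) \<Rightarrow> ('m \<Rightarrow> 'm) \<Rightarrow> bool" where
  "is_adjoint C Lo Lm Ro Rm \<longleftrightarrow> (\<exists>\<eta> \<epsilon>.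
     (\<forall>X. \<eta> X \<in> Hom C X (Ro (Lo X)) \<and> \<epsilon> X \<in> Hom C (Lo (Ro X)) X) \<and>
     (\<forall>X Y. \<forall>f \<in> Hom C X Y. \<eta> Y \<bullet>\<^bsub>C\<^esub> f = Rm (Lm f) \<bullet>\<^bsub>C\<^esub> \<eta> X \<and>
        f \<bullet>\<^bsub>C\<^esub> \<epsilon> X = \<epsilon> Y \<bullet>\<^bsub>C\<^esub> Lm (Rm f)) \<and>
     (\<forall>X. \<epsilon> (Lo X) \<bullet>\<^bsub>C\<^esub> Lm (\<eta> X) = Ide C (Lo X) \<and>
        Rm (\<epsilon> X) \<bullet>\<^bsub>C\<^esub> \<eta> (Ro X) = Ide C (Ro X)))"

definition right_tensor_adjoint :: "('o, 'm, 'z) mcat_scheme \<Rightarrow> 'o \<Rightarrow> 'o \<Rightarrow> bool" where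
  "right_tensor_adjoint C B B' \<longleftrightarrow>
     is_adjoint C (\<lambda>X. X \<boxtimes>\<^bsub>C\<^esub> B) (\<lambda>f. f \<star>\<^bsub>C\<^esub> Ide C B) (\<lambda>X. X \<boxtimes>\<^bsub>C\<^esub> B') (\<lambda>f. f \<star>\<^bsub>C\<^esub> Ide C B')"

locale cell_category = graded_monoidal_krull_schmidt_category C
  for C :: "('o, 'm, 'g :: ab_group_add, 'z) gcat_scheme" (structure) +
  assumes cell_dual: "indecomposable C B \<Longrightarrow>
      \<exists>B'. obj_in_cells C (\<lambda>\<mu>. \<mu> = cell_of C B) B' \<and>
        right_tensor_adjoint C B B' \<and> right_tensor_adjoint C B' B"
    and cell_absorb: "indecomposable C B \<Longrightarrow>
      \<exists>B' \<in> cell_of C B. is_summand C B (B \<boxtimes> B')"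

section \<open>Bounded complexes up to homotopy\<close>

text \<open>\<open>Df K n\<close> is the differential from degree \<open>n\<close> to degree \<open>n + 1\<close>. Chain maps and homotopies are
  families of morphisms indexed by the degree of their source.\<close>

record ('o, 'm) cochain =
  Ob :: "int \<Rightarrow> 'o"
  Df :: "int \<Rightarrow> 'm"

definition supp :: "('o, 'm, 'z) cat_scheme \<Rightarrow> ('o, 'm) cochain \<Rightarrow> int set" where
  "supp C K = {n. \<not> is_zero_obj C (Ob K n)}"

definition bounded_complex :: "('o, 'm, 'z) cat_scheme \<Rightarrow> ('o, 'm) cochain \<Rightarrow> bool" where
  "bounded_complex C K \<longleftrightarrow>
     (\<forall>n. Df K n \<in> Hom C (Ob K n) (Ob K (n + 1))) \<and>
     (\<forall>n. Df K (n + 1) \<bullet>\<^bsub>C\<^esub> Df K n = Zero C (Ob K n) (Ob K (n + 2))) \<and>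
     finite (supp C K)"

definition chain_map :: "('o, 'm, 'z) cat_scheme \<Rightarrow> ('o, 'm) cochain \<Rightarrow> ('o, 'm) cochain
    \<Rightarrow> (int \<Rightarrow> 'm) \<Rightarrow> bool" where
  "chain_map C K L f \<longleftrightarrow> (\<forall>n. f n \<in> Hom C (Ob K n) (Ob L n)) \<and>
     (\<forall>n. Df L n \<bullet>\<^bsub>C\<^esub> f n = f (n + 1) \<bullet>\<^bsub>C\<^esub> Df K n)"

definition homotopic :: "('o, 'm, 'z) cat_scheme \<Rightarrow> ('o, 'm) cochain \<Rightarrow> ('o, 'm) cochain
    \<Rightarrow> (int \<Rightarrow> 'm) \<Rightarrow> (int \<Rightarrow> 'm) \<Rightarrow> bool" where
  "homotopic C K L f g \<longleftrightarrow> (\<exists>h. (\<forall>n. h n \<in> Hom C (Ob K n) (Ob L (n - 1))) \<and>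
     (\<forall>n. f n = Plus C (g n) (Plus C (Df L (n - 1) \<bullet>\<^bsub>C\<^esub> h n) (h (n + 1) \<bullet>\<^bsub>C\<^esub> Df K n))))"

definition htpy_equiv :: "('o, 'm, 'z) cat_scheme \<Rightarrow> ('o, 'm) cochain \<Rightarrow> ('o, 'm) cochain \<Rightarrow> bool"
  where
  "htpy_equiv C K L \<longleftrightarrow> (\<exists>f g. chain_map C K L f \<and> chain_map C L K g \<and>
     homotopic C K K (\<lambda>n. g n \<bullet>\<^bsub>C\<^esub> f n) (\<lambda>n. Ide C (Ob K n)) \<and>
     homotopic C L L (\<lambda>n. f n \<bullet>\<^bsub>C\<^esub> g n) (\<lambda>n. Ide C (Ob L n)))"

definition complex_iso :: "('o, 'm, 'z) cat_scheme \<Rightarrow> ('o, 'm) cochain \<Rightarrow> ('o, 'm) cochain \<Rightarrow> bool"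
  where
  "complex_iso C K L \<longleftrightarrow> (\<exists>f. chain_map C K L f \<and> (\<forall>n. is_iso C (Ob K n) (Ob L n) (f n)))"

definition stalk :: "('o, 'm, 'z) cat_scheme \<Rightarrow> 'o \<Rightarrow> int \<Rightarrow> ('o, 'm) cochain" where
  "stalk C X k = (let Y = \<lambda>n. if n = k then X else zero_obj C in
     \<lparr>Ob = Y, Df = \<lambda>n. Zero C (Y n) (Y (n + 1))\<rparr>)"

definition zero_complex :: "('o, 'm, 'z) cat_scheme \<Rightarrow> ('o, 'm) cochain" where
  "zero_complex C = \<lparr>Ob = \<lambda>n. zero_obj C, Df = \<lambda>n. Zero C (zero_obj C) (zero_obj C)\<rparr>"

definition sgn_mor :: "('o, 'm, 'z) cat_scheme \<Rightarrow> int \<Rightarrow> 'm \<Rightarrow> 'm" where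
  "sgn_mor C n f = (if even n then f else \<ominus>\<^bsub>homs C (Dom C f) (Cod C f)\<^esub> f)"

definition hshift :: "('o, 'm, 'z) cat_scheme \<Rightarrow> int \<Rightarrow> ('o, 'm) cochain \<Rightarrow> ('o, 'm) cochain" where
  "hshift C b K = \<lparr>Ob = \<lambda>n. Ob K (n + b), Df = \<lambda>n. sgn_mor C b (Df K (n + b))\<rparr>"

definition gshift :: "('o, 'm, 'g, 'z) gcat_scheme \<Rightarrow> 'g \<Rightarrow> ('o, 'm) cochain \<Rightarrow> ('o, 'm) cochain"
  where
  "gshift C a K = \<lparr>Ob = \<lambda>n. ShO C a (Ob K n), Df = \<lambda>n. ShM C a (Df K n)\<rparr>"

text \<open>The functor \<open>(a)[b]\<close>.\<close>

definition Sigma_shift :: "('o, 'm, 'g, 'z) gcat_scheme \<Rightarrow> 'g \<Rightarrow> int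
    \<Rightarrow> ('o, 'm) cochain \<Rightarrow> ('o, 'm) cochain" where
  "Sigma_shift C a b K = hshift C b (gshift C a K)"

text \<open>In degree \<open>n\<close> the cone of \<open>f : K \<rightarrow> L\<close> is \<open>K\<^sup>n\<^sup>+\<^sup>1 \<oplus> L\<^sup>n\<close>, with differential
  \<open>(x, y) \<mapsto> (- d x, f x + d y)\<close>.\<close>

definition cone :: "('o, 'm, 'z) cat_scheme \<Rightarrow> ('o, 'm) cochain \<Rightarrow> ('o, 'm) cochain
    \<Rightarrow> (int \<Rightarrow> 'm) \<Rightarrow> ('o, 'm) cochain" where
  "cone C K L f = (let X = \<lambda>n. pair (Ob K (n + 1)) (Ob L n);
       inj = \<lambda>n. bp_in C {0, 1} (X n); pr = \<lambda>n. bp_pr C {0, 1} (X n) in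
     \<lparr>Ob = \<lambda>n. bp_obj C {0, 1} (X n),
      Df = \<lambda>n. Plus C (inj (n + 1) 0 \<bullet>\<^bsub>C\<^esub> sgn_mor C 1 (Df K (n + 1)) \<bullet>\<^bsub>C\<^esub> pr n 0)
             (Plus C (inj (n + 1) 1 \<bullet>\<^bsub>C\<^esub> f (n + 1) \<bullet>\<^bsub>C\<^esub> pr n 0)
                     (inj (n + 1) 1 \<bullet>\<^bsub>C\<^esub> Df L n \<bullet>\<^bsub>C\<^esub> pr n 1))\<rparr>)"

text \<open>Degree \<open>n\<close> of \<open>K \<otimes> L\<close> is the sum of all \<open>K\<^sup>i \<otimes> L\<^sup>n\<^sup>-\<^sup>i\<close> in which both factors are nonzero, so
  that the family is finite. The differential on this summand is \<open>d \<otimes> 1 + (-1)\<^sup>i 1 \<otimes> d\<close>; a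
  component whose target is not in the family vanishes.\<close>

definition ten_idx :: "('o, 'm, 'z) cat_scheme \<Rightarrow> ('o, 'm) cochain \<Rightarrow> ('o, 'm) cochain
    \<Rightarrow> int \<Rightarrow> int set" where
  "ten_idx C K L n = {i. i \<in> supp C K \<and> n - i \<in> supp C L}"

definition tensor_complex :: "('o, 'm, 'z) mcat_scheme \<Rightarrow> ('o, 'm) cochain \<Rightarrow> ('o, 'm) cochain
    \<Rightarrow> ('o, 'm) cochain" where
  "tensor_complex C K L = (let
       I = ten_idx C K L;
       X = \<lambda>n i. Ob K i \<boxtimes>\<^bsub>C\<^esub> Ob L (n - i);
       T = \<lambda>n. bp_obj C (I n) (X n);
       inj = \<lambda>n. bp_in C (I n) (X n);
       pr = \<lambda>n. bp_pr C (I n) (X n);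
       z = \<lambda>n. Zero C (T n) (T (n + 1)) in
     \<lparr>Ob = T,
      Df = \<lambda>n. finsum (homs C (T n) (T (n + 1)))
        (\<lambda>i. Plus C
           (if i + 1 \<in> I (n + 1)
            then inj (n + 1) (i + 1) \<bullet>\<^bsub>C\<^esub> (Df K i \<star>\<^bsub>C\<^esub> Ide C (Ob L (n - i))) \<bullet>\<^bsub>C\<^esub> pr n i
            else z n)
           (if i \<in> I (n + 1)
            then inj (n + 1) i \<bullet>\<^bsub>C\<^esub> sgn_mor C i (Ide C (Ob K i) \<star>\<^bsub>C\<^esub> Df L (n - i)) \<bullet>\<^bsub>C\<^esub> pr n i
            else z n))
        (I n)\<rparr>)"

text \<open>Iterated tensor products are bracketed to the right.\<close>

fun tensor_list :: "('o, 'm, 'z) mcat_scheme \<Rightarrow> ('o, 'm) cochain list \<Rightarrow> ('o, 'm) cochain" where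
  "tensor_list C [] = stalk C (Unit C) 0"
| "tensor_list C [K] = K"
| "tensor_list C (K # L # Ks) = tensor_complex C K (tensor_list C (L # Ks))"

definition complex_in_cells :: "('o, 'm, 'z) mcat_scheme \<Rightarrow> ('o set \<Rightarrow> bool)
    \<Rightarrow> ('o, 'm) cochain \<Rightarrow> bool" where
  "complex_in_cells C P K \<longleftrightarrow> (\<forall>n. obj_in_cells C P (Ob K n))"

section \<open>Quotient by the ideal of cells not above a given cell\<close>

definition ideal_not_ge :: "('o, 'm, 'z) mcat_scheme \<Rightarrow> 'o set \<Rightarrow> 'o \<Rightarrow> 'o \<Rightarrow> 'm set" where
  "ideal_not_ge C \<kappa> X Y = {g \<bullet>\<^bsub>C\<^esub> f |f g Z. f \<in> Hom C X Z \<and> g \<in> Hom C Z Y \<and>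
     obj_in_cells C (\<lambda>\<mu>. \<not> cell_le C \<kappa> \<mu>) Z}"

definition mor_class :: "('o, 'm, 'z) cat_scheme \<Rightarrow> ('o \<Rightarrow> 'o \<Rightarrow> 'm set) \<Rightarrow> 'm \<Rightarrow> 'm set" where
  "mor_class C J f = J (Dom C f) (Cod C f) +>\<^bsub>homs C (Dom C f) (Cod C f)\<^esub> f"

definition rep :: "'m set \<Rightarrow> 'm" where
  "rep c = (SOME f. f \<in> c)"

definition quotient_cat :: "('o, 'm, 'z) cat_scheme \<Rightarrow> ('o \<Rightarrow> 'o \<Rightarrow> 'm set) \<Rightarrow> ('o, 'm set) cat" where
  "quotient_cat C J = \<lparr>Arr = mor_class C J ` Arr C,
     Dom = \<lambda>c. Dom C (rep c), Cod = \<lambda>c. Cod C (rep c),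
     Ide = \<lambda>X. mor_class C J (Ide C X),
     Comp = \<lambda>c c'. mor_class C J (rep c \<bullet>\<^bsub>C\<^esub> rep c'),
     Zero = \<lambda>X Y. mor_class C J (Zero C X Y),
     Plus = \<lambda>c c'. mor_class C J (Plus C (rep c) (rep c'))\<rparr>"

definition quotient_complex :: "('o, 'm, 'z) cat_scheme \<Rightarrow> ('o \<Rightarrow> 'o \<Rightarrow> 'm set)
    \<Rightarrow> ('o, 'm) cochain \<Rightarrow> ('o, 'm set) cochain" where
  "quotient_complex C J K = \<lparr>Ob = Ob K, Df = \<lambda>n. mor_class C J (Df K n)\<rparr>"

section \<open>Twist-like and cell triangular complexes\<close>

definition inverse_complex :: "('o, 'm, 'z) mcat_scheme \<Rightarrow> ('o, 'm) cochain \<Rightarrow> ('o, 'm) cochain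
    \<Rightarrow> bool" where
  "inverse_complex C F G \<longleftrightarrow> bounded_complex C G \<and>
     htpy_equiv C (tensor_complex C F G) (stalk C (Unit C) 0) \<and>
     htpy_equiv C (tensor_complex C G F) (stalk C (Unit C) 0)"

definition twist_like :: "('o, 'm, 'z) mcat_scheme \<Rightarrow> ('o, 'm) cochain \<Rightarrow> bool" where
  "twist_like C F \<longleftrightarrow> (\<exists>G. inverse_complex C F G \<and>
     (\<forall>B. \<exists>X. htpy_equiv C (tensor_complex C (tensor_complex C F (stalk C B 0)) G) (stalk C X 0)))"

definition n_obj :: "('o, 'm, 'z) mcat_scheme \<Rightarrow> ('o, 'm) cochain \<Rightarrow> 'o \<Rightarrow> int" where
  "n_obj C F B = (LEAST n. \<exists>K. bounded_complex C K \<and> supp C K \<subseteq> {..n} \<and>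
     htpy_equiv C (tensor_complex C F (stalk C B 0)) K)"

definition n_cell :: "('o, 'm, 'z) mcat_scheme \<Rightarrow> ('o, 'm) cochain \<Rightarrow> 'o set \<Rightarrow> int" where
  "n_cell C F \<kappa> = (THE n. \<forall>B\<in>\<kappa>. n_obj C F B = n)"

definition m_cell :: "('o, 'm, 'z) mcat_scheme \<Rightarrow> ('o, 'm) cochain \<Rightarrow> 'o set \<Rightarrow> int" where
  "m_cell C F \<kappa> = (let Q = quotient_cat C (ideal_not_ge C \<kappa>) in
     GREATEST k. \<exists>K. bounded_complex Q K \<and> supp Q K \<subseteq> {k..} \<and>
       htpy_equiv Q (quotient_complex C (ideal_not_ge C \<kappa>) F) K)"

definition sharp :: "('o, 'm, 'z) mcat_scheme \<Rightarrow> ('o, 'm) cochain \<Rightarrow> bool" where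
  "sharp C F \<longleftrightarrow> (\<forall>\<kappa>\<in>cells C. n_cell C F \<kappa> = m_cell C F \<kappa>)"

definition increasing :: "('o, 'm, 'z) mcat_scheme \<Rightarrow> ('o, 'm) cochain \<Rightarrow> bool" where
  "increasing C F \<longleftrightarrow> (\<forall>\<kappa>\<in>cells C. \<forall>\<mu>\<in>cells C. cell_less C \<kappa> \<mu> \<longrightarrow> m_cell C F \<kappa> < m_cell C F \<mu>)"

text \<open>No differential has an isomorphism \<open>\<phi>\<close> between nonzero objects as a direct summand, where
  summands are taken among morphisms: \<open>(i, j)\<close> is a split inclusion of \<open>\<phi>\<close> into the differential
  with retraction \<open>(p, q)\<close>.\<close>

definition minimal :: "('o, 'm, 'z) cat_scheme \<Rightarrow> ('o, 'm) cochain \<Rightarrow> bool" where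
  "minimal C K \<longleftrightarrow> \<not> (\<exists>n X Y \<phi> i p j q. \<not> is_zero_obj C X \<and> is_iso C X Y \<phi> \<and>
     i \<in> Hom C X (Ob K n) \<and> p \<in> Hom C (Ob K n) X \<and> p \<bullet>\<^bsub>C\<^esub> i = Ide C X \<and>
     j \<in> Hom C Y (Ob K (n + 1)) \<and> q \<in> Hom C (Ob K (n + 1)) Y \<and> q \<bullet>\<^bsub>C\<^esub> j = Ide C Y \<and>
     Df K n \<bullet>\<^bsub>C\<^esub> i = j \<bullet>\<^bsub>C\<^esub> \<phi> \<and> q \<bullet>\<^bsub>C\<^esub> Df K n = \<phi> \<bullet>\<^bsub>C\<^esub> p)"

definition minimal_complex :: "('o, 'm, 'z) cat_scheme \<Rightarrow> ('o, 'm) cochain \<Rightarrow> ('o, 'm) cochain" where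
  "minimal_complex C K = (SOME M. bounded_complex C M \<and> minimal C M \<and> htpy_equiv C K M)"

definition head :: "('o, 'm, 'z) mcat_scheme \<Rightarrow> ('o, 'm) cochain \<Rightarrow> 'o \<Rightarrow> ('o, 'm) cochain" where
  "head C F B = (let n = n_cell C F (cell_of C B) in
     stalk C (Ob (minimal_complex C (tensor_complex C F (stalk C B 0))) n) n)"

text \<open>\<open>a\<close> and \<open>b\<close> encode the shift functors \<open>\<Sigma>\<^sub>\<kappa> = (a \<kappa>)[b \<kappa>]\<close>.\<close>

definition cell_triangular :: "('o, 'm, 'g, 'z) gcat_scheme \<Rightarrow> ('o, 'm) cochain
    \<Rightarrow> ('o set \<Rightarrow> 'g) \<Rightarrow> ('o set \<Rightarrow> int) \<Rightarrow> bool" where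
  "cell_triangular C F a b \<longleftrightarrow> twist_like C F \<and> sharp C F \<and> increasing C F \<and>
     (\<forall>\<kappa>\<in>cells C. \<forall>B\<in>\<kappa>. complex_iso C (head C F B) (Sigma_shift C (a \<kappa>) (b \<kappa>) (stalk C B 0)))"

definition cell_equivalence :: "('o, 'm, 'g, 'z) gcat_scheme \<Rightarrow> ('o, 'm) cochain
    \<Rightarrow> 'o set \<Rightarrow> 'g \<Rightarrow> int \<Rightarrow> (int \<Rightarrow> 'm) \<Rightarrow> bool" where
  "cell_equivalence C F \<kappa> a b \<alpha> \<longleftrightarrow>
     chain_map C (Sigma_shift C a b (stalk C (Unit C) 0)) F \<alpha> \<and>
     (\<forall>B. obj_in_cells C (\<lambda>\<mu>. \<mu> = \<kappa>) B \<longrightarrow>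
        (\<exists>K. bounded_complex C K \<and> complex_in_cells C (\<lambda>\<mu>. cell_less C \<mu> \<kappa>) K \<and>
           htpy_equiv C
             (tensor_complex C (cone C (Sigma_shift C a b (stalk C (Unit C) 0)) F \<alpha>) (stalk C B 0))
             K))"

end

theory Submission
  imports Defs
begin

text \<open>
  For a set \<open>L\<close> of cells let \<open>J(L)\<close> be the ideal of morphisms spanned by those that factor through an
  indecomposable object whose cell is in \<open>L\<close>, and let \<open>L(m) = {\<kappa>\<^sub>1, \<dots>, \<kappa>\<^sub>m}\<close>. Every complex is
  contractible modulo \<open>J\<close> of all cells, and \<open>J({}) = 0\<close>, so it suffices that tensoring with
  \<open>A = Cone(\<alpha>\<^sub>m)\<close> turns a complex \<open>K\<close> that is contractible modulo \<open>J(L(m))\<close> into one that is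
  contractible modulo \<open>J(L(m - 1))\<close>. By the equivalence property, and because \<open>L(m - 1)\<close> is an ideal,
  \<open>A \<otimes> Y\<close> is contractible modulo \<open>J(L(m - 1))\<close> for each indecomposable \<open>Y\<close> in a cell of \<open>L(m)\<close>;
  hence \<open>A \<otimes> \<phi>\<close> is null-homotopic modulo \<open>J(L(m - 1))\<close> for each \<open>\<phi>\<close> in \<open>J(L(m))\<close>. Combining these homotopies with the
  contraction of \<open>K\<close> shows that the identity of \<open>A \<otimes> K\<close> is homotopic to a map that is nilpotent
  modulo \<open>J(L(m - 1))\<close>. Working with ideals of morphisms avoids minimal complexes and the
  uniqueness part of the Krull-Schmidt theorem.
\<close>

section \<open>Calculus in preadditive categories\<close>

text \<open>The objects of \<open>K\<close> need not lie in cells of \<open>L(m)\<close>; only the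
  error p of its contraction id = p + d t + t d lies in the ideal of \<open>L(m)\<close>. This is
  why null-homotopies are wanted for A \<otimes> \<phi> with \<phi> a morphism, and not only for A
  \<otimes> Y. The obstacle is that the null-homotopies of 1 \<otimes> p_j are chosen separately for
  each degree j of \<open>K\<close>, so they need not be compatible with the differential of
  \<open>K\<close>, and adding them to the contraction of \<open>K\<close> does not yet contract A
  \<otimes> K. The defect goes from A^i \<otimes> K^j to A^(i-1) \<otimes> K^(j+1): it lowers the
  degree in A, and A is bounded. That is the source of nilpotency. Nilpotency is enough because a
  composite of maps homotopic to the identity is again homotopic to the identity, so a high power
  gives a contraction modulo the smaller ideal. The product is consumed from its right end, where
  the last cells of the ordering stand, since a \<lambda>-equivalence controls products with the
  cone as left factor.\<close>

lemma homs_simps [simp]: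
  "carrier (homs C X Y) = Hom C X Y" "add (homs C X Y) = Plus C"
  "zero (homs C X Y) = Zero C X Y" "mult (homs C X Y) = Comp C" "one (homs C X Y) = Ide C X"
  by (simp_all add: homs_def)

lemma in_HomD [dest]:
  assumes "f \<in> Hom C X Y"
  shows "f \<in> Arr C" "Dom C f = X" "Cod C f = Y"
  using assms by (auto simp: Hom_def)

text \<open>Unfolding \<open>Hom\<close> like this turns composability into equations between
  \<open>Dom\<close> and \<open>Cod\<close>, which simp rules can discharge. Conditions of the form
  \<open>f \<in> Hom C X Y\<close> would leave the intermediate objects as free variables of the
  rules.\<close>

lemma in_Hom_iff: "f \<in> Hom C X Y \<longleftrightarrow> f \<in> Arr C \<and> Dom C f = X \<and> Cod C f = Y"
  by (simp add: Hom_def)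

context preadditive_category
begin

abbreviation plus (infixl "\<boxplus>" 65) where "f \<boxplus> g \<equiv> Plus C f g"
text \<open>Negation is the sign with exponent 1, so that it shares its rules with the signs of
  shifts, cones and tensor products.\<close>

abbreviation neg where "neg f \<equiv> sgn_mor C 1 f"

lemma ide_arr [simp]: "Ide C X \<in> Arr C" "Dom C (Ide C X) = X" "Cod C (Ide C X) = X"
  using ide_in_hom by (auto simp: in_Hom_iff)

lemma comp_arr [simp]:
  assumes "f \<in> Arr C" "g \<in> Arr C" "Dom C g = Cod C f"
  shows "g \<bullet> f \<in> Arr C" "Dom C (g \<bullet> f) = Dom C f" "Cod C (g \<bullet> f) = Cod C g"
  using comp_in_hom[of f "Dom C f" "Cod C f" g "Cod C g"] assms by (auto simp: in_Hom_iff)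

lemma assoc [simp]:
  assumes "f \<in> Arr C" "g \<in> Arr C" "h \<in> Arr C" "Dom C g = Cod C f" "Dom C h = Cod C g"
  shows "(h \<bullet> g) \<bullet> f = h \<bullet> (g \<bullet> f)"
  using comp_assoc[of f "Dom C f" "Cod C f" g "Cod C g" h "Cod C h"] assms
  by (auto simp: in_Hom_iff)

lemma ide_right [simp]: "\<lbrakk>f \<in> Arr C; Dom C f = X\<rbrakk> \<Longrightarrow> f \<bullet> Ide C X = f"
  using comp_ide_right by (auto simp: in_Hom_iff)

lemma ide_left [simp]: "\<lbrakk>f \<in> Arr C; Cod C f = X\<rbrakk> \<Longrightarrow> Ide C X \<bullet> f = f"
  using comp_ide_left by (auto simp: in_Hom_iff)

lemma zero_arr [simp]:
  "Zero C X Y \<in> Arr C" "Dom C (Zero C X Y) = X" "Cod C (Zero C X Y) = Y"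
proof -
  interpret abelian_group "homs C X Y" by (rule hom_abelian_group)
  show "Zero C X Y \<in> Arr C" "Dom C (Zero C X Y) = X" "Cod C (Zero C X Y) = Y"
    using zero_closed by (auto simp: in_Hom_iff)
qed

lemma plus_arr [simp]:
  assumes "f \<in> Arr C" "g \<in> Arr C" "Dom C g = Dom C f" "Cod C g = Cod C f"
  shows "f \<boxplus> g \<in> Arr C" "Dom C (f \<boxplus> g) = Dom C f" "Cod C (f \<boxplus> g) = Cod C f"
proof -
  interpret abelian_group "homs C (Dom C f) (Cod C f)" by (rule hom_abelian_group)
  show "f \<boxplus> g \<in> Arr C" "Dom C (f \<boxplus> g) = Dom C f" "Cod C (f \<boxplus> g) = Cod C f"
    using add.m_closed[of f g] assms by (auto simp: in_Hom_iff)
qed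

lemma plus_ac:
  assumes "f \<in> Arr C" "g \<in> Arr C" "Dom C g = Dom C f" "Cod C g = Cod C f"
  shows plus_commute: "f \<boxplus> g = g \<boxplus> f"
    and plus_assoc: "\<lbrakk>h \<in> Arr C; Dom C h = Dom C f; Cod C h = Cod C f\<rbrakk>
      \<Longrightarrow> (f \<boxplus> g) \<boxplus> h = f \<boxplus> (g \<boxplus> h)"
    and plus_left_commute: "\<lbrakk>h \<in> Arr C; Dom C h = Dom C f; Cod C h = Cod C f\<rbrakk>
      \<Longrightarrow> f \<boxplus> (g \<boxplus> h) = g \<boxplus> (f \<boxplus> h)"
proof -
  interpret abelian_group "homs C (Dom C f) (Cod C f)" by (rule hom_abelian_group)
  show "f \<boxplus> g = g \<boxplus> f" using a_comm[of f g] assms by (auto simp: in_Hom_iff)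
  show "(f \<boxplus> g) \<boxplus> h = f \<boxplus> (g \<boxplus> h)" "f \<boxplus> (g \<boxplus> h) = g \<boxplus> (f \<boxplus> h)"
    if "h \<in> Arr C" "Dom C h = Dom C f" "Cod C h = Cod C f"
    using a_assoc[of f g h] a_lcomm[of f g h] assms that by (auto simp: in_Hom_iff)
qed

lemma plus_zero [simp]:
  assumes "f \<in> Arr C" "Dom C f = X" "Cod C f = Y"
  shows "f \<boxplus> Zero C X Y = f" "Zero C X Y \<boxplus> f = f"
proof -
  interpret abelian_group "homs C X Y" by (rule hom_abelian_group)
  show "f \<boxplus> Zero C X Y = f" "Zero C X Y \<boxplus> f = f"
    using r_zero[of f] l_zero[of f] assms by (auto simp: in_Hom_iff)
qed

lemma plus_cancel:
  assumes "f \<boxplus> g = f \<boxplus> h" "f \<in> Arr C" "g \<in> Arr C" "h \<in> Arr C"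
    "Dom C g = Dom C f" "Cod C g = Cod C f" "Dom C h = Dom C f" "Cod C h = Cod C f"
  shows "g = h"
proof -
  interpret abelian_group "homs C (Dom C f) (Cod C f)" by (rule hom_abelian_group)
  show ?thesis using add.right_cancel[of f g h] a_comm[of f g] a_comm[of f h] assms by (auto simp: in_Hom_iff)
qed

lemma comp_plus [simp]:
  shows "\<lbrakk>f \<in> Arr C; g \<in> Arr C; h \<in> Arr C; Dom C g = Dom C f; Cod C g = Cod C f; Dom C h = Cod C f\<rbrakk>
      \<Longrightarrow> h \<bullet> (f \<boxplus> g) = (h \<bullet> f) \<boxplus> (h \<bullet> g)"
    and "\<lbrakk>f \<in> Arr C; g \<in> Arr C; h \<in> Arr C; Dom C g = Cod C f; Dom C h = Dom C g; Cod C h = Cod C g\<rbrakk>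
      \<Longrightarrow> (g \<boxplus> h) \<bullet> f = (g \<bullet> f) \<boxplus> (h \<bullet> f)"
  using comp_plus_left comp_plus_right by (auto simp: in_Hom_iff)

text \<open>Additive operations preserve 0 because 0 + 0 = 0 is mapped to an equation of this form;
  used for composition and for the tensor product.\<close>

lemma plus_idem_zero:
  assumes "f \<boxplus> f = f" "f \<in> Arr C"
  shows "f = Zero C (Dom C f) (Cod C f)"
  using plus_cancel[of f f "Zero C (Dom C f) (Cod C f)"] assms by simp

lemma comp_zero [simp]:
  "\<lbrakk>f \<in> Arr C; Dom C f = Y\<rbrakk> \<Longrightarrow> f \<bullet> Zero C X Y = Zero C X (Cod C f)"
  "\<lbrakk>f \<in> Arr C; Cod C f = X\<rbrakk> \<Longrightarrow> Zero C X Y \<bullet> f = Zero C (Dom C f) Y"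
proof -
  assume f: "f \<in> Arr C" "Dom C f = Y"
  have "f \<bullet> Zero C X Y \<boxplus> f \<bullet> Zero C X Y = f \<bullet> Zero C X Y"
    using comp_plus(1)[of "Zero C X Y" "Zero C X Y" f] f by simp
  from plus_idem_zero[OF this] f show "f \<bullet> Zero C X Y = Zero C X (Cod C f)" by simp
next
  assume f: "f \<in> Arr C" "Cod C f = X"
  have "Zero C X Y \<bullet> f \<boxplus> Zero C X Y \<bullet> f = Zero C X Y \<bullet> f"
    using comp_plus(2)[of f "Zero C X Y" "Zero C X Y"] f by simp
  from plus_idem_zero[OF this] f show "Zero C X Y \<bullet> f = Zero C (Dom C f) Y" by simp
qed

lemma sgn_arr [simp]:
  assumes "f \<in> Arr C"
  shows "sgn_mor C n f \<in> Arr C" "Dom C (sgn_mor C n f) = Dom C f" "Cod C (sgn_mor C n f) = Cod C f"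
proof -
  interpret abelian_group "homs C (Dom C f) (Cod C f)" by (rule hom_abelian_group)
  show "sgn_mor C n f \<in> Arr C" "Dom C (sgn_mor C n f) = Dom C f" "Cod C (sgn_mor C n f) = Cod C f"
    using a_inv_closed[of f] assms by (auto simp: in_Hom_iff sgn_mor_def)
qed

lemma plus_neg [simp]:
  assumes "f \<in> Arr C"
  shows "f \<boxplus> neg f = Zero C (Dom C f) (Cod C f)" "neg f \<boxplus> f = Zero C (Dom C f) (Cod C f)"
proof -
  interpret abelian_group "homs C (Dom C f) (Cod C f)" by (rule hom_abelian_group)
  show "f \<boxplus> neg f = Zero C (Dom C f) (Cod C f)" "neg f \<boxplus> f = Zero C (Dom C f) (Cod C f)"
    using r_neg[of f] l_neg[of f] assms by (auto simp: in_Hom_iff sgn_mor_def)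
qed

lemma neg_unique:
  assumes "f \<boxplus> g = Zero C (Dom C f) (Cod C f)" "f \<in> Arr C" "g \<in> Arr C"
    "Dom C g = Dom C f" "Cod C g = Cod C f"
  shows "g = neg f"
  using plus_cancel[of f g "neg f"] assms by simp

lemma sgn_even [simp]: "even n \<Longrightarrow> sgn_mor C n f = f"
  by (simp add: sgn_mor_def)

text \<open>A statement about an arbitrary sign is thereby reduced to the identity, which is
  trivial, and to \<open>neg\<close>.\<close>

lemma sgn_cases:
  obtains "sgn_mor C n = (\<lambda>f. f)" | "sgn_mor C n = sgn_mor C 1"
  unfolding sgn_mor_def by (cases "even n") auto

lemma neg_neg [simp]: "f \<in> Arr C \<Longrightarrow> neg (neg f) = f"
  by (rule neg_unique[of "neg f" f, symmetric]) simp_all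

lemma neg_zero [simp]: "neg (Zero C X Y) = Zero C X Y"
  by (rule neg_unique[symmetric]) simp_all

lemma neg_comp:
  assumes "f \<in> Arr C" "g \<in> Arr C" "Dom C g = Cod C f"
  shows "neg g \<bullet> f = neg (g \<bullet> f)" "g \<bullet> neg f = neg (g \<bullet> f)"
proof -
  show "neg g \<bullet> f = neg (g \<bullet> f)"
    using assms comp_plus(2)[of f g "neg g"] by (intro neg_unique) simp_all
  show "g \<bullet> neg f = neg (g \<bullet> f)"
    using assms comp_plus(1)[of f "neg f" g] by (intro neg_unique) simp_all
qed

lemma neg_plus:
  assumes "f \<in> Arr C" "g \<in> Arr C" "Dom C g = Dom C f" "Cod C g = Cod C f"
  shows "neg (f \<boxplus> g) = neg f \<boxplus> neg g"
proof (rule neg_unique[symmetric])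
  have "(f \<boxplus> g) \<boxplus> (neg f \<boxplus> neg g) = (f \<boxplus> neg f) \<boxplus> (g \<boxplus> neg g)"
    using assms by (simp only: plus_assoc plus_left_commute plus_arr sgn_arr)
  then show "(f \<boxplus> g) \<boxplus> (neg f \<boxplus> neg g) = Zero C (Dom C (f \<boxplus> g)) (Cod C (f \<boxplus> g))"
    using assms by simp
qed (use assms in simp_all)

lemma sgn_comp [simp]:
  assumes "f \<in> Arr C" "g \<in> Arr C" "Dom C g = Cod C f"
  shows "sgn_mor C n g \<bullet> f = sgn_mor C n (g \<bullet> f)" "g \<bullet> sgn_mor C n f = sgn_mor C n (g \<bullet> f)"
  by (cases n rule: sgn_cases; use assms in \<open>simp add: neg_comp\<close>)+

lemma sgn_plus [simp]:
  assumes "f \<in> Arr C" "g \<in> Arr C" "Dom C g = Dom C f" "Cod C g = Cod C f"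
  shows "sgn_mor C n (f \<boxplus> g) = sgn_mor C n f \<boxplus> sgn_mor C n g"
  by (cases n rule: sgn_cases; use assms in \<open>simp add: neg_plus\<close>)

lemma sgn_zero [simp]: "sgn_mor C n (Zero C X Y) = Zero C X Y"
  by (cases n rule: sgn_cases; simp)

lemma sgn_sgn:
  assumes "f \<in> Arr C"
  shows "sgn_mor C m (sgn_mor C n f) = sgn_mor C (m + n) f"
proof -
  have "sgn_mor C k f = (if even k then f else neg f)" for k
    by (auto simp: sgn_mor_def)
  moreover have "sgn_mor C k (neg f) = (if even k then neg f else f)" for k
    using neg_neg[OF assms] sgn_arr[OF assms, of 1] by (auto simp: sgn_mor_def)
  ultimately show ?thesis by (metis even_add)
qed

lemma zero_obj_arr:
  assumes "is_zero_obj C X" "f \<in> Arr C"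
  shows "Dom C f = X \<Longrightarrow> f = Zero C X (Cod C f)" "Cod C f = X \<Longrightarrow> f = Zero C (Dom C f) X"
proof -
  show "Dom C f = X \<Longrightarrow> f = Zero C X (Cod C f)"
    using assms ide_right[of f X] comp_zero(1)[of f X X] by (auto simp: is_zero_obj_def)
  show "Cod C f = X \<Longrightarrow> f = Zero C (Dom C f) X"
    using assms ide_left[of f X] comp_zero(2)[of f X X] by (auto simp: is_zero_obj_def)
qed

lemma finsum_comp:
  assumes "finite I" "u \<in> Hom C Y X" "\<And>i. i \<in> I \<Longrightarrow> F i \<in> Hom C X Z"
  shows "finsum (homs C X Z) F I \<in> Hom C X Z"
    and "finsum (homs C X Z) F I \<bullet> u = finsum (homs C Y Z) (\<lambda>i. F i \<bullet> u) I"
proof -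
  interpret XZ: abelian_group "homs C X Z" by (rule hom_abelian_group)
  interpret YZ: abelian_group "homs C Y Z" by (rule hom_abelian_group)
  have *: "finsum (homs C X Z) F I \<in> Hom C X Z \<and>
    finsum (homs C X Z) F I \<bullet> u = finsum (homs C Y Z) (\<lambda>i. F i \<bullet> u) I"
    using assms(1,3)
  proof (induction I)
    case empty
    then show ?case using assms(2) by (auto simp: in_Hom_iff)
  next
    case (insert i I)
    have F: "F \<in> I \<rightarrow> Hom C X Z" "F i \<in> Hom C X Z" using insert.prems by auto
    have Fu: "(\<lambda>i. F i \<bullet> u) \<in> I \<rightarrow> Hom C Y Z" "F i \<bullet> u \<in> Hom C Y Z"
      using insert.prems comp_in_hom[OF assms(2)] by auto
    have IH: "finsum (homs C X Z) F I \<in> Hom C X Z"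
      "finsum (homs C X Z) F I \<bullet> u = finsum (homs C Y Z) (\<lambda>i. F i \<bullet> u) I"
      using insert by auto
    show ?case using F Fu IH insert.hyps assms(2) XZ.add.m_closed[of "F i" "finsum (homs C X Z) F I"]
      by (simp add: XZ.finsum_insert YZ.finsum_insert comp_plus_left)
  qed
  then show "finsum (homs C X Z) F I \<in> Hom C X Z"
    and "finsum (homs C X Z) F I \<bullet> u = finsum (homs C Y Z) (\<lambda>i. F i \<bullet> u) I" by auto
qed

lemma comp_finsum:
  assumes "finite I" "u \<in> Hom C Z Y" "\<And>i. i \<in> I \<Longrightarrow> F i \<in> Hom C X Z"
  shows "u \<bullet> finsum (homs C X Z) F I = finsum (homs C X Y) (\<lambda>i. u \<bullet> F i) I"
proof -
  interpret XZ: abelian_group "homs C X Z" by (rule hom_abelian_group)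
  interpret XY: abelian_group "homs C X Y" by (rule hom_abelian_group)
  show ?thesis using assms(1,3)
  proof (induction I)
    case empty
    then show ?case using assms(2) by (auto simp: in_Hom_iff)
  next
    case (insert i I)
    have F: "F \<in> I \<rightarrow> Hom C X Z" "F i \<in> Hom C X Z" using insert.prems by auto
    have Fu: "(\<lambda>i. u \<bullet> F i) \<in> I \<rightarrow> Hom C X Y" "u \<bullet> F i \<in> Hom C X Y"
      using insert.prems comp_in_hom[OF _ assms(2)] by auto
    have IH: "finsum (homs C X Z) F I \<in> Hom C X Z"
      "u \<bullet> finsum (homs C X Z) F I = finsum (homs C X Y) (\<lambda>i. u \<bullet> F i) I"
      using insert finsum_comp(1)[OF _ ide_in_hom, of I F X Z] by auto
    show ?case using F Fu IH insert.hyps assms(2)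
      by (simp add: XZ.finsum_insert XY.finsum_insert comp_plus_right)
  qed
qed

end

section \<open>Ideals of morphisms\<close>

text \<open>Closure under negation follows by composing with \<open>neg (Ide C X)\<close>. The
  ideals are ideals for composition and addition, with no clause about tensor products.\<close>

definition two_sided_ideal :: "('o, 'm, 'z) cat_scheme \<Rightarrow> ('o \<Rightarrow> 'o \<Rightarrow> 'm set) \<Rightarrow> bool" where
  "two_sided_ideal C J \<longleftrightarrow> (\<forall>X Y. J X Y \<subseteq> Hom C X Y \<and> Zero C X Y \<in> J X Y \<and>
     (\<forall>f\<in>J X Y. \<forall>g\<in>J X Y. Plus C f g \<in> J X Y) \<and>
     (\<forall>f\<in>J X Y. \<forall>Z. (\<forall>g\<in>Hom C Y Z. g \<bullet>\<^bsub>C\<^esub> f \<in> J X Z) \<and> (\<forall>g\<in>Hom C Z X. f \<bullet>\<^bsub>C\<^esub> g \<in> J Z Y)))"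

lemma two_sided_idealD:
  assumes "two_sided_ideal C J"
  shows ideal_in_hom: "f \<in> J X Y \<Longrightarrow> f \<in> Hom C X Y"
    and ideal_zero: "Zero C X Y \<in> J X Y"
    and ideal_plus: "\<lbrakk>f \<in> J X Y; g \<in> J X Y\<rbrakk> \<Longrightarrow> Plus C f g \<in> J X Y"
    and ideal_comp_left: "\<lbrakk>f \<in> J X Y; g \<in> Hom C Y Z\<rbrakk> \<Longrightarrow> g \<bullet>\<^bsub>C\<^esub> f \<in> J X Z"
    and ideal_comp_right: "\<lbrakk>f \<in> J X Y; g \<in> Hom C Z X\<rbrakk> \<Longrightarrow> f \<bullet>\<^bsub>C\<^esub> g \<in> J Z Y"
  using assms unfolding two_sided_ideal_def by blast+

text \<open>A member is a finite sum of composites through objects of \<open>S\<close>, nested to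
  the right so that induction removes one composite at a time. Spanning by single objects of
  \<open>S\<close>, instead of factoring once through a direct sum of them, makes closure under
  addition immediate.\<close>

inductive_set factor_ideal :: "('o, 'm, 'z) cat_scheme \<Rightarrow> 'o set \<Rightarrow> 'o \<Rightarrow> 'o \<Rightarrow> 'm set"
  for C :: "('o, 'm, 'z) cat_scheme" and S :: "'o set" and X Y :: 'o where
  zero: "Zero C X Y \<in> factor_ideal C S X Y"
| plus: "\<lbrakk>B \<in> S; u \<in> Hom C X B; v \<in> Hom C B Y; r \<in> factor_ideal C S X Y\<rbrakk>
    \<Longrightarrow> Plus C (v \<bullet>\<^bsub>C\<^esub> u) r \<in> factor_ideal C S X Y"

section \<open>Biproducts\<close>

text \<open>A biproduct of a family indexed by all integers, only finitely many of which are nonzero.\<close>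

definition biproduct_family :: "('o, 'm, 'z) cat_scheme \<Rightarrow> (int \<Rightarrow> 'o) \<Rightarrow> 'o
    \<Rightarrow> (int \<Rightarrow> 'm) \<Rightarrow> (int \<Rightarrow> 'm) \<Rightarrow> bool" where
  "biproduct_family C X S \<iota> \<pi> \<longleftrightarrow> (\<exists>I. is_biproduct C I X S \<iota> \<pi> \<and>
     (\<forall>i. i \<notin> I \<longrightarrow> is_zero_obj C (X i) \<and> \<iota> i = Zero C (X i) S \<and> \<pi> i = Zero C S (X i)))"

context preadditive_category
begin

lemma factor_ideal_in_hom: "f \<in> factor_ideal C S X Y \<Longrightarrow> f \<in> Hom C X Y"
  by (induction rule: factor_ideal.induct) (auto simp: in_Hom_iff)

lemma factor_idealI:
  assumes "B \<in> S" "u \<in> Hom C X B" "v \<in> Hom C B Y"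
  shows "v \<bullet> u \<in> factor_ideal C S X Y"
  using factor_ideal.plus[OF assms factor_ideal.zero] assms by (auto simp: in_Hom_iff)

lemma two_sided_ideal_factor_ideal: "two_sided_ideal C (factor_ideal C S)"
proof -
  have plus: "f \<boxplus> g \<in> factor_ideal C S X Y"
    if "f \<in> factor_ideal C S X Y" "g \<in> factor_ideal C S X Y" for f g X Y
    using that
  proof (induction rule: factor_ideal.induct)
    case zero
    then show ?case using factor_ideal_in_hom[OF zero] by (auto simp: in_Hom_iff)
  next
    case (plus B u v r)
    have "(v \<bullet> u \<boxplus> r) \<boxplus> g = v \<bullet> u \<boxplus> (r \<boxplus> g)"
      using plus factor_ideal_in_hom by (intro plus_assoc) (auto simp: in_Hom_iff)
    then show ?case using factor_ideal.plus[OF plus(1-3) plus.IH[OF plus.prems]] by simp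
  qed
  moreover have "g \<bullet> f \<in> factor_ideal C S X Z"
    if "f \<in> factor_ideal C S X Y" "g \<in> Hom C Y Z" for f g X Y Z
    using that
  proof (induction rule: factor_ideal.induct)
    case zero
    then show ?case by (auto simp: in_Hom_iff intro: factor_ideal.zero)
  next
    case (plus B u v r)
    have "g \<bullet> (v \<bullet> u \<boxplus> r) = (g \<bullet> v) \<bullet> u \<boxplus> g \<bullet> r"
      using plus.hyps(1-3) plus.prems factor_ideal_in_hom[OF plus.hyps(4)]
      by (auto simp: in_Hom_iff)
    then show ?case
      using factor_ideal.plus[OF plus.hyps(1,2) comp_in_hom[OF plus.hyps(3) plus.prems]
          plus.IH[OF plus.prems]] by simp
  qed
  moreover have "f \<bullet> g \<in> factor_ideal C S Z Y"
    if "f \<in> factor_ideal C S X Y" "g \<in> Hom C Z X" for f g X Y Z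
    using that
  proof (induction rule: factor_ideal.induct)
    case zero
    then show ?case by (auto simp: in_Hom_iff intro: factor_ideal.zero)
  next
    case (plus B u v r)
    have "(v \<bullet> u \<boxplus> r) \<bullet> g = v \<bullet> (u \<bullet> g) \<boxplus> r \<bullet> g"
      using plus.hyps(1-3) plus.prems factor_ideal_in_hom[OF plus.hyps(4)]
      by (auto simp: in_Hom_iff)
    then show ?case
      using factor_ideal.plus[OF plus.hyps(1) comp_in_hom[OF plus.prems plus.hyps(2)] plus.hyps(3)
          plus.IH[OF plus.prems]] by simp
  qed
  ultimately show ?thesis
    unfolding two_sided_ideal_def
    by (intro allI conjI ballI subsetI) (simp_all add: factor_ideal_in_hom factor_ideal.zero)
qed

lemma is_biproductD:
  assumes "is_biproduct C I X S \<iota> \<pi>" "i \<in> I"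
  shows "\<iota> i \<in> Hom C (X i) S" "\<pi> i \<in> Hom C S (X i)" "\<pi> i \<bullet> \<iota> i = Ide C (X i)"
    "\<lbrakk>j \<in> I; j \<noteq> i\<rbrakk> \<Longrightarrow> \<pi> j \<bullet> \<iota> i = Zero C (X i) (X j)"
  using assms by (auto simp: is_biproduct_def)

lemma biproduct_finite: "is_biproduct C I X S \<iota> \<pi> \<Longrightarrow> finite I"
  by (auto simp: is_biproduct_def)

text \<open>Insert the identity of \<open>S\<close> as the sum of all \<iota>_i \<pi>_i before or
  after the morphism.\<close>

lemma biproduct_decompose:
  assumes "is_biproduct C I X S \<iota> \<pi>"
  shows "f \<in> Hom C S Y \<Longrightarrow> f = finsum (homs C S Y) (\<lambda>i. (f \<bullet> \<iota> i) \<bullet> \<pi> i) I"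
    and "g \<in> Hom C Y S \<Longrightarrow> g = finsum (homs C Y S) (\<lambda>i. \<iota> i \<bullet> (\<pi> i \<bullet> g)) I"
proof -
  note bp = is_biproductD[OF assms]
  have 1: "\<iota> i \<bullet> \<pi> i \<in> Hom C S S" if "i \<in> I" for i
    using bp(1,2)[OF that] by (auto intro: comp_in_hom)
  have 2: "finsum (homs C S S) (\<lambda>i. \<iota> i \<bullet> \<pi> i) I = Ide C S" "finite I"
    using assms by (auto simp: is_biproduct_def)
  show "f = finsum (homs C S Y) (\<lambda>i. (f \<bullet> \<iota> i) \<bullet> \<pi> i) I" if f: "f \<in> Hom C S Y"
  proof -
    interpret SY: abelian_group "homs C S Y" by (rule hom_abelian_group)
    have "f = f \<bullet> finsum (homs C S S) (\<lambda>i. \<iota> i \<bullet> \<pi> i) I" using 2 comp_ide_right[OF f] by simp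
    also have "\<dots> = finsum (homs C S Y) (\<lambda>i. f \<bullet> (\<iota> i \<bullet> \<pi> i)) I"
      by (rule comp_finsum[OF 2(2) f 1])
    also have "\<dots> = finsum (homs C S Y) (\<lambda>i. (f \<bullet> \<iota> i) \<bullet> \<pi> i) I"
      using bp(1,2) f by (intro SY.finsum_cong') (auto simp: in_Hom_iff)
    finally show ?thesis .
  qed
  show "g = finsum (homs C Y S) (\<lambda>i. \<iota> i \<bullet> (\<pi> i \<bullet> g)) I" if g: "g \<in> Hom C Y S"
  proof -
    interpret YS: abelian_group "homs C Y S" by (rule hom_abelian_group)
    have "g = finsum (homs C S S) (\<lambda>i. \<iota> i \<bullet> \<pi> i) I \<bullet> g" using 2 comp_ide_left[OF g] by simp
    also have "\<dots> = finsum (homs C Y S) (\<lambda>i. (\<iota> i \<bullet> \<pi> i) \<bullet> g) I"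
      by (rule finsum_comp(2)[OF 2(2) g 1])
    also have "\<dots> = finsum (homs C Y S) (\<lambda>i. \<iota> i \<bullet> (\<pi> i \<bullet> g)) I"
      using bp(1,2) g by (intro YS.finsum_cong') (auto simp: in_Hom_iff)
    finally show ?thesis .
  qed
qed

lemma biproduct_ext:
  assumes "is_biproduct C I X S \<iota> \<pi>"
    and fg: "f \<in> Hom C S Y" "g \<in> Hom C S Y" and eq: "\<And>i. i \<in> I \<Longrightarrow> f \<bullet> \<iota> i = g \<bullet> \<iota> i"
  shows "f = g"
proof -
  interpret SY: abelian_group "homs C S Y" by (rule hom_abelian_group)
  have "finsum (homs C S Y) (\<lambda>i. (f \<bullet> \<iota> i) \<bullet> \<pi> i) I = finsum (homs C S Y) (\<lambda>i. (g \<bullet> \<iota> i) \<bullet> \<pi> i) I"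
    using eq is_biproductD(1,2)[OF assms(1)] fg by (intro SY.finsum_cong') (auto simp: in_Hom_iff)
  then show ?thesis using biproduct_decompose(1)[OF assms(1)] fg by metis
qed

text \<open>The copairing is kept as an explicit sum because the differential of
  \<open>tensor_complex\<close> can be brought into exactly this form.\<close>

lemma biproduct_copair_finsum:
  assumes "is_biproduct C I X S \<iota> \<pi>" "\<And>i. i \<in> I \<Longrightarrow> a i \<in> Hom C (X i) Y"
  shows "finsum (homs C S Y) (\<lambda>i. a i \<bullet> \<pi> i) I \<in> Hom C S Y"
    and "j \<in> I \<Longrightarrow> finsum (homs C S Y) (\<lambda>i. a i \<bullet> \<pi> i) I \<bullet> \<iota> j = a j"
proof -
  note bp = is_biproductD[OF assms(1)]
  have fin: "finite I" using assms(1) by (rule biproduct_finite)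
  have ap: "a i \<bullet> \<pi> i \<in> Hom C S Y" if "i \<in> I" for i
    using that assms(2) bp(2) by (auto intro: comp_in_hom)
  show "finsum (homs C S Y) (\<lambda>i. a i \<bullet> \<pi> i) I \<in> Hom C S Y"
    using finsum_comp(1)[OF fin ide_in_hom, of "\<lambda>i. a i \<bullet> \<pi> i"] ap by blast
  assume j: "j \<in> I"
  interpret XY: abelian_group "homs C (X j) Y" by (rule hom_abelian_group)
  have "finsum (homs C S Y) (\<lambda>i. a i \<bullet> \<pi> i) I \<bullet> \<iota> j
      = finsum (homs C (X j) Y) (\<lambda>i. (a i \<bullet> \<pi> i) \<bullet> \<iota> j) I"
    using fin bp(1)[OF j] ap by (rule finsum_comp(2))
  also have "\<dots> = finsum (homs C (X j) Y) (\<lambda>i. if j = i then a i else Zero C (X j) Y) I"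
  proof (rule XY.finsum_cong')
    fix i assume i: "i \<in> I"
    show "(a i \<bullet> \<pi> i) \<bullet> \<iota> j = (if j = i then a i else Zero C (X j) Y)"
      using assms(2)[OF i] bp(1)[OF j] bp(2)[OF i] bp(3)[OF i] bp(4)[OF j i]
      by (auto simp: in_Hom_iff)
  qed (use assms(2) j in \<open>auto simp: in_Hom_iff\<close>)
  also have "\<dots> = a j"
  proof -
    \<comment> \<open>\<open>finsum_singleton\<close> wants its whole family in one hom-group,
      whereas \<open>a i\<close> starts at \<open>X i\<close>; hence the constant family with value
      \<open>a j\<close>.\<close>
    have "finsum (homs C (X j) Y) (\<lambda>i. if j = i then a i else Zero C (X j) Y) I
      = finsum (homs C (X j) Y) (\<lambda>i. if j = i then a j else Zero C (X j) Y) I"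
      using assms(2)[OF j] by (intro XY.finsum_cong') (auto simp: in_Hom_iff)
    also have "\<dots> = a j"
      using XY.finsum_singleton[OF j fin, of "\<lambda>_. a j", unfolded homs_simps] assms(2)[OF j] by simp
    finally show ?thesis .
  qed
  finally show "finsum (homs C S Y) (\<lambda>i. a i \<bullet> \<pi> i) I \<bullet> \<iota> j = a j" .
qed

lemma biproduct_copair:
  assumes "is_biproduct C I X S \<iota> \<pi>" "\<And>i. i \<in> I \<Longrightarrow> a i \<in> Hom C (X i) Y"
  obtains u where "u \<in> Hom C S Y" "\<And>i. i \<in> I \<Longrightarrow> u \<bullet> \<iota> i = a i"
  using biproduct_copair_finsum[OF assms] that by blast

lemma ideal_finsum:
  assumes "two_sided_ideal C J" "finite I" "\<And>i. i \<in> I \<Longrightarrow> F i \<in> J X Y"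
  shows "finsum (homs C X Y) F I \<in> J X Y"
  using assms(2,3)
proof (induction I)
  case empty
  interpret abelian_group "homs C X Y" by (rule hom_abelian_group)
  show ?case using ideal_zero[OF assms(1)] by simp
next
  case (insert i I)
  interpret abelian_group "homs C X Y" by (rule hom_abelian_group)
  have "F \<in> I \<rightarrow> Hom C X Y" "F i \<in> Hom C X Y"
    using insert.prems ideal_in_hom[OF assms(1)] by auto
  then show ?case using insert ideal_plus[OF assms(1)] by simp
qed

text \<open>By \<open>biproduct_decompose\<close> a morphism is the sum of its components composed
  with projections or injections, so membership in an ideal can be tested on components.\<close>

lemma biproduct_ideal:
  assumes "is_biproduct C I X S \<iota> \<pi>" "two_sided_ideal C J"
  shows "\<lbrakk>f \<in> Hom C S Y; \<And>i. i \<in> I \<Longrightarrow> f \<bullet> \<iota> i \<in> J (X i) Y\<rbrakk> \<Longrightarrow> f \<in> J S Y"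
    and "\<lbrakk>f \<in> Hom C Y S; \<And>i. i \<in> I \<Longrightarrow> \<pi> i \<bullet> f \<in> J Y (X i)\<rbrakk> \<Longrightarrow> f \<in> J Y S"
proof -
  note bp = is_biproductD[OF assms(1)] and fin = biproduct_finite[OF assms(1)]
  assume "f \<in> Hom C S Y" and J: "\<And>i. i \<in> I \<Longrightarrow> f \<bullet> \<iota> i \<in> J (X i) Y"
  moreover have "finsum (homs C S Y) (\<lambda>i. (f \<bullet> \<iota> i) \<bullet> \<pi> i) I \<in> J S Y"
    by (rule ideal_finsum[OF assms(2) fin]) (rule ideal_comp_right[OF assms(2) J bp(2)])
  ultimately show "f \<in> J S Y" using biproduct_decompose(1)[OF assms(1)] by metis
next
  note bp = is_biproductD[OF assms(1)] and fin = biproduct_finite[OF assms(1)]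
  assume "f \<in> Hom C Y S" and J: "\<And>i. i \<in> I \<Longrightarrow> \<pi> i \<bullet> f \<in> J Y (X i)"
  moreover have "finsum (homs C Y S) (\<lambda>i. \<iota> i \<bullet> (\<pi> i \<bullet> f)) I \<in> J Y S"
    by (rule ideal_finsum[OF assms(2) fin]) (rule ideal_comp_left[OF assms(2) J bp(1)])
  ultimately show "f \<in> J Y S" using biproduct_decompose(2)[OF assms(1)] by metis
qed

text \<open>Outside the finite index set all objects are zero, so the biproduct equations persist
  for every integer. Later computations therefore never have to ask whether a neighbouring index is
  still in the family.\<close>

lemma
  assumes "biproduct_family C X S \<iota> \<pi>"
  shows family_in: "\<iota> i \<in> Hom C (X i) S"
    and family_pr: "\<pi> i \<in> Hom C S (X i)"
    and family_pr_in: "\<pi> i \<bullet> \<iota> i = Ide C (X i)"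
    and family_pr_in_neq: "j \<noteq> i \<Longrightarrow> \<pi> j \<bullet> \<iota> i = Zero C (X i) (X j)"
    and family_ext: "\<lbrakk>f \<in> Hom C S Y; g \<in> Hom C S Y; \<And>i. f \<bullet> \<iota> i = g \<bullet> \<iota> i\<rbrakk> \<Longrightarrow> f = g"
    and family_ideal: "\<lbrakk>two_sided_ideal C J; f \<in> Hom C S Y; \<And>i. f \<bullet> \<iota> i \<in> J (X i) Y\<rbrakk> \<Longrightarrow> f \<in> J S Y"
    and family_ideal': "\<lbrakk>two_sided_ideal C J; f' \<in> Hom C Y S; \<And>i. \<pi> i \<bullet> f' \<in> J Y (X i)\<rbrakk> \<Longrightarrow> f' \<in> J Y S"
proof -
  obtain I where bp: "is_biproduct C I X S \<iota> \<pi>"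
    and z: "\<And>i. i \<notin> I \<Longrightarrow> is_zero_obj C (X i)"
      "\<And>i. i \<notin> I \<Longrightarrow> \<iota> i = Zero C (X i) S" "\<And>i. i \<notin> I \<Longrightarrow> \<pi> i = Zero C S (X i)"
    using assms by (auto simp: biproduct_family_def)
  show in_: "\<iota> i \<in> Hom C (X i) S" and pr: "\<pi> i \<in> Hom C S (X i)" for i
    using is_biproductD(1,2)[OF bp] z(2,3)[of i] by (cases "i \<in> I"; simp add: in_Hom_iff)+
  show "\<pi> i \<bullet> \<iota> i = Ide C (X i)"
    using is_biproductD(3)[OF bp] z[of i] by (cases "i \<in> I") (auto simp: is_zero_obj_def)
  show "\<pi> j \<bullet> \<iota> i = Zero C (X i) (X j)" if "j \<noteq> i"
    using is_biproductD(4)[OF bp, of i j] that z[of i] z[of j] in_[of i] pr[of j]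
    by (cases "i \<in> I"; cases "j \<in> I") (auto simp: in_Hom_iff)
  show "\<lbrakk>f \<in> Hom C S Y; g \<in> Hom C S Y; \<And>i. f \<bullet> \<iota> i = g \<bullet> \<iota> i\<rbrakk> \<Longrightarrow> f = g"
    by (rule biproduct_ext[OF bp])
  show "\<lbrakk>two_sided_ideal C J; f \<in> Hom C S Y; \<And>i. f \<bullet> \<iota> i \<in> J (X i) Y\<rbrakk> \<Longrightarrow> f \<in> J S Y"
    by (rule biproduct_ideal(1)[OF bp])
  show "\<lbrakk>two_sided_ideal C J; f' \<in> Hom C Y S; \<And>i. \<pi> i \<bullet> f' \<in> J Y (X i)\<rbrakk> \<Longrightarrow> f' \<in> J Y S"
    by (rule biproduct_ideal(2)[OF bp])
qed

lemma family_copair: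
  assumes "biproduct_family C X S \<iota> \<pi>" "\<And>i. a i \<in> Hom C (X i) Y"
  obtains u where "u \<in> Hom C S Y" "\<And>i. u \<bullet> \<iota> i = a i"
proof -
  obtain I where bp: "is_biproduct C I X S \<iota> \<pi>"
    and z: "\<And>i. i \<notin> I \<Longrightarrow> is_zero_obj C (X i)" "\<And>i. i \<notin> I \<Longrightarrow> \<iota> i = Zero C (X i) S"
    using assms(1) by (auto simp: biproduct_family_def)
  obtain u where u: "u \<in> Hom C S Y" "\<And>i. i \<in> I \<Longrightarrow> u \<bullet> \<iota> i = a i"
    using biproduct_copair[OF bp] assms(2) by blast
  have "u \<bullet> \<iota> i = a i" if "i \<notin> I" for i
    using z[OF that] u(1) zero_obj_arr(1)[of "X i" "a i"] assms(2)[of i] by (auto simp: in_Hom_iff)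
  then show ?thesis using u that by blast
qed

text \<open>Matrix multiplication, with the sum of all \<iota>_i \<pi>_i inserted between
  \<open>f\<close> and \<open>g\<close>. The condition concerns products of entries because in the
  application it depends on the index which of the two factors lies in the ideal.\<close>

lemma family_comp_ideal:
  assumes "biproduct_family C X S \<iota> \<pi>" "two_sided_ideal C J" "f \<in> Hom C Y S" "g \<in> Hom C S Z"
    "\<And>i. (g \<bullet> \<iota> i) \<bullet> (\<pi> i \<bullet> f) \<in> J Y Z"
  shows "g \<bullet> f \<in> J Y Z"
proof -
  obtain I where bp: "is_biproduct C I X S \<iota> \<pi>"
    using assms(1) by (auto simp: biproduct_family_def)
  interpret YZ: abelian_group "homs C Y Z" by (rule hom_abelian_group)
  note hom = family_in[OF assms(1)] family_pr[OF assms(1)]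
  have "g \<bullet> f = g \<bullet> finsum (homs C Y S) (\<lambda>i. \<iota> i \<bullet> (\<pi> i \<bullet> f)) I"
    using biproduct_decompose(2)[OF bp assms(3)] by simp
  also have "\<dots> = finsum (homs C Y Z) (\<lambda>i. g \<bullet> (\<iota> i \<bullet> (\<pi> i \<bullet> f))) I"
    using assms(3,4) hom biproduct_finite[OF bp] by (intro comp_finsum) (auto intro!: comp_in_hom)
  also have "\<dots> \<in> J Y Z"
  proof (rule ideal_finsum[OF assms(2) biproduct_finite[OF bp]])
    show "g \<bullet> (\<iota> i \<bullet> (\<pi> i \<bullet> f)) \<in> J Y Z" for i
      using assms(3,4) assms(5)[of i] hom[of i] by (auto simp: in_Hom_iff)
  qed
  finally show ?thesis .
qed

lemma family_zero_obj:
  assumes "biproduct_family C X S \<iota> \<pi>" "\<And>i. is_zero_obj C (X i)"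
  shows "is_zero_obj C S"
  unfolding is_zero_obj_def
proof (rule family_ext[OF assms(1)])
  show "Ide C S \<bullet> \<iota> i = Zero C S S \<bullet> \<iota> i" for i
    using zero_obj_arr(1)[OF assms(2), of "\<iota> i" i] family_in[OF assms(1), of i]
    by (auto simp: in_Hom_iff)
qed (auto simp: in_Hom_iff)

end

section \<open>Complexes\<close>

lemma bounded_complexD:
  assumes "bounded_complex C K"
  shows "Df K n \<in> Hom C (Ob K n) (Ob K (n + 1))"
    and "Df K (n - 1) \<in> Hom C (Ob K (n - 1)) (Ob K n)"
    and "Df K (n + 1) \<bullet>\<^bsub>C\<^esub> Df K n = Zero C (Ob K n) (Ob K (n + 2))"
    and "Df K n \<bullet>\<^bsub>C\<^esub> Df K (n - 1) = Zero C (Ob K (n - 1)) (Ob K (n + 1))"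
    and "finite (supp C K)"
proof -
  have 1: "\<And>n. Df K n \<in> Hom C (Ob K n) (Ob K (n + 1))"
    and 2: "\<And>n. Df K (n + 1) \<bullet>\<^bsub>C\<^esub> Df K n = Zero C (Ob K n) (Ob K (n + 2))"
    and 3: "finite (supp C K)"
    using assms by (auto simp: bounded_complex_def)
  show "Df K n \<in> Hom C (Ob K n) (Ob K (n + 1))"
    "Df K (n + 1) \<bullet>\<^bsub>C\<^esub> Df K n = Zero C (Ob K n) (Ob K (n + 2))" "finite (supp C K)"
    by (fact 1 2 3)+
  show "Df K (n - 1) \<in> Hom C (Ob K (n - 1)) (Ob K n)"
    "Df K n \<bullet>\<^bsub>C\<^esub> Df K (n - 1) = Zero C (Ob K (n - 1)) (Ob K (n + 1))"
    using 1[of "n - 1"] 2[of "n - 1"] by (simp_all add: add.commute)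
qed

text \<open>Compared with \<open>homotopic\<close>, the identity stands alone on one side, so that
  \<open>p\<close> is the error of the would-be contraction \<open>h\<close>. That \<open>p\<close>
  commutes with the differential is forced by the equation, see
  \<open>homotopic_to_ide_commute\<close>.\<close>

definition homotopic_to_ide :: "('o, 'm, 'z) cat_scheme \<Rightarrow> ('o, 'm) cochain
    \<Rightarrow> (int \<Rightarrow> 'm) \<Rightarrow> (int \<Rightarrow> 'm) \<Rightarrow> bool" where
  "homotopic_to_ide C K p h \<longleftrightarrow> (\<forall>n. p n \<in> Hom C (Ob K n) (Ob K n) \<and>
     h n \<in> Hom C (Ob K n) (Ob K (n - 1)) \<and>
     Ide C (Ob K n) = Plus C (p n) (Plus C (Df K (n - 1) \<bullet>\<^bsub>C\<^esub> h n) (h (n + 1) \<bullet>\<^bsub>C\<^esub> Df K n)))"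

text \<open>Contractibility of the image of \<open>K\<close> in the quotient category by \<open>J\<close>, expressed in \<open>C\<close>.\<close>

definition contractible_mod :: "('o, 'm, 'z) cat_scheme \<Rightarrow> ('o \<Rightarrow> 'o \<Rightarrow> 'm set)
    \<Rightarrow> ('o, 'm) cochain \<Rightarrow> bool" where
  "contractible_mod C J K \<longleftrightarrow> (\<exists>p h. homotopic_to_ide C K p h \<and> (\<forall>n. p n \<in> J (Ob K n) (Ob K n)))"

lemma homotopic_to_ideD:
  assumes "homotopic_to_ide C K p h"
  shows "p n \<in> Hom C (Ob K n) (Ob K n)"
    and "h n \<in> Hom C (Ob K n) (Ob K (n - 1))"
    and "h (n + 1) \<in> Hom C (Ob K (n + 1)) (Ob K n)"
    and "Plus C (p n) (Plus C (Df K (n - 1) \<bullet>\<^bsub>C\<^esub> h n) (h (n + 1) \<bullet>\<^bsub>C\<^esub> Df K n)) = Ide C (Ob K n)"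
proof -
  have *: "\<And>n. h n \<in> Hom C (Ob K n) (Ob K (n - 1))"
    using assms unfolding homotopic_to_ide_def by blast
  show "h n \<in> Hom C (Ob K n) (Ob K (n - 1))" "h (n + 1) \<in> Hom C (Ob K (n + 1)) (Ob K n)"
    using *[of n] *[of "n + 1"] by auto
qed (use assms in \<open>simp_all add: homotopic_to_ide_def\<close>)

context preadditive_category
begin

lemma plus_cancel_right:
  assumes "g \<boxplus> f = h \<boxplus> f" "f \<in> Arr C" "g \<in> Arr C" "h \<in> Arr C"
    "Dom C g = Dom C f" "Cod C g = Cod C f" "Dom C h = Dom C f" "Cod C h = Cod C f"
  shows "g = h"
  using plus_cancel[of f g h] plus_commute[of f g] plus_commute[of f h] assms by metis

text \<open>Composing id = p + d h + h d with d on either side and using d d = 0 gives d p + d h d =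
  d = p d + d h d; cancel the common term.\<close>

lemma homotopic_to_ide_commute:
  assumes K: "bounded_complex C K" and h: "homotopic_to_ide C K p h"
  shows "Df K n \<bullet> p n = p (n + 1) \<bullet> Df K n"
proof -
  let ?x = "Df K n \<bullet> (h (n + 1) \<bullet> Df K n)"
  note a = bounded_complexD(1)[OF K, of n] bounded_complexD(2)[OF K, of n]
    bounded_complexD(1)[OF K, of "n + 1"]
    homotopic_to_ideD(1)[OF h, of n] homotopic_to_ideD(1)[OF h, of "n + 1"]
    homotopic_to_ideD(2)[OF h, of n] homotopic_to_ideD(3)[OF h, of n]
    homotopic_to_ideD(3)[OF h, of "n + 1"]
  have "Df K n \<bullet> (Df K (n - 1) \<bullet> h n) = Zero C (Ob K n) (Ob K (n + 1))"
    using a assoc[of "h n" "Df K (n - 1)" "Df K n"] bounded_complexD(4)[OF K, of n]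
    by (simp add: in_Hom_iff)
  then have "Df K n \<bullet> p n \<boxplus> ?x = Df K n \<bullet> Ide C (Ob K n)"
    using a unfolding homotopic_to_ideD(4)[OF h, of n, symmetric] in_Hom_iff by simp
  moreover have "h (n + 2) \<bullet> (Df K (n + 1) \<bullet> Df K n) = Zero C (Ob K n) (Ob K (n + 1))"
    using a bounded_complexD(3)[OF K, of n] by (simp add: in_Hom_iff add.commute)
  then have "p (n + 1) \<bullet> Df K n \<boxplus> ?x = Ide C (Ob K (n + 1)) \<bullet> Df K n"
    using a homotopic_to_ideD(4)[OF h, of "n + 1", symmetric] by (simp add: in_Hom_iff add.commute)
  ultimately have "Df K n \<bullet> p n \<boxplus> ?x = p (n + 1) \<bullet> Df K n \<boxplus> ?x"
    using a by (simp add: in_Hom_iff)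
  then show ?thesis
    by (rule plus_cancel_right) (use a in \<open>simp_all add: in_Hom_iff\<close>)
qed

text \<open>Start from id = p' + d h' + h' d, replace p' by (p + d h + h d) p', and move d past p'
  in the last term. Iterating this is what makes a nilpotent error harmless.\<close>

lemma homotopic_to_ide_comp:
  assumes K: "bounded_complex C K" and h: "homotopic_to_ide C K p h" and h': "homotopic_to_ide C K p' h'"
  shows "homotopic_to_ide C K (\<lambda>n. p n \<bullet> p' n) (\<lambda>n. h n \<bullet> p' n \<boxplus> h' n)"
  unfolding homotopic_to_ide_def
proof (intro allI conjI)
  fix n
  note a = bounded_complexD(1)[OF K, of n] bounded_complexD(2)[OF K, of n]
    homotopic_to_ideD(1)[OF h, of n] homotopic_to_ideD(1)[OF h', of "n + 1"]
    homotopic_to_ideD(2)[OF h, of n] homotopic_to_ideD(3)[OF h, of n]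
    homotopic_to_ideD(1)[OF h', of n]
    homotopic_to_ideD(2)[OF h', of n] homotopic_to_ideD(3)[OF h', of n]
  show "p n \<bullet> p' n \<in> Hom C (Ob K n) (Ob K n)" "h n \<bullet> p' n \<boxplus> h' n \<in> Hom C (Ob K n) (Ob K (n - 1))"
    using a by (auto simp: in_Hom_iff)
  have "Ide C (Ob K n) = Ide C (Ob K n) \<bullet> p' n \<boxplus> (Df K (n - 1) \<bullet> h' n \<boxplus> h' (n + 1) \<bullet> Df K n)"
    using homotopic_to_ideD(4)[OF h', of n] a by (simp add: in_Hom_iff)
  also have "Ide C (Ob K n) \<bullet> p' n = p n \<bullet> p' n \<boxplus> (Df K (n - 1) \<bullet> (h n \<bullet> p' n) \<boxplus> h (n + 1) \<bullet> (Df K n \<bullet> p' n))"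
    unfolding homotopic_to_ideD(4)[OF h, of n, symmetric] using a by (simp add: in_Hom_iff)
  also have "Df K n \<bullet> p' n = p' (n + 1) \<bullet> Df K n"
    by (rule homotopic_to_ide_commute[OF K h'])
  finally show "Ide C (Ob K n) = p n \<bullet> p' n \<boxplus> (Df K (n - 1) \<bullet> (h n \<bullet> p' n \<boxplus> h' n) \<boxplus>
      (h (n + 1) \<bullet> p' (n + 1) \<boxplus> h' (n + 1)) \<bullet> Df K n)"
    using a by (simp add: in_Hom_iff plus_ac)
qed

text \<open>The cancellation of mixed terms, both in the square of the tensor differential and in
  the homotopy on a tensor product.\<close>

lemma sgn_Suc_cancel:
  assumes "f \<in> Arr C"
  shows "sgn_mor C (i + 1) f \<boxplus> sgn_mor C i f = Zero C (Dom C f) (Cod C f)"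
    "sgn_mor C i f \<boxplus> sgn_mor C (i + 1) f = Zero C (Dom C f) (Cod C f)"
  using sgn_sgn[OF assms, of 1 i] plus_neg[of "sgn_mor C i f"] assms by (simp_all add: add.commute)

lemma sgn_twice: "f \<in> Arr C \<Longrightarrow> sgn_mor C i (sgn_mor C i f) = f"
  by (simp add: sgn_sgn)

lemma sgn_in_hom: "f \<in> Hom C X Y \<Longrightarrow> sgn_mor C i f \<in> Hom C X Y"
  by (auto simp: in_Hom_iff)

lemma plus_in_hom: "\<lbrakk>f \<in> Hom C X Y; g \<in> Hom C X Y\<rbrakk> \<Longrightarrow> f \<boxplus> g \<in> Hom C X Y"
  by (auto simp: in_Hom_iff)

lemma zero_in_hom: "Zero C X Y \<in> Hom C X Y"
  by (auto simp: in_Hom_iff)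

end

context additive_category
begin

lemma biproduct_chosen:
  assumes "finite I"
  shows "is_biproduct C I X (bp_obj C I X) (bp_in C I X) (bp_pr C I X)"
proof -
  have "case biprod C I X of (S, \<iota>, \<pi>) \<Rightarrow> is_biproduct C I X S \<iota> \<pi>"
    unfolding biprod_def by (rule someI_ex) (use biproducts[OF assms, of X] in auto)
  then show ?thesis by (simp add: bp_obj_def bp_in_def bp_pr_def split_beta)
qed

end

section \<open>Tensor products of complexes\<close>

context monoidal_krull_schmidt_category
begin

lemma ten_arr [simp]:
  assumes "f \<in> Arr C" "g \<in> Arr C"
  shows "f \<star> g \<in> Arr C" "Dom C (f \<star> g) = Dom C f \<boxtimes> Dom C g" "Cod C (f \<star> g) = Cod C f \<boxtimes> Cod C g"
  using ten_in_hom[of f "Dom C f" "Cod C f" g "Dom C g" "Cod C g"] assms by (auto simp: in_Hom_iff)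

lemma comp_ten [simp]:
  assumes "f \<in> Arr C" "f' \<in> Arr C" "g \<in> Arr C" "g' \<in> Arr C" "Dom C f' = Cod C f" "Dom C g' = Cod C g"
  shows "(f' \<star> g') \<bullet> (f \<star> g) = (f' \<bullet> f) \<star> (g' \<bullet> g)"
  using ten_comp[of f "Dom C f" "Cod C f" f' "Cod C f'" g "Dom C g" "Cod C g" g' "Cod C g'"] assms
  by (auto simp: in_Hom_iff)

lemma ten_plus [simp]:
  shows "\<lbrakk>f \<in> Arr C; f' \<in> Arr C; g \<in> Arr C; Dom C f' = Dom C f; Cod C f' = Cod C f\<rbrakk>
      \<Longrightarrow> (f \<boxplus> f') \<star> g = (f \<star> g) \<boxplus> (f' \<star> g)"
    and "\<lbrakk>f \<in> Arr C; f' \<in> Arr C; g \<in> Arr C; Dom C f' = Dom C f; Cod C f' = Cod C f\<rbrakk>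
      \<Longrightarrow> g \<star> (f \<boxplus> f') = (g \<star> f) \<boxplus> (g \<star> f')"
  using ten_plus_left[of f "Dom C f" "Cod C f" f' g "Dom C g" "Cod C g"]
    ten_plus_right[of g "Dom C g" "Cod C g" f "Dom C f" "Cod C f" f']
  by (auto simp: in_Hom_iff)

lemma ten_zero [simp]:
  assumes "g \<in> Arr C"
  shows "Zero C X Y \<star> g = Zero C (X \<boxtimes> Dom C g) (Y \<boxtimes> Cod C g)"
    and "g \<star> Zero C X Y = Zero C (Dom C g \<boxtimes> X) (Cod C g \<boxtimes> Y)"
  using plus_idem_zero[of "Zero C X Y \<star> g"] plus_idem_zero[of "g \<star> Zero C X Y"]
    ten_plus(1)[of "Zero C X Y" "Zero C X Y" g] ten_plus(2)[of "Zero C X Y" "Zero C X Y" g] assms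
  by auto

lemma zero_obj_ten:
  assumes "is_zero_obj C X \<or> is_zero_obj C Y"
  shows "is_zero_obj C (X \<boxtimes> Y)"
  using assms ten_ide[of X Y, symmetric] by (auto simp: is_zero_obj_def)

text \<open>All later arguments use these three properties in place of the definition. The case
  distinctions of the definition disappear once injections and projections are extended by zero: a
  component whose target is missing vanishes because the extended injection does.\<close>

lemma tensor_complex_structure:
  assumes K: "bounded_complex C K" and L: "bounded_complex C L"
  defines "T \<equiv> tensor_complex C K L"
  obtains \<iota> \<pi> where
    "\<And>n. biproduct_family C (\<lambda>i. Ob K i \<boxtimes> Ob L (n - i)) (Ob T n) (\<iota> n) (\<pi> n)"
    "\<And>n. Df T n \<in> Hom C (Ob T n) (Ob T (n + 1))"
    "\<And>n i. Df T n \<bullet> \<iota> n i = \<iota> (n + 1) (i + 1) \<bullet> (Df K i \<star> Ide C (Ob L (n - i))) \<boxplus>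
       \<iota> (n + 1) i \<bullet> sgn_mor C i (Ide C (Ob K i) \<star> Df L (n - i))"
proof
  define I where "I = ten_idx C K L"
  define X where "X = (\<lambda>n i. Ob K i \<boxtimes> Ob L (n - i))"
  define S where "S = (\<lambda>n. bp_obj C (I n) (X n))"
  define inj where "inj = (\<lambda>n. bp_in C (I n) (X n))"
  define pr where "pr = (\<lambda>n. bp_pr C (I n) (X n))"
  \<comment> \<open>Zero is the right value outside \<open>I n\<close>, because there one tensor
    factor, and with it \<open>X n i\<close>, is a zero object.\<close>
  define \<iota> where "\<iota> = (\<lambda>n i. if i \<in> I n then inj n i else Zero C (X n i) (S n))"
  define \<pi> where "\<pi> = (\<lambda>n i. if i \<in> I n then pr n i else Zero C (S n) (X n i))"
  define a where "a = (\<lambda>n i. \<iota> (n + 1) (i + 1) \<bullet> (Df K i \<star> Ide C (Ob L (n - i))) \<boxplus>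
       \<iota> (n + 1) i \<bullet> sgn_mor C i (Ide C (Ob K i) \<star> Df L (n - i)))"
  have fin: "finite (I n)" for n
    using bounded_complexD(5)[OF K] unfolding I_def ten_idx_def by (rule rev_finite_subset) auto
  have bp: "is_biproduct C (I n) (X n) (S n) (inj n) (pr n)" for n
    unfolding S_def inj_def pr_def using fin by (rule biproduct_chosen)
  have zero: "is_zero_obj C (X n i)" if "i \<notin> I n" for n i
    using that unfolding X_def I_def ten_idx_def supp_def by (auto intro: zero_obj_ten)
  have bp': "is_biproduct C (I n) (X n) (S n) (\<iota> n) (\<pi> n)" for n
  proof -
    have "finsum (homs C (S n) (S n)) (\<lambda>i. \<iota> n i \<bullet> \<pi> n i) (I n)
        = finsum (homs C (S n) (S n)) (\<lambda>i. inj n i \<bullet> pr n i) (I n)"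
    proof -
      interpret SS: abelian_group "homs C (S n) (S n)" by (rule hom_abelian_group)
      show ?thesis using is_biproductD(1,2)[OF bp]
        by (intro SS.finsum_cong') (auto simp: \<iota>_def \<pi>_def intro!: comp_in_hom)
    qed
    then show ?thesis using bp[of n] unfolding is_biproduct_def by (auto simp: \<iota>_def \<pi>_def)
  qed
  have fam: "biproduct_family C (X n) (S n) (\<iota> n) (\<pi> n)" for n
    unfolding biproduct_family_def using bp' zero by (intro exI[of _ "I n"]) (auto simp: \<iota>_def \<pi>_def)
  have Ob_T: "Ob T n = S n" for n
    by (simp add: T_def tensor_complex_def S_def I_def X_def Let_def)
  have in_hom: "\<iota> n i \<in> Arr C" "Dom C (\<iota> n i) = X n i" "Cod C (\<iota> n i) = S n"
    "\<pi> n i \<in> Arr C" "Dom C (\<pi> n i) = S n" "Cod C (\<pi> n i) = X n i" for n i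
    using family_in[OF fam] family_pr[OF fam] by (auto simp: in_Hom_iff)
  have d: "Df K i \<in> Arr C" "Dom C (Df K i) = Ob K i" "Cod C (Df K i) = Ob K (i + 1)"
    "Df L i \<in> Arr C" "Dom C (Df L i) = Ob L i" "Cod C (Df L i) = Ob L (i + 1)" for i
    using bounded_complexD(1)[OF K, of i] bounded_complexD(1)[OF L, of i] by (auto simp: in_Hom_iff)
  have a: "a n i \<in> Hom C (X n i) (S (n + 1))" for n i
    using in_hom d unfolding a_def by (simp add: in_Hom_iff X_def algebra_simps)
  have Df_T: "Df T n = finsum (homs C (S n) (S (n + 1))) (\<lambda>i. a n i \<bullet> \<pi> n i) (I n)" for n
  proof -
    interpret SS: abelian_group "homs C (S n) (S (n + 1))" by (rule hom_abelian_group)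
    have "Df T n = finsum (homs C (S n) (S (n + 1)))
        (\<lambda>i. (if i + 1 \<in> I (n + 1)
            then inj (n + 1) (i + 1) \<bullet> (Df K i \<star> Ide C (Ob L (n - i))) \<bullet> pr n i
            else Zero C (S n) (S (n + 1))) \<boxplus>
           (if i \<in> I (n + 1)
            then inj (n + 1) i \<bullet> sgn_mor C i (Ide C (Ob K i) \<star> Df L (n - i)) \<bullet> pr n i
            else Zero C (S n) (S (n + 1)))) (I n)"
      by (simp only: T_def tensor_complex_def S_def I_def X_def inj_def pr_def Let_def cochain.select_convs)
    also have "\<dots> = finsum (homs C (S n) (S (n + 1))) (\<lambda>i. a n i \<bullet> \<pi> n i) (I n)"
    proof (rule SS.finsum_cong'[OF refl])
      fix i assume i: "i \<in> I n"
      have eq: "inj n j = \<iota> n j" "pr n j = \<pi> n j" if "j \<in> I n" for n j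
        using that by (auto simp: \<iota>_def \<pi>_def)
      have z: "\<iota> n j = Zero C (X n j) (S n)" if "j \<notin> I n" for n j
        using that by (auto simp: \<iota>_def)
      have 1: "(if i + 1 \<in> I (n + 1)
            then inj (n + 1) (i + 1) \<bullet> (Df K i \<star> Ide C (Ob L (n - i))) \<bullet> pr n i
            else Zero C (S n) (S (n + 1)))
          = \<iota> (n + 1) (i + 1) \<bullet> (Df K i \<star> Ide C (Ob L (n - i))) \<bullet> \<pi> n i"
        using in_hom d eq(2)[OF i] eq(1)[of "i + 1" "n + 1"] z[of "i + 1" "n + 1"]
        by (auto simp: X_def)
      have 2: "(if i \<in> I (n + 1)
            then inj (n + 1) i \<bullet> sgn_mor C i (Ide C (Ob K i) \<star> Df L (n - i)) \<bullet> pr n i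
            else Zero C (S n) (S (n + 1)))
          = \<iota> (n + 1) i \<bullet> sgn_mor C i (Ide C (Ob K i) \<star> Df L (n - i)) \<bullet> \<pi> n i"
        using in_hom d eq(2)[OF i] eq(1)[of "i" "n + 1"] z[of "i" "n + 1"]
        by (auto simp: X_def algebra_simps)
      show "(if i + 1 \<in> I (n + 1)
            then inj (n + 1) (i + 1) \<bullet> (Df K i \<star> Ide C (Ob L (n - i))) \<bullet> pr n i
            else Zero C (S n) (S (n + 1))) \<boxplus>
           (if i \<in> I (n + 1)
            then inj (n + 1) i \<bullet> sgn_mor C i (Ide C (Ob K i) \<star> Df L (n - i)) \<bullet> pr n i
            else Zero C (S n) (S (n + 1))) = a n i \<bullet> \<pi> n i"
        unfolding 1 2 unfolding a_def using in_hom d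
        by (intro comp_plus(2)[symmetric]) (simp_all add: X_def algebra_simps)
    qed (use a in_hom in \<open>auto simp: in_Hom_iff\<close>)
    finally show ?thesis .
  qed
  show fam': "biproduct_family C (\<lambda>i. Ob K i \<boxtimes> Ob L (n - i)) (Ob T n) (\<iota> n) (\<pi> n)" for n
    using fam unfolding Ob_T X_def .
  show hom: "Df T n \<in> Hom C (Ob T n) (Ob T (n + 1))" for n
    unfolding Df_T Ob_T using biproduct_copair_finsum(1)[OF bp' a] .
  show "Df T n \<bullet> \<iota> n i = \<iota> (n + 1) (i + 1) \<bullet> (Df K i \<star> Ide C (Ob L (n - i))) \<boxplus>
       \<iota> (n + 1) i \<bullet> sgn_mor C i (Ide C (Ob K i) \<star> Df L (n - i))" for n i
  proof (cases "i \<in> I n")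
    case True
    show ?thesis using biproduct_copair_finsum(2)[OF bp' a True] unfolding Df_T a_def .
  next
    case False
    have "Df T n \<bullet> \<iota> n i \<in> Hom C (X n i) (S (n + 1))"
      using hom[of n] in_hom by (auto simp: in_Hom_iff Ob_T)
    then show ?thesis using a[of n i] zero_obj_arr(1)[OF zero[OF False], of "a n i"]
      zero_obj_arr(1)[OF zero[OF False], of "Df T n \<bullet> \<iota> n i"]
      unfolding a_def by (auto simp: in_Hom_iff)
  qed
qed

text \<open>The square of the differential is tested on each summand: the two unmixed terms vanish
  since \<open>K\<close> and \<open>L\<close> are complexes, and the mixed terms carry the signs of
  i + 1 and i.\<close>

lemma bounded_tensor_complex:
  assumes K: "bounded_complex C K" and L: "bounded_complex C L"
  shows "bounded_complex C (tensor_complex C K L)"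
proof -
  define T where "T = tensor_complex C K L"
  obtain \<iota> \<pi> where fam: "\<And>n. biproduct_family C (\<lambda>i. Ob K i \<boxtimes> Ob L (n - i)) (Ob T n) (\<iota> n) (\<pi> n)"
    and hom: "\<And>n. Df T n \<in> Hom C (Ob T n) (Ob T (n + 1))"
    and D: "\<And>n i. Df T n \<bullet> \<iota> n i = \<iota> (n + 1) (i + 1) \<bullet> (Df K i \<star> Ide C (Ob L (n - i))) \<boxplus>
       \<iota> (n + 1) i \<bullet> sgn_mor C i (Ide C (Ob K i) \<star> Df L (n - i))"
    using tensor_complex_structure[OF K L, folded T_def] by blast
  have in_hom: "\<iota> n i \<in> Arr C" "Dom C (\<iota> n i) = Ob K i \<boxtimes> Ob L (n - i)" "Cod C (\<iota> n i) = Ob T n" for n i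
    using family_in[OF fam, of n i] by (auto simp: in_Hom_iff)
  have d: "Df K i \<in> Arr C" "Dom C (Df K i) = Ob K i" "Cod C (Df K i) = Ob K (i + 1)"
    "Df L i \<in> Arr C" "Dom C (Df L i) = Ob L i" "Cod C (Df L i) = Ob L (i + 1)" for i
    using bounded_complexD(1)[OF K, of i] bounded_complexD(1)[OF L, of i] by (auto simp: in_Hom_iff)
  have dd: "Df K (i + 1) \<bullet> Df K i = Zero C (Ob K i) (Ob K (i + 2))"
    "Df L (i + 1) \<bullet> Df L i = Zero C (Ob L i) (Ob L (i + 2))" for i
    by (rule bounded_complexD(3)[OF K] bounded_complexD(3)[OF L])+
  have DT: "Df T n \<in> Arr C" "Dom C (Df T n) = Ob T n" "Cod C (Df T n) = Ob T (n + 1)" for n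
    using hom[of n] by (auto simp: in_Hom_iff)
  have "Df T (n + 1) \<bullet> Df T n = Zero C (Ob T n) (Ob T (n + 2))" for n
  proof (rule family_ext[OF fam])
    show "Df T (n + 1) \<bullet> Df T n \<in> Hom C (Ob T n) (Ob T (n + 2))"
      using DT by (simp add: in_Hom_iff add.commute)
    fix i
    \<comment> \<open>The bidegree is (i, j) with sum n; writing n as i + j removes the subtractions
      from the degrees of \<open>L\<close>.\<close>
    define j where "j = n - i"
    have j: "n = i + j" by (simp add: j_def)
    \<comment> \<open>The mixed term, reached once by applying the differential of \<open>L\<close>
      last and once by applying that of \<open>K\<close> last.\<close>
    let ?x = "\<iota> (i + j + 2) (i + 1) \<bullet> (Df K i \<star> Df L j)"
    have arr: "\<iota> (i + j + 2) (i + 1) \<in> Arr C" "Dom C (\<iota> (i + j + 2) (i + 1)) = Ob K (i + 1) \<boxtimes> Ob L (j + 1)"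
      "\<iota> (i + j + 2) (i + 2) \<in> Arr C" "Dom C (\<iota> (i + j + 2) (i + 2)) = Ob K (i + 2) \<boxtimes> Ob L j"
      "\<iota> (i + j + 1) (i + 1) \<in> Arr C" "Dom C (\<iota> (i + j + 1) (i + 1)) = Ob K (i + 1) \<boxtimes> Ob L j"
      "\<iota> (i + j + 1) i \<in> Arr C" "Dom C (\<iota> (i + j + 1) i) = Ob K i \<boxtimes> Ob L (j + 1)"
      "\<iota> (i + j + 2) i \<in> Arr C" "Dom C (\<iota> (i + j + 2) i) = Ob K i \<boxtimes> Ob L (j + 2)"
      using in_hom by (simp_all add: algebra_simps)
    have D1: "Df T (i + j) \<bullet> \<iota> (i + j) i = \<iota> (i + j + 1) (i + 1) \<bullet> (Df K i \<star> Ide C (Ob L j)) \<boxplus>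
       \<iota> (i + j + 1) i \<bullet> sgn_mor C i (Ide C (Ob K i) \<star> Df L j)"
      using D[of "i + j" i] by simp
    have D2: "Df T (i + j + 1) \<bullet> \<iota> (i + j + 1) (i + 1)
        = \<iota> (i + j + 2) (i + 2) \<bullet> (Df K (i + 1) \<star> Ide C (Ob L j)) \<boxplus>
          \<iota> (i + j + 2) (i + 1) \<bullet> sgn_mor C (i + 1) (Ide C (Ob K (i + 1)) \<star> Df L j)"
      using D[of "i + j + 1" "i + 1"] by (simp add: algebra_simps)
    have D3: "Df T (i + j + 1) \<bullet> \<iota> (i + j + 1) i
        = \<iota> (i + j + 2) (i + 1) \<bullet> (Df K i \<star> Ide C (Ob L (j + 1))) \<boxplus>
          \<iota> (i + j + 2) i \<bullet> sgn_mor C i (Ide C (Ob K i) \<star> Df L (j + 1))"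
      using D[of "i + j + 1" i] by (simp add: algebra_simps)
    have "(Df T (i + j + 1) \<bullet> Df T (i + j)) \<bullet> \<iota> (i + j) i
      = (Df T (i + j + 1) \<bullet> \<iota> (i + j + 1) (i + 1)) \<bullet> (Df K i \<star> Ide C (Ob L j)) \<boxplus>
        (Df T (i + j + 1) \<bullet> \<iota> (i + j + 1) i) \<bullet> sgn_mor C i (Ide C (Ob K i) \<star> Df L j)"
      using DT in_hom arr d by (simp add: D1 del: sgn_comp)
    also have "\<dots> = sgn_mor C (i + 1) ?x \<boxplus> sgn_mor C i ?x"
    proof -
      have 1: "(\<iota> (i + j + 2) (i + 2) \<bullet> (Df K (i + 1) \<star> Ide C (Ob L j)) \<boxplus>
          \<iota> (i + j + 2) (i + 1) \<bullet> sgn_mor C (i + 1) (Ide C (Ob K (i + 1)) \<star> Df L j)) \<bullet> (Df K i \<star> Ide C (Ob L j))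
        = sgn_mor C (i + 1) ?x"
        using arr in_hom(3) d[of i] d[of j] d[of "i + 1"] d[of "j + 1"] dd[of i] dd[of j] by (simp add: add_ac)
      have 2: "(\<iota> (i + j + 2) (i + 1) \<bullet> (Df K i \<star> Ide C (Ob L (j + 1))) \<boxplus>
          \<iota> (i + j + 2) i \<bullet> sgn_mor C i (Ide C (Ob K i) \<star> Df L (j + 1))) \<bullet> sgn_mor C i (Ide C (Ob K i) \<star> Df L j)
        = sgn_mor C i ?x"
        using arr in_hom(3) d[of i] d[of j] d[of "i + 1"] d[of "j + 1"] dd[of i] dd[of j] by (simp add: add_ac sgn_twice)
      show ?thesis unfolding D2 D3 1 2 ..
    qed
    also have "\<dots> = Zero C (Ob K i \<boxtimes> Ob L j) (Ob T (i + j + 2))"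
      using sgn_Suc_cancel(1)[of ?x i] in_hom arr d by simp
    finally show "(Df T (n + 1) \<bullet> Df T n) \<bullet> \<iota> n i = Zero C (Ob T n) (Ob T (n + 2)) \<bullet> \<iota> n i"
      using in_hom by (simp add: j)
  qed (simp add: in_Hom_iff)
  moreover have "finite (supp C T)"
  proof (rule finite_subset)
    show "supp C T \<subseteq> (\<lambda>(i, j). i + j) ` (supp C K \<times> supp C L)"
    proof
      fix n assume "n \<in> supp C T"
      then obtain i where "\<not> is_zero_obj C (Ob K i \<boxtimes> Ob L (n - i))"
        using family_zero_obj[OF fam, of n] unfolding supp_def by blast
      then have "i \<in> supp C K" "n - i \<in> supp C L"
        unfolding supp_def using zero_obj_ten by blast+
      then show "n \<in> (\<lambda>(i, j). i + j) ` (supp C K \<times> supp C L)"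
        by (intro image_eqI[of _ _ "(i, n - i)"]) auto
    qed
    show "finite ((\<lambda>(i, j). i + j) ` (supp C K \<times> supp C L))"
      using bounded_complexD(5)[OF K] bounded_complexD(5)[OF L] by simp
  qed
  ultimately show ?thesis using hom unfolding bounded_complex_def T_def by blast
qed

end

text \<open>The chain map \<open>A \<otimes> \<phi> : A \<otimes> X \<rightarrow> A \<otimes> Y\<close> is null-homotopic modulo \<open>J\<close>. The complexes
  \<open>A \<otimes> X\<close> and \<open>A \<otimes> Y\<close> are formed degreewise, without the biproducts of \<open>tensor_complex\<close>.\<close>

definition null_tensor :: "('o, 'm, 'z) mcat_scheme \<Rightarrow> ('o \<Rightarrow> 'o \<Rightarrow> 'm set) \<Rightarrow> ('o, 'm) cochain
    \<Rightarrow> 'o \<Rightarrow> 'o \<Rightarrow> 'm \<Rightarrow> bool" where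
  "null_tensor C J A X Y \<phi> \<longleftrightarrow> (\<exists>q s. \<forall>i.
     q i \<in> J (Ob A i \<boxtimes>\<^bsub>C\<^esub> X) (Ob A i \<boxtimes>\<^bsub>C\<^esub> Y) \<and>
     s i \<in> Hom C (Ob A i \<boxtimes>\<^bsub>C\<^esub> X) (Ob A (i - 1) \<boxtimes>\<^bsub>C\<^esub> Y) \<and>
     Ide C (Ob A i) \<star>\<^bsub>C\<^esub> \<phi> = Plus C (q i)
       (Plus C ((Df A (i - 1) \<star>\<^bsub>C\<^esub> Ide C Y) \<bullet>\<^bsub>C\<^esub> s i) (s (i + 1) \<bullet>\<^bsub>C\<^esub> (Df A i \<star>\<^bsub>C\<^esub> Ide C X))))"

section \<open>Contracting a tensor product modulo an ideal\<close>

context monoidal_krull_schmidt_category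
begin

text \<open>Sorts the eight terms of d H + H d on the summand of bidegree (i, j): the x and y stay
  there, the b go to A-degree i - 1, and the z go to A-degree i + 1, where they cancel.\<close>

lemma plus_rearrange:
  assumes "x1 \<in> Hom C X Y" "x2 \<in> Hom C X Y" "b1 \<in> Hom C X Y" "b2 \<in> Hom C X Y"
    "y1 \<in> Hom C X Y" "y2 \<in> Hom C X Y" "z1 \<in> Hom C X Y" "z2 \<in> Hom C X Y"
  shows "((x1 \<boxplus> b1) \<boxplus> (z1 \<boxplus> y1)) \<boxplus> ((x2 \<boxplus> z2) \<boxplus> (b2 \<boxplus> y2))
    = (((x1 \<boxplus> x2) \<boxplus> (y1 \<boxplus> y2)) \<boxplus> (b1 \<boxplus> b2)) \<boxplus> (z1 \<boxplus> z2)"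
proof -
  interpret XY: abelian_group "homs C X Y" by (rule hom_abelian_group)
  show ?thesis
    using assms XY.a_ac[unfolded homs_simps] XY.a_closed[unfolded homs_simps] by simp
qed

text \<open>The sum of the contractions of \<open>A \<otimes> K\<^sup>j\<close> and of the contraction of \<open>K\<close> is a homotopy from the
  identity to a map which, modulo \<open>J\<close>, strictly lowers the degree in \<open>A\<close>.\<close>

lemma tensor_lowering_homotopy:
  assumes A: "bounded_complex C A" and K: "bounded_complex C K"
    and J: "two_sided_ideal C J"
    and null: "\<And>X Y \<phi>. \<phi> \<in> J' X Y \<Longrightarrow> null_tensor C J A X Y \<phi>"
    and contr: "contractible_mod C J' K"
    and fam: "\<And>n. biproduct_family C (\<lambda>i. Ob A i \<boxtimes> Ob K (n - i)) (Ob T n) (\<iota> n) (\<pi> n)"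
    and T: "bounded_complex C T"
    and D: "\<And>n i. Df T n \<bullet> \<iota> n i = \<iota> (n + 1) (i + 1) \<bullet> (Df A i \<star> Ide C (Ob K (n - i))) \<boxplus>
       \<iota> (n + 1) i \<bullet> sgn_mor C i (Ide C (Ob A i) \<star> Df K (n - i))"
  obtains P H where "homotopic_to_ide C T P H"
    "\<And>n i j. i < j + 1 \<Longrightarrow>
      \<pi> n j \<bullet> (P n \<bullet> \<iota> n i) \<in> J (Ob A i \<boxtimes> Ob K (n - i)) (Ob A j \<boxtimes> Ob K (n - j))"
proof -
  obtain p t where pt: "homotopic_to_ide C K p t" "\<And>n. p n \<in> J' (Ob K n) (Ob K n)"
    using contr unfolding contractible_mod_def by blast
  have "\<forall>n. \<exists>q s. \<forall>i.
     q i \<in> J (Ob A i \<boxtimes> Ob K n) (Ob A i \<boxtimes> Ob K n) \<and>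
     s i \<in> Hom C (Ob A i \<boxtimes> Ob K n) (Ob A (i - 1) \<boxtimes> Ob K n) \<and>
     Ide C (Ob A i) \<star> p n = q i \<boxplus>
       ((Df A (i - 1) \<star> Ide C (Ob K n)) \<bullet> s i \<boxplus> s (i + 1) \<bullet> (Df A i \<star> Ide C (Ob K n)))"
    using null[OF pt(2)] unfolding null_tensor_def by blast
  then obtain q s where qs: "\<And>n i. q n i \<in> J (Ob A i \<boxtimes> Ob K n) (Ob A i \<boxtimes> Ob K n)"
     "\<And>n i. s n i \<in> Hom C (Ob A i \<boxtimes> Ob K n) (Ob A (i - 1) \<boxtimes> Ob K n)"
     "\<And>n i. Ide C (Ob A i) \<star> p n = q n i \<boxplus>
       ((Df A (i - 1) \<star> Ide C (Ob K n)) \<bullet> s n i \<boxplus> s n (i + 1) \<bullet> (Df A i \<star> Ide C (Ob K n)))"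
    by metis
  \<comment> \<open>On A^i \<otimes> K^(n-i) the homotopy is \<open>s\<close>, which trivialises 1
    \<otimes> p modulo \<open>J\<close>, plus the contraction \<open>t\<close> of \<open>K\<close>
    with the sign (-1)^i that the tensor differential gives to operators on the second
    factor.\<close>
  define a where "a = (\<lambda>n i. \<iota> (n - 1) (i - 1) \<bullet> s (n - i) i \<boxplus>
    \<iota> (n - 1) i \<bullet> sgn_mor C i (Ide C (Ob A i) \<star> t (n - i)))"
  have in_hom: "\<iota> n i \<in> Arr C" "Dom C (\<iota> n i) = Ob A i \<boxtimes> Ob K (n - i)" "Cod C (\<iota> n i) = Ob T n"
    "\<pi> n i \<in> Arr C" "Cod C (\<pi> n i) = Ob A i \<boxtimes> Ob K (n - i)" "Dom C (\<pi> n i) = Ob T n" for n i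
    using family_in[OF fam, of n i] family_pr[OF fam, of n i] by (auto simp: in_Hom_iff)
  have d: "Df A i \<in> Arr C" "Dom C (Df A i) = Ob A i" "Cod C (Df A i) = Ob A (i + 1)"
    "Df K i \<in> Arr C" "Dom C (Df K i) = Ob K i" "Cod C (Df K i) = Ob K (i + 1)"
    "Df T i \<in> Arr C" "Dom C (Df T i) = Ob T i" "Cod C (Df T i) = Ob T (i + 1)" for i
    using bounded_complexD(1)[OF A, of i] bounded_complexD(1)[OF K, of i]
      bounded_complexD(1)[OF T, of i] by (auto simp: in_Hom_iff)
  have pts: "p i \<in> Arr C" "Dom C (p i) = Ob K i" "Cod C (p i) = Ob K i"
    "t i \<in> Arr C" "Dom C (t i) = Ob K i" "Cod C (t i) = Ob K (i - 1)"
    "s n i \<in> Arr C" "Dom C (s n i) = Ob A i \<boxtimes> Ob K n" "Cod C (s n i) = Ob A (i - 1) \<boxtimes> Ob K n"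
    "q n i \<in> Arr C" "Dom C (q n i) = Ob A i \<boxtimes> Ob K n" "Cod C (q n i) = Ob A i \<boxtimes> Ob K n" for i n
    using homotopic_to_ideD(1,2)[OF pt(1), of i] qs(2)[of n i] ideal_in_hom[OF J qs(1)[of n i]]
    by (auto simp: in_Hom_iff)
  have a: "a n i \<in> Hom C (Ob A i \<boxtimes> Ob K (n - i)) (Ob T (n - 1))" for n i
  proof -
    have "Dom C (\<iota> (n - 1) i) = Ob A i \<boxtimes> Ob K (n - i - 1)"
      "Dom C (\<iota> (n - 1) (i - 1)) = Ob A (i - 1) \<boxtimes> Ob K (n - i)"
      using in_hom(2) by (simp_all add: algebra_simps)
    then show ?thesis using in_hom(1,3) pts unfolding a_def by (simp add: in_Hom_iff)
  qed
  have "\<exists>u. u \<in> Hom C (Ob T n) (Ob T (n - 1)) \<and> (\<forall>i. u \<bullet> \<iota> n i = a n i)" for n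
    using family_copair[OF fam a] by metis
  then obtain H where H: "\<And>n. H n \<in> Hom C (Ob T n) (Ob T (n - 1))" "\<And>n i. H n \<bullet> \<iota> n i = a n i"
    by metis
  have Harr: "H n \<in> Arr C" "Dom C (H n) = Ob T n" "Cod C (H n) = Ob T (n - 1)" for n
    using H(1)[of n] by (auto simp: in_Hom_iff)
  define DH where "DH = (\<lambda>n. Df T (n - 1) \<bullet> H n \<boxplus> H (n + 1) \<bullet> Df T n)"
  \<comment> \<open>The error is defined as whatever makes the homotopy equation true; the work lies
    in computing its entries.\<close>
  define P where "P = (\<lambda>n. Ide C (Ob T n) \<boxplus> neg (DH n))"
  have DH: "DH n \<in> Arr C" "Dom C (DH n) = Ob T n" "Cod C (DH n) = Ob T n" for n
    using Harr[of n] Harr[of "n + 1"] d(7-9)[of n] d(7-9)[of "n - 1"] by (simp_all add: DH_def)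
  have P: "P n \<in> Hom C (Ob T n) (Ob T n)" for n
    using DH[of n] by (simp add: P_def in_Hom_iff)
  have hti: "homotopic_to_ide C T P H"
    unfolding homotopic_to_ide_def
  proof (intro allI conjI)
    fix n
    have "Ide C (Ob T n) = P n \<boxplus> DH n"
      using DH[of n] by (simp add: P_def plus_assoc)
    then show "Ide C (Ob T n) = P n \<boxplus> (Df T (n - 1) \<bullet> H n \<boxplus> H (n + 1) \<bullet> Df T n)"
      by (simp only: DH_def)
  qed (use P H in auto)
  \<comment> \<open>Here i is the degree in \<open>A\<close> and j the degree in \<open>K\<close>.
    The diagonal entry is \<open>q\<close>, which lies in \<open>J\<close>, and the only other entry
    lowers the degree in \<open>A\<close> by 1.\<close>
  have P_coeff: "\<exists>b. b \<in> Hom C (Ob A i \<boxtimes> Ob K j) (Ob A (i - 1) \<boxtimes> Ob K (j + 1)) \<and>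
     P (i + j) \<bullet> \<iota> (i + j) i = \<iota> (i + j) i \<bullet> q j i \<boxplus> \<iota> (i + j) (i - 1) \<bullet> b" for i j
  proof -
    have arr: "Dom C (\<iota> (i + j) i) = Ob A i \<boxtimes> Ob K j"
      "Dom C (\<iota> (i + j) (i - 1)) = Ob A (i - 1) \<boxtimes> Ob K (j + 1)"
      "Dom C (\<iota> (i + j) (i + 1)) = Ob A (i + 1) \<boxtimes> Ob K (j - 1)"
      "Dom C (\<iota> (i + j - 1) (i - 1)) = Ob A (i - 1) \<boxtimes> Ob K j"
      "Dom C (\<iota> (i + j - 1) i) = Ob A i \<boxtimes> Ob K (j - 1)"
      "Dom C (\<iota> (i + j + 1) (i + 1)) = Ob A (i + 1) \<boxtimes> Ob K j"
      "Dom C (\<iota> (i + j + 1) i) = Ob A i \<boxtimes> Ob K (j + 1)"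
      using in_hom(2) by (simp_all add: algebra_simps)
    note arrs = arr in_hom(1,3) d[of i] d[of j] d[of "i - 1"] d[of "j - 1"]
      pts[of j] pts[of "j + 1"] pts(7-)[of j i] pts(7-)[of j "i + 1"] pts(7-)[of "j + 1" i]
    let ?e = "\<iota> (i + j) i" and ?f = "\<iota> (i + j) (i - 1)" and ?g = "\<iota> (i + j) (i + 1)"
    \<comment> \<open>The x come from \<open>s\<close> against the differential of \<open>A\<close>,
      the y from \<open>t\<close> against that of \<open>K\<close>. The b measure how far
      \<open>s\<close> is from commuting with the differential of \<open>K\<close>;
      \<open>?z\<close> pairs \<open>t\<close> with the differential of \<open>A\<close> and occurs
      with the signs of i and i + 1.\<close>
    let ?x1 = "(Df A (i - 1) \<star> Ide C (Ob K j)) \<bullet> s j i"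
    let ?x2 = "s j (i + 1) \<bullet> (Df A i \<star> Ide C (Ob K j))"
    let ?y1 = "Ide C (Ob A i) \<star> (Df K (j - 1) \<bullet> t j)"
    let ?y2 = "Ide C (Ob A i) \<star> (t (j + 1) \<bullet> Df K j)"
    let ?b1 = "sgn_mor C (i - 1) ((Ide C (Ob A (i - 1)) \<star> Df K j) \<bullet> s j i)"
    let ?b2 = "sgn_mor C i (s (j + 1) i \<bullet> (Ide C (Ob A i) \<star> Df K j))"
    let ?z = "?g \<bullet> (Df A i \<star> t j)"
    have D1: "Df T (i + j - 1) \<bullet> \<iota> (i + j - 1) (i - 1) = ?e \<bullet> (Df A (i - 1) \<star> Ide C (Ob K j)) \<boxplus>
       ?f \<bullet> sgn_mor C (i - 1) (Ide C (Ob A (i - 1)) \<star> Df K j)"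
      using D[of "i + j - 1" "i - 1"] by (simp add: algebra_simps)
    have D2: "Df T (i + j - 1) \<bullet> \<iota> (i + j - 1) i = ?g \<bullet> (Df A i \<star> Ide C (Ob K (j - 1))) \<boxplus>
       ?e \<bullet> sgn_mor C i (Ide C (Ob A i) \<star> Df K (j - 1))"
      using D[of "i + j - 1" i] by (simp add: algebra_simps)
    have H0: "H (i + j) \<bullet> ?e = \<iota> (i + j - 1) (i - 1) \<bullet> s j i \<boxplus>
       \<iota> (i + j - 1) i \<bullet> sgn_mor C i (Ide C (Ob A i) \<star> t j)"
      using H(2)[of "i + j" i] unfolding a_def by (simp add: algebra_simps)
    have H1: "H (i + j + 1) \<bullet> \<iota> (i + j + 1) (i + 1) = ?e \<bullet> s j (i + 1) \<boxplus>
       ?g \<bullet> sgn_mor C (i + 1) (Ide C (Ob A (i + 1)) \<star> t j)"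
      using H(2)[of "i + j + 1" "i + 1"] unfolding a_def by (simp add: algebra_simps)
    have H2: "H (i + j + 1) \<bullet> \<iota> (i + j + 1) i = ?f \<bullet> s (j + 1) i \<boxplus>
       ?e \<bullet> sgn_mor C i (Ide C (Ob A i) \<star> t (j + 1))"
      using H(2)[of "i + j + 1" i] unfolding a_def by (simp add: algebra_simps)
    have D0: "Df T (i + j) \<bullet> ?e = \<iota> (i + j + 1) (i + 1) \<bullet> (Df A i \<star> Ide C (Ob K j)) \<boxplus>
       \<iota> (i + j + 1) i \<bullet> sgn_mor C i (Ide C (Ob A i) \<star> Df K j)"
      using D[of "i + j" i] by simp
    note Harrs = Harr[of "i + j"] Harr[of "i + j + 1"] d(7-)[of "i + j - 1"] d(7-)[of "i + j"]
    have "(Df T (i + j - 1) \<bullet> H (i + j)) \<bullet> ?e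
      = (Df T (i + j - 1) \<bullet> \<iota> (i + j - 1) (i - 1)) \<bullet> s j i \<boxplus>
        (Df T (i + j - 1) \<bullet> \<iota> (i + j - 1) i) \<bullet> sgn_mor C i (Ide C (Ob A i) \<star> t j)"
      using arrs Harrs by (simp add: H0 del: sgn_comp)
    also have "\<dots> = (?e \<bullet> ?x1 \<boxplus> ?f \<bullet> ?b1) \<boxplus> (sgn_mor C i ?z \<boxplus> ?e \<bullet> ?y1)"
      unfolding D1 D2 using arrs by (simp add: sgn_twice)
    finally have E1: "(Df T (i + j - 1) \<bullet> H (i + j)) \<bullet> ?e = (?e \<bullet> ?x1 \<boxplus> ?f \<bullet> ?b1) \<boxplus> (sgn_mor C i ?z \<boxplus> ?e \<bullet> ?y1)" .
    have "(H (i + j + 1) \<bullet> Df T (i + j)) \<bullet> ?e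
      = (H (i + j + 1) \<bullet> \<iota> (i + j + 1) (i + 1)) \<bullet> (Df A i \<star> Ide C (Ob K j)) \<boxplus>
        (H (i + j + 1) \<bullet> \<iota> (i + j + 1) i) \<bullet> sgn_mor C i (Ide C (Ob A i) \<star> Df K j)"
      using arrs Harrs by (simp add: D0 del: sgn_comp)
    also have "\<dots> = (?e \<bullet> ?x2 \<boxplus> sgn_mor C (i + 1) ?z) \<boxplus> (?f \<bullet> ?b2 \<boxplus> ?e \<bullet> ?y2)"
      unfolding H1 H2 using arrs by (simp add: sgn_twice)
    finally have E2: "(H (i + j + 1) \<bullet> Df T (i + j)) \<bullet> ?e
      = (?e \<bullet> ?x2 \<boxplus> sgn_mor C (i + 1) ?z) \<boxplus> (?f \<bullet> ?b2 \<boxplus> ?e \<bullet> ?y2)" .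
    let ?c = "(?x1 \<boxplus> ?x2) \<boxplus> (?y1 \<boxplus> ?y2)" and ?b = "?b1 \<boxplus> ?b2"
    have E: "DH (i + j) \<bullet> ?e = ?e \<bullet> ?c \<boxplus> ?f \<bullet> ?b"
    proof -
      have "DH (i + j) \<bullet> ?e = (Df T (i + j - 1) \<bullet> H (i + j)) \<bullet> ?e \<boxplus> (H (i + j + 1) \<bullet> Df T (i + j)) \<bullet> ?e"
        unfolding DH_def using arrs Harrs by simp
      also have "\<dots> = (((?e \<bullet> ?x1 \<boxplus> ?e \<bullet> ?x2) \<boxplus> (?e \<bullet> ?y1 \<boxplus> ?e \<bullet> ?y2)) \<boxplus> (?f \<bullet> ?b1 \<boxplus> ?f \<bullet> ?b2))
          \<boxplus> (sgn_mor C i ?z \<boxplus> sgn_mor C (i + 1) ?z)"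
        unfolding E1 E2
        by (rule plus_rearrange[of _ "Ob A i \<boxtimes> Ob K j" "Ob T (i + j)"])
          (use arrs in \<open>simp_all add: in_Hom_iff\<close>)
      also have "((?e \<bullet> ?x1 \<boxplus> ?e \<bullet> ?x2) \<boxplus> (?e \<bullet> ?y1 \<boxplus> ?e \<bullet> ?y2)) \<boxplus> (?f \<bullet> ?b1 \<boxplus> ?f \<bullet> ?b2)
          = ?e \<bullet> ?c \<boxplus> ?f \<bullet> ?b"
        using arrs by simp
      also have "sgn_mor C i ?z \<boxplus> sgn_mor C (i + 1) ?z = Zero C (Ob A i \<boxtimes> Ob K j) (Ob T (i + j))"
        using sgn_Suc_cancel(2)[of ?z i] arrs by simp
      also have "(?e \<bullet> ?c \<boxplus> ?f \<bullet> ?b) \<boxplus> Zero C (Ob A i \<boxtimes> Ob K j) (Ob T (i + j)) = ?e \<bullet> ?c \<boxplus> ?f \<bullet> ?b"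
        using arrs by (intro plus_zero) simp_all
      finally show ?thesis .
    qed
    \<comment> \<open>The contraction of \<open>K\<close> writes the identity as 1 \<otimes> p plus
      the y, and the null-homotopy writes 1 \<otimes> p as \<open>q\<close> plus the x. Hence
      subtracting d H + H d from the identity leaves \<open>q\<close> on the diagonal.\<close>
    have one: "Ide C (Ob A i \<boxtimes> Ob K j) = q j i \<boxplus> ?c"
    proof -
      have "Ide C (Ob A i \<boxtimes> Ob K j) = Ide C (Ob A i) \<star> Ide C (Ob K j)" by (simp add: ten_ide)
      also have "\<dots> = (Ide C (Ob A i) \<star> p j) \<boxplus> (?y1 \<boxplus> ?y2)"
        unfolding homotopic_to_ideD(4)[OF pt(1), of j, symmetric] using arrs by simp
      also have "\<dots> = q j i \<boxplus> ?c"
        unfolding qs(3) using arrs by (simp add: plus_assoc)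
      finally show ?thesis .
    qed
    have "P (i + j) \<bullet> ?e = ?e \<bullet> Ide C (Ob A i \<boxtimes> Ob K j) \<boxplus> neg (DH (i + j) \<bullet> ?e)"
      unfolding P_def using DH[of "i + j"] arrs by simp
    also have "\<dots> = ?e \<bullet> q j i \<boxplus> ?f \<bullet> neg ?b"
    proof -
      have c: "?c \<in> Arr C" "Dom C ?c = Ob A i \<boxtimes> Ob K j" "Cod C ?c = Ob A i \<boxtimes> Ob K j"
        and b: "?b \<in> Arr C" "Dom C ?b = Ob A i \<boxtimes> Ob K j" "Cod C ?b = Ob A (i - 1) \<boxtimes> Ob K (j + 1)"
        using arrs by simp_all
      define c b where "c = ?c" and "b = ?b"
      have "?e \<bullet> (q j i \<boxplus> c) \<boxplus> neg (?e \<bullet> c \<boxplus> ?f \<bullet> b) = ?e \<bullet> q j i \<boxplus> ((?e \<bullet> c \<boxplus> neg (?e \<bullet> c)) \<boxplus> ?f \<bullet> neg b)"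
        using c b arrs unfolding c_def[symmetric] b_def[symmetric] by (simp add: plus_assoc del: plus_neg)
      also have "\<dots> = ?e \<bullet> q j i \<boxplus> ?f \<bullet> neg b"
        using c b arrs unfolding c_def[symmetric] b_def[symmetric] by simp
      finally show ?thesis unfolding one E c_def b_def .
    qed
    finally show ?thesis using arrs by (intro exI[of _ "neg ?b"]) (simp add: in_Hom_iff)
  qed
  \<comment> \<open>The condition says that j is at least i, so j differs from i - 1 and the
    projection to j kills the lowering part; only a multiple of \<open>q\<close> remains.\<close>
  have "\<pi> n j \<bullet> (P n \<bullet> \<iota> n i) \<in> J (Ob A i \<boxtimes> Ob K (n - i)) (Ob A j \<boxtimes> Ob K (n - j))"
    if ij: "i < j + 1" for n i j
  proof -
    obtain b where b: "b \<in> Hom C (Ob A i \<boxtimes> Ob K (n - i)) (Ob A (i - 1) \<boxtimes> Ob K (n - i + 1))"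
      "P n \<bullet> \<iota> n i = \<iota> n i \<bullet> q (n - i) i \<boxplus> \<iota> n (i - 1) \<bullet> b"
      using P_coeff[of i "n - i"] by auto
    have n: "n - (i - 1) = n - i + 1" by simp
    have z: "\<pi> n j \<bullet> \<iota> n (i - 1) = Zero C (Ob A (i - 1) \<boxtimes> Ob K (n - i + 1)) (Ob A j \<boxtimes> Ob K (n - j))"
      using family_pr_in_neq[OF fam, of j "i - 1" n] ij n by simp
    have dom: "Dom C (\<iota> n (i - 1)) = Ob A (i - 1) \<boxtimes> Ob K (n - i + 1)"
      using in_hom(2)[of n "i - 1"] unfolding n .
    note arrs = b(1) in_hom(1,3-) in_hom(2)[of n i] dom pts
    have "\<pi> n j \<bullet> (P n \<bullet> \<iota> n i) = (\<pi> n j \<bullet> \<iota> n i) \<bullet> q (n - i) i \<boxplus> (\<pi> n j \<bullet> \<iota> n (i - 1)) \<bullet> b"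
      unfolding b(2) using arrs by (simp add: in_Hom_iff)
    also have "\<dots> = (\<pi> n j \<bullet> \<iota> n i) \<bullet> q (n - i) i"
      unfolding z using arrs by (simp add: in_Hom_iff)
    finally show ?thesis
      using ideal_comp_left[OF J qs(1)[of "n - i" i], of "\<pi> n j \<bullet> \<iota> n i"] in_hom
      by (simp add: in_Hom_iff)
  qed
  then show ?thesis using that hti by blast
qed

text \<open>The error of \<open>tensor_lowering_homotopy\<close> lowers the A-degree modulo
  \<open>J\<close>. Its powers are errors of homotopies as well, by
  \<open>homotopic_to_ide_comp\<close>, and a power exceeding the width of the support of
  \<open>A\<close> has all its entries in \<open>J\<close>.\<close>

theorem contractible_mod_tensor_complex:
  assumes A: "bounded_complex C A" and K: "bounded_complex C K"
    and J: "two_sided_ideal C J"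
    and null: "\<And>X Y \<phi>. \<phi> \<in> J' X Y \<Longrightarrow> null_tensor C J A X Y \<phi>"
    and contr: "contractible_mod C J' K"
  shows "contractible_mod C J (tensor_complex C A K)"
proof -
  define T where "T = tensor_complex C A K"
  have T: "bounded_complex C T"
    unfolding T_def using bounded_tensor_complex[OF A K] .
  obtain \<iota> \<pi> where fam: "\<And>n. biproduct_family C (\<lambda>i. Ob A i \<boxtimes> Ob K (n - i)) (Ob T n) (\<iota> n) (\<pi> n)"
    and "\<And>n. Df T n \<in> Hom C (Ob T n) (Ob T (n + 1))"
    and D: "\<And>n i. Df T n \<bullet> \<iota> n i = \<iota> (n + 1) (i + 1) \<bullet> (Df A i \<star> Ide C (Ob K (n - i))) \<boxplus>
       \<iota> (n + 1) i \<bullet> sgn_mor C i (Ide C (Ob A i) \<star> Df K (n - i))"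
    using tensor_complex_structure[OF A K, folded T_def] by blast
  let ?X = "\<lambda>n i. Ob A i \<boxtimes> Ob K (n - i)"
  \<comment> \<open>Modulo \<open>J\<close>, every nonzero entry of \<open>P\<close> lowers the
    degree in \<open>A\<close> by at least k.\<close>
  let ?low = "\<lambda>k P. \<forall>n i j. i < j + k \<longrightarrow> \<pi> n j \<bullet> (P n \<bullet> \<iota> n i) \<in> J (?X n i) (?X n j)"
  obtain P H where P: "homotopic_to_ide C T P H" "?low 1 P"
    using tensor_lowering_homotopy[OF A K J null contr fam T D] by metis
  have in_hom: "\<iota> n i \<in> Hom C (?X n i) (Ob T n)" "\<pi> n i \<in> Hom C (Ob T n) (?X n i)" for n i
    using family_in[OF fam] family_pr[OF fam] by auto
  have powers: "\<exists>Q H. homotopic_to_ide C T Q H \<and> ?low (int (Suc k)) Q" for k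
  proof (induction k)
    case 0
    show ?case using P by auto
  next
    case (Suc k)
    then obtain Q G where Q: "homotopic_to_ide C T Q G" "?low (int (Suc k)) Q" by blast
    have "?low (int (Suc (Suc k))) (\<lambda>n. P n \<bullet> Q n)"
    proof (intro allI impI)
      fix n i l assume il: "i < l + int (Suc (Suc k))"
      have PQ: "P n \<in> Hom C (Ob T n) (Ob T n)" "Q n \<in> Hom C (Ob T n) (Ob T n)"
        using homotopic_to_ideD(1)[OF P(1)] homotopic_to_ideD(1)[OF Q(1)] by auto
      have "(\<pi> n l \<bullet> P n) \<bullet> (Q n \<bullet> \<iota> n i) \<in> J (?X n i) (?X n l)"
      proof (rule family_comp_ideal[OF fam J])
        show hom: "Q n \<bullet> \<iota> n i \<in> Hom C (?X n i) (Ob T n)" "\<pi> n l \<bullet> P n \<in> Hom C (Ob T n) (?X n l)"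
          using PQ in_hom by (auto intro: comp_in_hom)
        fix j
        have 1: "\<pi> n l \<bullet> (P n \<bullet> \<iota> n j) \<in> Hom C (?X n j) (?X n l)"
          and 2: "\<pi> n j \<bullet> (Q n \<bullet> \<iota> n i) \<in> Hom C (?X n i) (?X n j)"
          using PQ in_hom by (meson comp_in_hom)+
        have "(\<pi> n l \<bullet> P n) \<bullet> \<iota> n j = \<pi> n l \<bullet> (P n \<bullet> \<iota> n j)"
          using PQ in_hom by (meson comp_assoc)
        moreover have "(\<pi> n l \<bullet> (P n \<bullet> \<iota> n j)) \<bullet> (\<pi> n j \<bullet> (Q n \<bullet> \<iota> n i)) \<in> J (?X n i) (?X n l)"
        \<comment> \<open>On the way from i over j to l, either \<open>Q\<close> lowers by less than
          k + 1, so its entry is in \<open>J\<close>, or it has used up so much of the total that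
          \<open>P\<close> lowers by less than 1, so the entry of \<open>P\<close> is in
          \<open>J\<close>.\<close>
        proof (cases "i < j + int (Suc k)")
          case True
          then show ?thesis using ideal_comp_left[OF J _ 1] Q(2) by blast
        next
          case False
          then have "j < l + 1" using il by simp
          then show ?thesis using ideal_comp_right[OF J _ 2] P(2) by blast
        qed
        ultimately show "((\<pi> n l \<bullet> P n) \<bullet> \<iota> n j) \<bullet> (\<pi> n j \<bullet> (Q n \<bullet> \<iota> n i)) \<in> J (?X n i) (?X n l)"
          by simp
      qed
      moreover have "(\<pi> n l \<bullet> P n) \<bullet> (Q n \<bullet> \<iota> n i) = \<pi> n l \<bullet> ((P n \<bullet> Q n) \<bullet> \<iota> n i)"
        using PQ in_hom[of n i] in_hom[of n l] by (simp add: in_Hom_iff)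
      ultimately show "\<pi> n l \<bullet> ((P n \<bullet> Q n) \<bullet> \<iota> n i) \<in> J (?X n i) (?X n l)" by simp
    qed
    then show ?case using homotopic_to_ide_comp[OF T P(1) Q(1)] by blast
  qed
  \<comment> \<open>Two degrees in the support differ by at most 2 N, so lowering by 2 N + 1 is
    impossible between them.\<close>
  obtain N where N: "\<And>i. i \<in> supp C A \<Longrightarrow> \<bar>i\<bar> \<le> N"
    using bounded_complexD(5)[OF A] finite_imageI[of _ abs]
    by (metis Max_ge imageI)
  obtain Q G where Q: "homotopic_to_ide C T Q G" "?low (int (Suc (nat (2 * N)))) Q"
    using powers by blast
  have "Q n \<in> J (Ob T n) (Ob T n)" for n
  proof -
    have Qn: "Q n \<in> Hom C (Ob T n) (Ob T n)"
      using homotopic_to_ideD(1)[OF Q(1)] .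
    have coeff: "\<pi> n j \<bullet> (Q n \<bullet> \<iota> n i) \<in> J (?X n i) (?X n j)" for i j
    proof (cases "i \<in> supp C A \<and> j \<in> supp C A")
      case True
      then have "i < j + int (Suc (nat (2 * N)))" using N[of i] N[of j] by simp
      then show ?thesis using Q(2) by blast
    next
      case False
      then have "is_zero_obj C (?X n i) \<or> is_zero_obj C (?X n j)"
        unfolding supp_def using zero_obj_ten by blast
      moreover have "\<pi> n j \<bullet> (Q n \<bullet> \<iota> n i) \<in> Hom C (?X n i) (?X n j)"
        using Qn in_hom by (meson comp_in_hom)
      ultimately have "\<pi> n j \<bullet> (Q n \<bullet> \<iota> n i) = Zero C (?X n i) (?X n j)"
        using zero_obj_arr in_HomD by metis
      then show ?thesis using ideal_zero[OF J] by simp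
    qed
    show ?thesis
    proof (rule family_ideal[OF fam J Qn], rule family_ideal'[OF fam J])
      show "Q n \<bullet> \<iota> n i \<in> Hom C (?X n i) (Ob T n)" for i
        using Qn in_hom by (meson comp_in_hom)
    qed (rule coeff)
  qed
  then show ?thesis using Q(1) unfolding contractible_mod_def T_def by blast
qed

end

section \<open>Contractibility and homotopy equivalence; boundedness of stalks, shifts and
  cones\<close>

context preadditive_category
begin

text \<open>The identity of \<open>T\<close> is homotopic to g f = g id f, which passes through the
  identity of \<open>K\<close> and so lies in \<open>J\<close>. The homotopy changes sign because
  \<open>homotopic\<close> puts the identity on the other side.\<close>

lemma contractible_mod_htpy_equiv:
  assumes T: "bounded_complex C T" and J: "two_sided_ideal C J"
    and equiv: "htpy_equiv C T K" and K: "\<And>n. Ide C (Ob K n) \<in> J (Ob K n) (Ob K n)"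
  shows "contractible_mod C J T"
proof -
  obtain f g h where f: "chain_map C T K f" and g: "chain_map C K T g"
    and h: "\<And>n. h n \<in> Hom C (Ob T n) (Ob T (n - 1))"
    and gf: "\<And>n. g n \<bullet> f n = Ide C (Ob T n) \<boxplus> (Df T (n - 1) \<bullet> h n \<boxplus> h (n + 1) \<bullet> Df T n)"
    using equiv unfolding htpy_equiv_def homotopic_def by blast
  have "Ide C (Ob T n) = g n \<bullet> f n \<boxplus> (Df T (n - 1) \<bullet> neg (h n) \<boxplus> neg (h (n + 1)) \<bullet> Df T n)" for n
  proof -
    let ?x = "Df T (n - 1) \<bullet> h n \<boxplus> h (n + 1) \<bullet> Df T n"
    have d: "Df T (n - 1) \<in> Hom C (Ob T (n - 1)) (Ob T n)" "Df T n \<in> Hom C (Ob T n) (Ob T (n + 1))"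
      "h (n + 1) \<in> Hom C (Ob T (n + 1)) (Ob T n)"
      using bounded_complexD(1,2)[OF T, of n] h[of "n + 1"] by auto
    have "Ide C (Ob T n) = g n \<bullet> f n \<boxplus> neg ?x"
      unfolding gf using d h[of n] by (simp add: in_Hom_iff plus_assoc del: sgn_plus)
    then show ?thesis using d h[of n] by (simp add: in_Hom_iff)
  qed
  moreover have gf_hom: "f n \<in> Hom C (Ob T n) (Ob K n)" "g n \<in> Hom C (Ob K n) (Ob T n)" for n
    using f g unfolding chain_map_def by auto
  then have "g n \<bullet> f n \<in> Hom C (Ob T n) (Ob T n)" for n by (auto intro: comp_in_hom)
  moreover have "g n \<bullet> f n \<in> J (Ob T n) (Ob T n)" for n
    using ideal_comp_left[OF J ideal_comp_right[OF J K gf_hom(1)] gf_hom(2), of n]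
      comp_ide_left[OF gf_hom(1), of n] by simp
  ultimately show ?thesis
    unfolding contractible_mod_def homotopic_to_ide_def using sgn_in_hom[OF h]
    by (intro exI[of _ "\<lambda>n. g n \<bullet> f n"] exI[of _ "\<lambda>n. neg (h n)"]) auto
qed

end

context additive_category
begin

text \<open>The biproduct of the empty family has the empty sum as its identity; this justifies the
  choice made in \<open>zero_obj\<close>.\<close>

lemma is_zero_obj_zero_obj: "is_zero_obj C (zero_obj C)"
proof -
  obtain S \<iota> \<pi> where S: "is_biproduct C ({} :: int set) (\<lambda>_. undefined) S \<iota> \<pi>"
    using biproducts[of "{}" "\<lambda>_. undefined"] by auto
  interpret abelian_group "homs C S S" by (rule hom_abelian_group)
  have "is_zero_obj C S"
    using S by (simp add: is_biproduct_def is_zero_obj_def)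
  then show ?thesis unfolding zero_obj_def by (rule someI)
qed

lemma stalk_simps:
  "Ob (stalk C X k) n = (if n = k then X else zero_obj C)"
  "Df (stalk C X k) n = Zero C (Ob (stalk C X k) n) (Ob (stalk C X k) (n + 1))"
  by (simp_all add: stalk_def Let_def)

lemma bounded_stalk: "bounded_complex C (stalk C X k)"
proof -
  have "supp C (stalk C X k) \<subseteq> {k}"
    unfolding supp_def using is_zero_obj_zero_obj by (auto simp: stalk_simps(1))
  then show ?thesis
    unfolding bounded_complex_def stalk_simps(2)
    by (auto simp: in_Hom_iff add.assoc intro: finite_subset)
qed

lemma bounded_hshift:
  assumes "bounded_complex C K"
  shows "bounded_complex C (hshift C b K)"
proof -
  have d: "Df K n \<in> Arr C" "Dom C (Df K n) = Ob K n" "Cod C (Df K n) = Ob K (n + 1)" for n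
    using bounded_complexD(1)[OF assms, of n] by (auto simp: in_Hom_iff)
  have "supp C (hshift C b K) \<subseteq> (\<lambda>n. n - b) ` supp C K"
  proof
    fix n assume "n \<in> supp C (hshift C b K)"
    then show "n \<in> (\<lambda>n. n - b) ` supp C K"
      by (intro image_eqI[of _ _ "n + b"]) (simp_all add: supp_def hshift_def)
  qed
  then have "finite (supp C (hshift C b K))"
    using finite_subset bounded_complexD(5)[OF assms] by blast
  moreover have "sgn_mor C b (Df K (n + b)) \<in> Hom C (Ob K (n + b)) (Ob K (n + 1 + b))" for n
    using d[of "n + b"] by (simp add: in_Hom_iff algebra_simps)
  moreover have "sgn_mor C b (Df K (n + 1 + b)) \<bullet> sgn_mor C b (Df K (n + b))
      = Zero C (Ob K (n + b)) (Ob K (n + 2 + b))" for n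
  proof -
    have n: "n + 1 + b = n + b + 1" "n + 2 + b = n + b + 2" by simp_all
    show ?thesis
      unfolding n using d[of "n + b"] d[of "n + b + 1"] bounded_complexD(3)[OF assms, of "n + b"] by simp
  qed
  ultimately show ?thesis unfolding bounded_complex_def by (simp add: hshift_def)
qed

text \<open>On the first summand the square of the differential has the off-diagonal part d f - f d,
  which vanishes since \<open>f\<close> is a chain map. The remaining parts are squares of the
  differentials of \<open>K\<close> and \<open>L\<close>, up to sign.\<close>

lemma bounded_cone:
  assumes K: "bounded_complex C K" and L: "bounded_complex C L" and f: "chain_map C K L f"
  shows "bounded_complex C (cone C K L f)"
proof -
  define X where "X = (\<lambda>n. pair (Ob K (n + 1)) (Ob L n))"
  define S where "S = (\<lambda>n. bp_obj C {0, 1} (X n))"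
  define i0 where "i0 = (\<lambda>n. bp_in C {0, 1} (X n) 0)"
  define i1 where "i1 = (\<lambda>n. bp_in C {0, 1} (X n) 1)"
  define p0 where "p0 = (\<lambda>n. bp_pr C {0, 1} (X n) 0)"
  define p1 where "p1 = (\<lambda>n. bp_pr C {0, 1} (X n) 1)"
  define D where "D = (\<lambda>n. i0 (n + 1) \<bullet> sgn_mor C 1 (Df K (n + 1)) \<bullet> p0 n \<boxplus>
    (i1 (n + 1) \<bullet> f (n + 1) \<bullet> p0 n \<boxplus> i1 (n + 1) \<bullet> Df L n \<bullet> p1 n))"
  have cone: "Ob (cone C K L f) = S" "Df (cone C K L f) = D"
    by (simp_all add: cone_def Let_def S_def D_def i0_def i1_def p0_def p1_def X_def)
  have bp: "is_biproduct C {0, 1} (X n) (S n) (bp_in C {0, 1} (X n)) (bp_pr C {0, 1} (X n))" for n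
    unfolding S_def by (rule biproduct_chosen) simp
  have X: "X n 0 = Ob K (n + 1)" "X n 1 = Ob L n" for n
    by (simp_all add: X_def pair_def)
  have i: "i0 n \<in> Arr C" "Dom C (i0 n) = Ob K (n + 1)" "Cod C (i0 n) = S n"
    "i1 n \<in> Arr C" "Dom C (i1 n) = Ob L n" "Cod C (i1 n) = S n"
    "p0 n \<in> Arr C" "Cod C (p0 n) = Ob K (n + 1)" "Dom C (p0 n) = S n"
    "p1 n \<in> Arr C" "Cod C (p1 n) = Ob L n" "Dom C (p1 n) = S n" for n
    using is_biproductD(1,2)[OF bp[of n], of 0] is_biproductD(1,2)[OF bp[of n], of 1]
    unfolding i0_def i1_def p0_def p1_def X by (auto simp: in_Hom_iff)
  have pi: "p0 n \<bullet> i0 n = Ide C (Ob K (n + 1))" "p1 n \<bullet> i1 n = Ide C (Ob L n)"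
    "p1 n \<bullet> i0 n = Zero C (Ob K (n + 1)) (Ob L n)" "p0 n \<bullet> i1 n = Zero C (Ob L n) (Ob K (n + 1))" for n
    using is_biproductD(3)[OF bp[of n], of 0] is_biproductD(3)[OF bp[of n], of 1]
      is_biproductD(4)[OF bp[of n], of 0 1] is_biproductD(4)[OF bp[of n], of 1 0]
    unfolding i0_def i1_def p0_def p1_def X by auto
  have d: "Df K n \<in> Arr C" "Dom C (Df K n) = Ob K n" "Cod C (Df K n) = Ob K (n + 1)"
    "Df L n \<in> Arr C" "Dom C (Df L n) = Ob L n" "Cod C (Df L n) = Ob L (n + 1)"
    "f n \<in> Arr C" "Dom C (f n) = Ob K n" "Cod C (f n) = Ob L n" for n
    using bounded_complexD(1)[OF K, of n] bounded_complexD(1)[OF L, of n] f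
    unfolding chain_map_def by (auto simp: in_Hom_iff)
  have D: "D n \<in> Arr C" "Dom C (D n) = S n" "Cod C (D n) = S (n + 1)" for n
    using i[of n] i[of "n + 1"] d[of "n + 1"] d[of n] unfolding D_def by simp_all
  have Di: "D n \<bullet> i0 n = i0 (n + 1) \<bullet> neg (Df K (n + 1)) \<boxplus> i1 (n + 1) \<bullet> f (n + 1)"
    "D n \<bullet> i1 n = i1 (n + 1) \<bullet> Df L n" for n
    using i[of n] i[of "n + 1"] d[of "n + 1"] d[of n] pi[of n] unfolding D_def by simp_all
  have DD: "D (n + 1) \<bullet> D n = Zero C (S n) (S (n + 2))" for n
  proof (rule biproduct_ext[OF bp[of n]])
    have n: "n + 1 + 1 = n + 2" by simp
    note arrs = D[of n] D[of "n + 1", unfolded n] i[of n] i[of "n + 1", unfolded n] i[of "n + 2"]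
      d[of "n + 1", unfolded n] d[of n] d[of "n + 2"]
    show "D (n + 1) \<bullet> D n \<in> Hom C (S n) (S (n + 2))"
      using arrs by (simp only: in_Hom_iff comp_arr)
    show "Zero C (S n) (S (n + 2)) \<in> Hom C (S n) (S (n + 2))"
      by (rule zero_in_hom)
    have "(D (n + 1) \<bullet> D n) \<bullet> i0 n = Zero C (Ob K (n + 1)) (S (n + 2))"
    proof -
      let ?x = "f (n + 2) \<bullet> Df K (n + 1)"
      have "(D (n + 1) \<bullet> D n) \<bullet> i0 n = D (n + 1) \<bullet> (D n \<bullet> i0 n)"
        using arrs by (intro assoc) simp_all
      also have "\<dots> = (D (n + 1) \<bullet> i0 (n + 1)) \<bullet> neg (Df K (n + 1)) \<boxplus> (D (n + 1) \<bullet> i1 (n + 1)) \<bullet> f (n + 1)"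
        unfolding Di(1)[of n] using arrs by (simp del: sgn_comp)
      also have "\<dots> = (i0 (n + 2) \<bullet> (neg (Df K (n + 2)) \<bullet> neg (Df K (n + 1))) \<boxplus> neg (i1 (n + 2) \<bullet> ?x))
          \<boxplus> i1 (n + 2) \<bullet> (Df L (n + 1) \<bullet> f (n + 1))"
        unfolding Di n using arrs by (simp add: neg_comp del: sgn_comp)
      also have "neg (Df K (n + 2)) \<bullet> neg (Df K (n + 1)) = Zero C (Ob K (n + 1)) (Ob K (n + 3))"
        using arrs bounded_complexD(3)[OF K, of "n + 1"] by (simp add: add.commute)
      also have "Df L (n + 1) \<bullet> f (n + 1) = ?x"
        using f unfolding chain_map_def by (metis n)
      finally show ?thesis using arrs by (simp add: add.commute)
    qed
    moreover have "(D (n + 1) \<bullet> D n) \<bullet> i1 n = Zero C (Ob L n) (S (n + 2))"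
    proof -
      have "(D (n + 1) \<bullet> D n) \<bullet> i1 n = D (n + 1) \<bullet> (D n \<bullet> i1 n)"
        using arrs by (intro assoc) simp_all
      also have "\<dots> = (D (n + 1) \<bullet> i1 (n + 1)) \<bullet> Df L n"
        unfolding Di(2)[of n] using arrs by simp
      also have "\<dots> = i1 (n + 2) \<bullet> (Df L (n + 1) \<bullet> Df L n)"
        unfolding Di n using arrs by simp
      finally show ?thesis using arrs bounded_complexD(3)[OF L, of n] by simp
    qed
    ultimately show "(D (n + 1) \<bullet> D n) \<bullet> bp_in C {0, 1} (X n) j = Zero C (S n) (S (n + 2)) \<bullet> bp_in C {0, 1} (X n) j"
      if "j \<in> {0, 1}" for j
      using that i[of n] unfolding i0_def i1_def by auto
  qed
  have "supp C (cone C K L f) \<subseteq> (\<lambda>n. n - 1) ` supp C K \<union> supp C L"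
  proof
    fix n assume n: "n \<in> supp C (cone C K L f)"
    show "n \<in> (\<lambda>n. n - 1) ` supp C K \<union> supp C L"
    proof (rule ccontr)
      assume "n \<notin> (\<lambda>n. n - 1) ` supp C K \<union> supp C L"
      then have "n + 1 \<notin> supp C K" "n \<notin> supp C L" by force+
      then have z: "is_zero_obj C (X n j)" for j
        unfolding X_def pair_def supp_def by simp
      have "is_zero_obj C (S n)"
        unfolding is_zero_obj_def
      proof (rule biproduct_ext[OF bp[of n]])
        fix j :: int assume j: "j \<in> {0, 1}"
        have "bp_in C {0, 1} (X n) j = Zero C (X n j) (S n)"
          using is_biproductD(1)[OF bp[of n] j] zero_obj_arr(1)[OF z[of j], of "bp_in C {0, 1} (X n) j"]
          by (auto simp: in_Hom_iff)
        then show "Ide C (S n) \<bullet> bp_in C {0, 1} (X n) j = Zero C (S n) (S n) \<bullet> bp_in C {0, 1} (X n) j"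
          by simp
      qed (auto simp: in_Hom_iff)
      then show False using n unfolding supp_def cone by simp
    qed
  qed
  then have "finite (supp C (cone C K L f))"
    using bounded_complexD(5)[OF K] bounded_complexD(5)[OF L] finite_subset by blast
  then show ?thesis using D DD unfolding bounded_complex_def cone by (simp add: in_Hom_iff)
qed

text \<open>Modulo the zero ideal the error \<open>p\<close> is 0, so \<open>h\<close> is a genuine
  contraction. Both comparison maps are zero, and \<open>neg (h n)\<close> exhibits the zero map as
  homotopic to the identity in the convention of \<open>homotopic\<close>.\<close>

lemma htpy_equiv_zero_complex:
  assumes K: "bounded_complex C K" and contr: "contractible_mod C (\<lambda>X Y. {Zero C X Y}) K"
  shows "htpy_equiv C K (zero_complex C)"
proof -
  let ?Z = "zero_complex C"
  have Z: "Ob ?Z n = zero_obj C" "Df ?Z n = Zero C (zero_obj C) (zero_obj C)" for n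
    by (simp_all add: zero_complex_def)
  have Ide_Z: "Ide C (zero_obj C) = Zero C (zero_obj C) (zero_obj C)"
    using is_zero_obj_zero_obj by (simp add: is_zero_obj_def)
  have d: "Df K n \<in> Arr C" "Dom C (Df K n) = Ob K n" "Cod C (Df K n) = Ob K (n + 1)" for n
    using bounded_complexD(1)[OF K, of n] by (auto simp: in_Hom_iff)
  obtain p h where ph: "homotopic_to_ide C K p h" "\<And>n. p n \<in> {Zero C (Ob K n) (Ob K n)}"
    using contr unfolding contractible_mod_def by blast
  have "p = (\<lambda>n. Zero C (Ob K n) (Ob K n))" using ph(2) by auto
  with ph(1) have h: "homotopic_to_ide C K (\<lambda>n. Zero C (Ob K n) (Ob K n)) h" by simp
  define f where "f = (\<lambda>n. Zero C (Ob K n) (zero_obj C))"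
  define g where "g = (\<lambda>n. Zero C (zero_obj C) (Ob K n))"
  have "homotopic C K K (\<lambda>n. g n \<bullet> f n) (\<lambda>n. Ide C (Ob K n))"
    unfolding homotopic_def
  proof (intro exI[of _ "\<lambda>n. neg (h n)"] conjI allI)
    fix n
    show "neg (h n) \<in> Hom C (Ob K n) (Ob K (n - 1))"
      by (rule sgn_in_hom[OF homotopic_to_ideD(2)[OF h]])
    let ?x = "Df K (n - 1) \<bullet> h n \<boxplus> h (n + 1) \<bullet> Df K n"
    note arrs = d[of n] bounded_complexD(2)[OF K, of n] homotopic_to_ideD(2,3)[OF h, of n]
    have x: "Ide C (Ob K n) = ?x"
      using homotopic_to_ideD(4)[OF h, of n] arrs by (simp add: in_Hom_iff)
    have "g n \<bullet> f n = ?x \<boxplus> neg ?x"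
      using arrs unfolding f_def g_def by (simp add: in_Hom_iff del: sgn_plus)
    also have "\<dots> = Ide C (Ob K n) \<boxplus> (Df K (n - 1) \<bullet> neg (h n) \<boxplus> neg (h (n + 1)) \<bullet> Df K n)"
      using arrs unfolding x by (simp add: in_Hom_iff)
    finally show "g n \<bullet> f n = Ide C (Ob K n) \<boxplus> (Df K (n - 1) \<bullet> neg (h n) \<boxplus> neg (h (n + 1)) \<bullet> Df K n)" .
  qed
  moreover have "homotopic C ?Z ?Z (\<lambda>n. f n \<bullet> g n) (\<lambda>n. Ide C (Ob ?Z n))"
    unfolding homotopic_def f_def g_def
    by (intro exI[of _ "\<lambda>n. Zero C (zero_obj C) (zero_obj C)"]) (simp add: Z Ide_Z in_Hom_iff)
  moreover have "chain_map C K ?Z f" "chain_map C ?Z K g"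
    unfolding chain_map_def f_def g_def using d by (simp_all add: Z in_Hom_iff)
  ultimately show ?thesis unfolding htpy_equiv_def by blast
qed

end

context graded_monoidal_krull_schmidt_category
begin

text \<open>Additivity is not among the axioms of the shifts. It is borrowed from the functor that
  tensors with the shifted unit, along the natural isomorphism \<open>shift_right\<close>.\<close>

lemma shift_zero: "ShM C i (Zero C X Y) = Zero C (ShO C i X) (ShO C i Y)"
proof -
  let ?f = "ShM C i (Zero C X Y)"
  have f: "?f \<in> Hom C (ShO C i X) (ShO C i Y)"
    by (rule shift_in_hom[OF zero_in_hom])
  obtain \<phi> where \<phi>: "\<And>X. is_iso C (ShO C i X) (X \<boxtimes> ShO C i (Unit C)) (\<phi> X)"
    and nat: "\<And>X Y f. f \<in> Hom C X Y \<Longrightarrow> \<phi> Y \<bullet> ShM C i f = (f \<star> Ide C (ShO C i (Unit C))) \<bullet> \<phi> X"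
    using shift_right[of i] by blast
  obtain \<psi> where \<psi>: "\<psi> \<in> Hom C (Y \<boxtimes> ShO C i (Unit C)) (ShO C i Y)" "\<psi> \<bullet> \<phi> Y = Ide C (ShO C i Y)"
    using \<phi>[of Y] unfolding is_iso_def by blast
  have hom: "\<phi> X \<in> Hom C (ShO C i X) (X \<boxtimes> ShO C i (Unit C))" for X
    using \<phi>[of X] unfolding is_iso_def by blast
  have "?f = \<psi> \<bullet> (\<phi> Y \<bullet> ?f)"
    using f \<psi> hom[of Y] assoc[of ?f "\<phi> Y" \<psi>] by (simp add: in_Hom_iff)
  also have "\<phi> Y \<bullet> ?f = Zero C (ShO C i X) (Y \<boxtimes> ShO C i (Unit C))"
    using nat[OF zero_in_hom, of Y X] hom[of X] by (simp add: in_Hom_iff)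
  finally show ?thesis using \<psi>(1) by (simp add: in_Hom_iff)
qed

lemma bounded_gshift:
  assumes "bounded_complex C K"
  shows "bounded_complex C (gshift C a K)"
proof -
  have "is_zero_obj C (ShO C a X)" if "is_zero_obj C X" for X
    using that shift_zero[of a X X] shift_ide[of a X] by (simp add: is_zero_obj_def)
  then have "supp C (gshift C a K) \<subseteq> supp C K"
    unfolding supp_def by (auto simp: gshift_def)
  then have "finite (supp C (gshift C a K))"
    using bounded_complexD(5)[OF assms] finite_subset by blast
  moreover have "ShM C a (Df K (n + 1)) \<bullet> ShM C a (Df K n) = Zero C (ShO C a (Ob K n)) (ShO C a (Ob K (n + 2)))" for n
    using shift_comp[OF bounded_complexD(1)[OF assms, of n] bounded_complexD(1)[OF assms, of "n + 1"], symmetric]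
      bounded_complexD(3)[OF assms, of n] shift_zero by simp
  ultimately show ?thesis
    unfolding bounded_complex_def
    using shift_in_hom[OF bounded_complexD(1)[OF assms]] by (simp add: gshift_def)
qed

lemma bounded_Sigma_shift: "bounded_complex C K \<Longrightarrow> bounded_complex C (Sigma_shift C a b K)"
  unfolding Sigma_shift_def by (intro bounded_hshift bounded_gshift)

end

section \<open>Summands and cells\<close>

context preadditive_category
begin

lemma is_isoE:
  assumes "is_iso C X Y f"
  obtains g where "f \<in> Hom C X Y" "g \<in> Hom C Y X" "g \<bullet> f = Ide C X" "f \<bullet> g = Ide C Y"
  using assms unfolding is_iso_def by blast

lemma is_iso_inverse:
  assumes "is_iso C X Y f"
  obtains g where "is_iso C Y X g"
  using assms unfolding is_iso_def by blast

text \<open>A biproduct over \<open>{0, 1}\<close> with its four maps as separate arguments, which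
  spares the index functions in computations with summands.\<close>

definition direct_sum :: "'o \<Rightarrow> 'o \<Rightarrow> 'o \<Rightarrow> 'm \<Rightarrow> 'm \<Rightarrow> 'm \<Rightarrow> 'm \<Rightarrow> bool" where
  "direct_sum Y Z X i p j q \<longleftrightarrow> i \<in> Hom C Y X \<and> p \<in> Hom C X Y \<and> j \<in> Hom C Z X \<and> q \<in> Hom C X Z \<and>
     p \<bullet> i = Ide C Y \<and> q \<bullet> j = Ide C Z \<and> q \<bullet> i = Zero C Y Z \<and> p \<bullet> j = Zero C Z Y \<and>
     i \<bullet> p \<boxplus> j \<bullet> q = Ide C X"

lemma direct_sumD:
  assumes "direct_sum Y Z X i p j q"
  shows "i \<in> Hom C Y X" "p \<in> Hom C X Y" "j \<in> Hom C Z X" "q \<in> Hom C X Z"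
    "p \<bullet> i = Ide C Y" "q \<bullet> j = Ide C Z" "q \<bullet> i = Zero C Y Z" "p \<bullet> j = Zero C Z Y"
    "i \<bullet> p \<boxplus> j \<bullet> q = Ide C X"
  using assms unfolding direct_sum_def by auto

lemma is_biproduct_pair_iff:
  "is_biproduct C {0, 1} (pair Y Z) X \<iota> \<pi> \<longleftrightarrow> direct_sum Y Z X (\<iota> 0) (\<pi> 0) (\<iota> 1) (\<pi> 1)"
proof -
  interpret XX: abelian_group "homs C X X" by (rule hom_abelian_group)
  have "finsum (homs C X X) (\<lambda>i. \<iota> i \<bullet> \<pi> i) {0, 1} = \<iota> 0 \<bullet> \<pi> 0 \<boxplus> \<iota> 1 \<bullet> \<pi> 1"
    if "\<iota> 0 \<in> Hom C Y X" "\<pi> 0 \<in> Hom C X Y" "\<iota> 1 \<in> Hom C Z X" "\<pi> 1 \<in> Hom C X Z"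
    using that by (subst XX.finsum_insert) (auto simp: in_Hom_iff)
  then show ?thesis unfolding is_biproduct_def direct_sum_def by (auto simp: pair_def)
qed

lemma is_summand_iff: "is_summand C Y X \<longleftrightarrow> (\<exists>Z i p j q. direct_sum Y Z X i p j q)"
proof
  assume "is_summand C Y X"
  then show "\<exists>Z i p j q. direct_sum Y Z X i p j q"
    unfolding is_summand_def is_biproduct_pair_iff by blast
next
  assume "\<exists>Z i p j q. direct_sum Y Z X i p j q"
  then obtain Z i p j q where "direct_sum Y Z X i p j q" by blast
  then have "is_biproduct C {0, 1} (pair Y Z) X (\<lambda>k. if k = 0 then i else j) (\<lambda>k. if k = 0 then p else q)"
    unfolding is_biproduct_pair_iff by simp
  then show "is_summand C Y X" unfolding is_summand_def by blast
qed

lemma indecomposable_iff: "indecomposable C X \<longleftrightarrow> \<not> is_zero_obj C X \<and>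
   (\<forall>Y Z i p j q. direct_sum Y Z X i p j q \<longrightarrow> is_zero_obj C Y \<or> is_zero_obj C Z)"
proof -
  have "(\<exists>\<iota> \<pi>. is_biproduct C {0, 1} (pair Y Z) X \<iota> \<pi>) \<longleftrightarrow> (\<exists>i p j q. direct_sum Y Z X i p j q)" for Y Z
  proof
    assume "\<exists>i p j q. direct_sum Y Z X i p j q"
    then obtain i p j q where "direct_sum Y Z X i p j q" by blast
    then have "is_biproduct C {0, 1} (pair Y Z) X (\<lambda>k. if k = 0 then i else j) (\<lambda>k. if k = 0 then p else q)"
      unfolding is_biproduct_pair_iff by simp
    then show "\<exists>\<iota> \<pi>. is_biproduct C {0, 1} (pair Y Z) X \<iota> \<pi>" by blast
  qed (auto simp: is_biproduct_pair_iff)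
  then show ?thesis unfolding indecomposable_def by metis
qed

lemma is_summand_iso_right:
  assumes "is_summand C Y X" "is_iso C X X' f"
  shows "is_summand C Y X'"
proof -
  obtain Z i p j q where s: "direct_sum Y Z X i p j q"
    using assms(1) unfolding is_summand_iff by blast
  obtain g where f: "f \<in> Hom C X X'" "g \<in> Hom C X' X" "g \<bullet> f = Ide C X" "f \<bullet> g = Ide C X'"
    using assms(2) by (rule is_isoE)
  have gf: "g \<bullet> (f \<bullet> x) = x" if "x \<in> Arr C" "Cod C x = X" for x
    using assoc[of x f g] that f by (simp add: in_Hom_iff)
  have "f \<bullet> (i \<bullet> (p \<bullet> g)) \<boxplus> f \<bullet> (j \<bullet> (q \<bullet> g)) = f \<bullet> ((i \<bullet> p \<boxplus> j \<bullet> q) \<bullet> g)"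
    using direct_sumD(1-4)[OF s] f(1,2) by (simp add: in_Hom_iff)
  also have "\<dots> = Ide C X'"
    unfolding direct_sumD(9)[OF s] using f by (simp add: in_Hom_iff)
  finally have "direct_sum Y Z X' (f \<bullet> i) (p \<bullet> g) (f \<bullet> j) (q \<bullet> g)"
    using s f(1,2) unfolding direct_sum_def by (simp add: in_Hom_iff gf)
  then show ?thesis unfolding is_summand_iff by blast
qed

lemma is_summand_iso_left:
  assumes "is_summand C Y X" "is_iso C Y Y' f"
  shows "is_summand C Y' X"
proof -
  obtain Z i p j q where s: "direct_sum Y Z X i p j q"
    using assms(1) unfolding is_summand_iff by blast
  obtain g where f: "f \<in> Hom C Y Y'" "g \<in> Hom C Y' Y" "g \<bullet> f = Ide C Y" "f \<bullet> g = Ide C Y'"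
    using assms(2) by (rule is_isoE)
  have gf: "g \<bullet> (f \<bullet> x) = x" if "x \<in> Arr C" "Cod C x = Y" for x
    using assoc[of x f g] that f by (simp add: in_Hom_iff)
  have pi: "p \<bullet> (i \<bullet> x) = x" if "x \<in> Arr C" "Cod C x = Y" for x
    using assoc[of x i p] that s unfolding direct_sum_def by (simp add: in_Hom_iff)
  have qi: "q \<bullet> (i \<bullet> x) = Zero C (Dom C x) Z" if "x \<in> Arr C" "Cod C x = Y" for x
    using assoc[of x i q] that s unfolding direct_sum_def by (simp add: in_Hom_iff)
  have "direct_sum Y' Z X (i \<bullet> g) (f \<bullet> p) j q"
    using s f unfolding direct_sum_def by (simp add: in_Hom_iff gf pi qi)
  then show ?thesis unfolding is_summand_iff by blast
qed

text \<open>Since \<open>B\<close> is nonzero, its complement in \<open>Y\<close> is zero, and then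
  the injection of \<open>B\<close> is invertible.\<close>

lemma indecomposable_summand_iso:
  assumes "indecomposable C Y" "indecomposable C B" "is_summand C B Y"
  obtains f where "is_iso C B Y f"
proof -
  obtain Z i p j q where s: "direct_sum B Z Y i p j q"
    using assms(3) unfolding is_summand_iff by blast
  have "is_zero_obj C Z" using s assms(1,2) unfolding indecomposable_iff by blast
  then have "j = Zero C Z Y"
    using s zero_obj_arr(1)[of Z j] unfolding direct_sum_def by (simp add: in_Hom_iff)
  then have "i \<bullet> p = Ide C Y"
    using direct_sumD(1-4)[OF s] direct_sumD(9)[OF s] by (simp add: in_Hom_iff)
  then have "is_iso C B Y i" using s unfolding direct_sum_def is_iso_def by blast
  then show ?thesis using that by blast
qed

text \<open>A decomposition gives idempotents e, e' with e + e' = 1 and e e' = e' e = 0. In a local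
  ring one of them is a unit, so the other is 0, and an object that splits off along the idempotent
  0 is zero.\<close>

lemma local_ring_indecomposable:
  assumes "local_ring (homs C X X)"
  shows "indecomposable C X"
  unfolding indecomposable_iff
proof (intro conjI allI impI)
  show "\<not> is_zero_obj C X"
    using assms unfolding local_ring_def is_zero_obj_def by simp
  fix Y Z i p j q assume s: "direct_sum Y Z X i p j q"
  then have hom: "i \<bullet> p \<in> Hom C X X" "j \<bullet> q \<in> Hom C X X"
    unfolding direct_sum_def by (auto intro: comp_in_hom)
  have zero: "(i \<bullet> p) \<bullet> (j \<bullet> q) = Zero C X X" "(j \<bullet> q) \<bullet> (i \<bullet> p) = Zero C X X"
  proof -
    have "(i \<bullet> p) \<bullet> (j \<bullet> q) = i \<bullet> ((p \<bullet> j) \<bullet> q)" "(j \<bullet> q) \<bullet> (i \<bullet> p) = j \<bullet> ((q \<bullet> i) \<bullet> p)"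
      using direct_sumD(1-4)[OF s] by (simp_all add: in_Hom_iff)
    then show "(i \<bullet> p) \<bullet> (j \<bullet> q) = Zero C X X" "(j \<bullet> q) \<bullet> (i \<bullet> p) = Zero C X X"
      unfolding direct_sumD(7,8)[OF s] using direct_sumD(1-4)[OF s] by (simp_all add: in_Hom_iff)
  qed
  have unit: "e' = Zero C X X"
    if u: "e \<in> Units (homs C X X)" and z: "e \<bullet> e' = Zero C X X" and e': "e' \<in> Hom C X X" for e e'
  proof -
    obtain u where "u \<in> Hom C X X" "e \<in> Hom C X X" "u \<bullet> e = Ide C X"
      using u unfolding Units_def by auto
    then show ?thesis using assoc[of e' e u] z e' by (simp add: in_Hom_iff)
  qed
  have ret: "is_zero_obj C W" if "r \<bullet> k = Ide C W" "k \<bullet> r = Zero C X X" "k \<in> Hom C W X" "r \<in> Hom C X W"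
    for W k r
  proof -
    have "Ide C W = (r \<bullet> k) \<bullet> (r \<bullet> k)" using that(1) by simp
    also have "\<dots> = r \<bullet> ((k \<bullet> r) \<bullet> k)" using that(3,4) by (simp add: in_Hom_iff)
    also have "\<dots> = Zero C W W" unfolding that(2) using that(3,4) by (simp add: in_Hom_iff)
    finally show ?thesis unfolding is_zero_obj_def .
  qed
  have "i \<bullet> p \<boxplus> j \<bullet> q \<in> Units (homs C X X)"
  proof -
    have "Ide C X \<in> Units (homs C X X)" unfolding Units_def by (auto simp: in_Hom_iff)
    then show ?thesis using s unfolding direct_sum_def by simp
  qed
  then have "i \<bullet> p \<in> Units (homs C X X) \<or> j \<bullet> q \<in> Units (homs C X X)"
    using assms hom unfolding local_ring_def by auto
  then have "j \<bullet> q = Zero C X X \<or> i \<bullet> p = Zero C X X"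
    using unit zero hom by blast
  then show "is_zero_obj C Y \<or> is_zero_obj C Z"
    using ret s unfolding direct_sum_def by blast
qed

lemma factor_ideal_empty: "f \<in> factor_ideal C {} X Y \<Longrightarrow> f = Zero C X Y"
  by (induction rule: factor_ideal.induct) simp_all

end

context additive_category
begin

text \<open>The complement required by \<open>is_summand\<close> is a biproduct of the remaining
  members of the family.\<close>

lemma biproduct_component_summand:
  assumes bp: "is_biproduct C I Y X \<iota> \<pi>" and i: "(i :: int) \<in> I"
  shows "is_summand C (Y i) X"
proof -
  note D = is_biproductD[OF bp]
  have fin: "finite (I - {i})" using biproduct_finite[OF bp] by simp
  obtain Z \<iota>' \<pi>' where Z: "is_biproduct C (I - {i}) Y Z \<iota>' \<pi>'"
    using biproducts[OF fin] by blast
  note D' = is_biproductD[OF Z]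
  obtain j where j: "j \<in> Hom C Z X" "\<And>k. k \<in> I - {i} \<Longrightarrow> j \<bullet> \<iota>' k = \<iota> k"
    using biproduct_copair[OF Z, of \<iota> X] D(1) by blast
  \<comment> \<open>These components describe the projection of \<open>X\<close> onto the
    complement: 0 on the i-th member, the injection into \<open>Z\<close> on all others.\<close>
  define a where "a = (\<lambda>k. if k = i then Zero C (Y i) Z else \<iota>' k)"
  have "a k \<in> Hom C (Y k) Z" if "k \<in> I" for k
    using that D'(1)[of k] by (auto simp: a_def in_Hom_iff)
  then obtain q where q: "q \<in> Hom C X Z" "\<And>k. k \<in> I \<Longrightarrow> q \<bullet> \<iota> k = a k"
    using biproduct_copair[OF bp, of a Z] by blast
  have ij: "\<iota> i \<in> Hom C (Y i) X" "\<pi> i \<in> Hom C X (Y i)" using D(1,2)[OF i] by auto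
  have "q \<bullet> j = Ide C Z"
  proof (rule biproduct_ext[OF Z])
    fix k assume k: "k \<in> I - {i}"
    have "(q \<bullet> j) \<bullet> \<iota>' k = q \<bullet> (j \<bullet> \<iota>' k)" using q(1) j(1) D'(1)[OF k] by (simp add: in_Hom_iff)
    then show "(q \<bullet> j) \<bullet> \<iota>' k = Ide C Z \<bullet> \<iota>' k"
      using j(2)[OF k] q(2)[of k] k D'(1)[OF k] by (simp add: in_Hom_iff a_def)
  qed (use q(1) j(1) in \<open>auto intro: comp_in_hom ide_in_hom\<close>)
  moreover have "\<pi> i \<bullet> j = Zero C Z (Y i)"
  proof (rule biproduct_ext[OF Z])
    fix k assume k: "k \<in> I - {i}"
    have "(\<pi> i \<bullet> j) \<bullet> \<iota>' k = \<pi> i \<bullet> (j \<bullet> \<iota>' k)" using ij j(1) D'(1)[OF k] by (simp add: in_Hom_iff)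
    then show "(\<pi> i \<bullet> j) \<bullet> \<iota>' k = Zero C Z (Y i) \<bullet> \<iota>' k"
      using j(2)[OF k] D(4)[of k i] i k D'(1)[OF k] by (auto simp: in_Hom_iff)
  qed (use ij j(1) in \<open>auto intro: comp_in_hom zero_in_hom\<close>)
  moreover have "q \<bullet> \<iota> i = Zero C (Y i) Z" using q(2)[OF i] by (simp add: a_def)
  moreover have "\<iota> i \<bullet> \<pi> i \<boxplus> j \<bullet> q = Ide C X"
  proof (rule biproduct_ext[OF bp])
    fix k assume k: "k \<in> I"
    have "(\<iota> i \<bullet> \<pi> i \<boxplus> j \<bullet> q) \<bullet> \<iota> k = \<iota> i \<bullet> (\<pi> i \<bullet> \<iota> k) \<boxplus> j \<bullet> (q \<bullet> \<iota> k)"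
      using ij j(1) q(1) D(1)[OF k] by (simp add: in_Hom_iff)
    also have "\<dots> = \<iota> k"
      using q(2)[OF k] j(2)[of k] j(1) D(3)[OF i] D(4)[OF k, of i] ij k i D(1)[OF k]
      by (cases "k = i") (auto simp: in_Hom_iff a_def)
    finally show "(\<iota> i \<bullet> \<pi> i \<boxplus> j \<bullet> q) \<bullet> \<iota> k = Ide C X \<bullet> \<iota> k"
      using D(1)[OF k] by (simp add: in_Hom_iff)
  qed (use ij j(1) q(1) in \<open>auto intro: comp_in_hom ide_in_hom plus_in_hom\<close>)
  ultimately have "direct_sum (Y i) Z X (\<iota> i) (\<pi> i) j q"
    using ij j(1) q(1) D(3)[OF i] unfolding direct_sum_def by simp
  then show ?thesis unfolding is_summand_iff by blast
qed

lemma is_summand_refl: "is_summand C X X"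
proof -
  have "direct_sum X (zero_obj C) X (Ide C X) (Ide C X) (Zero C (zero_obj C) X) (Zero C X (zero_obj C))"
    using is_zero_obj_zero_obj unfolding direct_sum_def is_zero_obj_def by (simp add: in_Hom_iff)
  then show ?thesis unfolding is_summand_iff by blast
qed

end

definition objects_in_cells :: "('o, 'm, 'z) mcat_scheme \<Rightarrow> 'o set set \<Rightarrow> 'o set" where
  "objects_in_cells C L = {B. indecomposable C B \<and> cell_of C B \<in> L}"

section \<open>Cells, ideals of cells and null-homotopies\<close>

context monoidal_krull_schmidt_category
begin

text \<open>Passage from objects to ideals: decompose \<open>X\<close> into pieces with local
  endomorphism rings. Each piece is an indecomposable summand, so its cell is in \<open>L\<close>,
  and the identity of \<open>X\<close> restricted to a piece is its injection, which factors through
  that piece.\<close>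

lemma ide_in_factor_ideal:
  assumes "obj_in_cells C (\<lambda>\<mu>. \<mu> \<in> L) X"
  shows "Ide C X \<in> factor_ideal C (objects_in_cells C L) X X"
proof -
  let ?J = "factor_ideal C (objects_in_cells C L)"
  obtain I :: "int set" and Y \<iota> \<pi> where bp: "is_biproduct C I Y X \<iota> \<pi>"
    and loc: "\<And>i. i \<in> I \<Longrightarrow> local_ring (homs C (Y i) (Y i))"
    using krull_schmidt by blast
  show ?thesis
  proof (rule biproduct_ideal(1)[OF bp two_sided_ideal_factor_ideal ide_in_hom])
    fix i assume i: "i \<in> I"
    have "indecomposable C (Y i)" by (rule local_ring_indecomposable[OF loc[OF i]])
    moreover have "is_summand C (Y i) X" by (rule biproduct_component_summand[OF bp i])
    ultimately have Y: "Y i \<in> objects_in_cells C L"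
      using assms unfolding obj_in_cells_def objects_in_cells_def by blast
    show "Ide C X \<bullet> \<iota> i \<in> ?J (Y i) X"
      using factor_idealI[OF Y ide_in_hom is_biproductD(1)[OF bp i]] is_biproductD(1)[OF bp i]
      by (simp add: in_Hom_iff)
  qed
qed

lemma is_iso_ten:
  assumes "is_iso C X X' f"
  shows "is_iso C ((M \<boxtimes> X) \<boxtimes> N) ((M \<boxtimes> X') \<boxtimes> N) ((Ide C M \<star> f) \<star> Ide C N)"
proof -
  obtain g where "f \<in> Hom C X X'" "g \<in> Hom C X' X" "g \<bullet> f = Ide C X" "f \<bullet> g = Ide C X'"
    using assms by (rule is_isoE)
  then show ?thesis
    unfolding is_iso_def by (intro conjI bexI[of _ "(Ide C M \<star> g) \<star> Ide C N"])
      (simp_all add: in_Hom_iff ten_ide)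
qed

text \<open>The relation multiplies on both sides; take the unit object on the right and transport
  along the inverse of \<open>RUnit\<close>.\<close>

lemma le_LR_tensor:
  assumes "is_summand C B (M \<boxtimes> Y)"
  shows "le_LR C B Y"
proof -
  obtain r where "is_iso C (M \<boxtimes> Y) ((M \<boxtimes> Y) \<boxtimes> Unit C) r"
    using is_iso_inverse[OF runit_iso] by blast
  then show ?thesis using is_summand_iso_right[OF assms] unfolding le_LR_def by blast
qed

lemma le_LR_refl: "le_LR C B B"
proof -
  obtain l where "is_iso C B (Unit C \<boxtimes> B) l"
    using is_iso_inverse[OF lunit_iso] by blast
  then show ?thesis using is_summand_iso_right[OF is_summand_refl] le_LR_tensor by blast
qed

lemma cell_of_iso:
  assumes "is_iso C B Y f"
  shows "cell_of C B = cell_of C Y"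
proof -
  have le: "le_LR C B'' Y' \<and> le_LR C Y' B''"
    if "is_iso C B' Y' g" "le_LR C B'' B'" "le_LR C B' B''" for B' Y' B'' g
    using that is_summand_iso_right[OF _ is_iso_ten[OF that(1)]] is_summand_iso_left
    unfolding le_LR_def by meson
  obtain g where "is_iso C Y B g" using is_iso_inverse[OF assms] by blast
  then show ?thesis using le[OF assms] le unfolding cell_of_def by blast
qed

text \<open>An indecomposable summand of \<open>Y\<close> is isomorphic to \<open>Y\<close>. This
  makes the condition of \<open>cell_equivalence\<close> on objects applicable to a single
  indecomposable.\<close>

lemma obj_in_own_cell:
  assumes "indecomposable C Y"
  shows "obj_in_cells C (\<lambda>\<mu>. \<mu> = cell_of C Y) Y"
  unfolding obj_in_cells_def using indecomposable_summand_iso[OF assms] cell_of_iso by metis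

lemma in_cell_of: "indecomposable C B \<Longrightarrow> B \<in> cell_of C B"
  unfolding cell_of_def using le_LR_refl by simp

lemma plus_rearrange6:
  assumes "a \<in> Hom C X Y" "b \<in> Hom C X Y" "c \<in> Hom C X Y" "d \<in> Hom C X Y" "e \<in> Hom C X Y" "f \<in> Hom C X Y"
  shows "(a \<boxplus> (b \<boxplus> c)) \<boxplus> (d \<boxplus> (e \<boxplus> f)) = (a \<boxplus> d) \<boxplus> ((b \<boxplus> e) \<boxplus> (c \<boxplus> f))"
proof -
  interpret XY: abelian_group "homs C X Y" by (rule hom_abelian_group)
  show ?thesis
    using assms XY.a_ac[unfolded homs_simps] XY.a_closed[unfolded homs_simps] by simp
qed

text \<open>For a composite v u through \<open>B\<close>, the null-homotopy of the identity of A
  \<otimes> B is sandwiched between 1 \<otimes> v and 1 \<otimes> u, which commute with the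
  differential of \<open>A\<close>. Null-homotopies of the summands are added.\<close>

lemma null_tensor_factor_ideal:
  assumes A: "bounded_complex C A" and J: "two_sided_ideal C J"
    and S: "\<And>B. B \<in> S \<Longrightarrow> null_tensor C J A B B (Ide C B)"
    and \<phi>: "\<phi> \<in> factor_ideal C S X Y"
  shows "null_tensor C J A X Y \<phi>"
  using \<phi>
proof (induction rule: factor_ideal.induct)
  case zero
  have d: "Df A (i - 1) \<in> Arr C" "Dom C (Df A (i - 1)) = Ob A (i - 1)" "Cod C (Df A (i - 1)) = Ob A i"
    "Df A i \<in> Arr C" "Dom C (Df A i) = Ob A i" "Cod C (Df A i) = Ob A (i + 1)" for i
    using bounded_complexD(1,2)[OF A, of i] by (auto simp: in_Hom_iff)
  show ?case
    unfolding null_tensor_def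
    by (intro exI[of _ "\<lambda>i. Zero C (Ob A i \<boxtimes> X) (Ob A i \<boxtimes> Y)"]
        exI[of _ "\<lambda>i. Zero C (Ob A i \<boxtimes> X) (Ob A (i - 1) \<boxtimes> Y)"] allI conjI)
      (use d in \<open>simp_all add: ideal_zero[OF J] in_Hom_iff\<close>)
next
  case (plus B u v r)
  obtain q s where qs: "\<And>i. q i \<in> J (Ob A i \<boxtimes> B) (Ob A i \<boxtimes> B)"
    "\<And>i. s i \<in> Hom C (Ob A i \<boxtimes> B) (Ob A (i - 1) \<boxtimes> B)"
    "\<And>i. Ide C (Ob A i) \<star> Ide C B = q i \<boxplus> ((Df A (i - 1) \<star> Ide C B) \<bullet> s i \<boxplus> s (i + 1) \<bullet> (Df A i \<star> Ide C B))"
    using S[OF plus(1)] unfolding null_tensor_def by blast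
  obtain q' s' where qs': "\<And>i. q' i \<in> J (Ob A i \<boxtimes> X) (Ob A i \<boxtimes> Y)"
    "\<And>i. s' i \<in> Hom C (Ob A i \<boxtimes> X) (Ob A (i - 1) \<boxtimes> Y)"
    "\<And>i. Ide C (Ob A i) \<star> r = q' i \<boxplus> ((Df A (i - 1) \<star> Ide C Y) \<bullet> s' i \<boxplus> s' (i + 1) \<bullet> (Df A i \<star> Ide C X))"
    using plus.IH unfolding null_tensor_def by blast
  define U where "U = (\<lambda>i. Ide C (Ob A i) \<star> u)"
  define V where "V = (\<lambda>i. Ide C (Ob A i) \<star> v)"
  have UV: "U i \<in> Hom C (Ob A i \<boxtimes> X) (Ob A i \<boxtimes> B)" "V i \<in> Hom C (Ob A i \<boxtimes> B) (Ob A i \<boxtimes> Y)" for i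
    using plus(2,3) unfolding U_def V_def by (auto simp: in_Hom_iff)
  let ?s = "\<lambda>i. V (i - 1) \<bullet> (s i \<bullet> U i) \<boxplus> s' i"
  have q: "V i \<bullet> (q i \<bullet> U i) \<in> J (Ob A i \<boxtimes> X) (Ob A i \<boxtimes> Y)" for i
    using ideal_comp_left[OF J ideal_comp_right[OF J qs(1) UV(1)] UV(2)] .
  have s: "?s i \<in> Hom C (Ob A i \<boxtimes> X) (Ob A (i - 1) \<boxtimes> Y)" for i
    using UV qs(2) qs'(2) by (auto intro!: plus_in_hom comp_in_hom)
  have "Ide C (Ob A i) \<star> (v \<bullet> u \<boxplus> r) = (V i \<bullet> (q i \<bullet> U i) \<boxplus> q' i) \<boxplus>
      ((Df A (i - 1) \<star> Ide C Y) \<bullet> ?s i \<boxplus> ?s (i + 1) \<bullet> (Df A i \<star> Ide C X))" for i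
  proof -
    have d: "Df A (i - 1) \<in> Hom C (Ob A (i - 1)) (Ob A i)" "Df A i \<in> Hom C (Ob A i) (Ob A (i + 1))"
      using bounded_complexD(1,2)[OF A, of i] by auto
    define x where "x = Df A (i - 1) \<star> Ide C B"
    define y where "y = Df A i \<star> Ide C B"
    define x' where "x' = Df A (i - 1) \<star> Ide C Y"
    define y' where "y' = Df A i \<star> Ide C X"
    have xy: "x \<in> Hom C (Ob A (i - 1) \<boxtimes> B) (Ob A i \<boxtimes> B)" "y \<in> Hom C (Ob A i \<boxtimes> B) (Ob A (i + 1) \<boxtimes> B)"
      "x' \<in> Hom C (Ob A (i - 1) \<boxtimes> Y) (Ob A i \<boxtimes> Y)" "y' \<in> Hom C (Ob A i \<boxtimes> X) (Ob A (i + 1) \<boxtimes> X)"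
      unfolding x_def y_def x'_def y'_def using d by (auto simp: in_Hom_iff)
    \<comment> \<open>The interchange law, which carries the sandwiching maps past the
      differential.\<close>
    have comm: "x' \<bullet> V (i - 1) = V i \<bullet> x" "U (i + 1) \<bullet> y' = y \<bullet> U i"
      unfolding x_def y_def x'_def y'_def U_def V_def using d plus(2,3) by (simp_all add: in_Hom_iff)
    note arrs = xy UV[of i] UV[of "i - 1"] UV[of "i + 1"] qs(2)[of i] qs(2)[of "i + 1"]
      qs'(2)[of i] qs'(2)[of "i + 1"] ideal_in_hom[OF J qs(1)[of i]] ideal_in_hom[OF J qs'(1)[of i]]
    have "Ide C (Ob A i) \<star> (v \<bullet> u \<boxplus> r) = V i \<bullet> ((Ide C (Ob A i) \<star> Ide C B) \<bullet> U i) \<boxplus> Ide C (Ob A i) \<star> r"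
      using plus(2,3) factor_ideal_in_hom[OF plus(4)] unfolding U_def V_def by (simp add: in_Hom_iff)
    also have "\<dots> = (V i \<bullet> (q i \<bullet> U i) \<boxplus> (V i \<bullet> (x \<bullet> (s i \<bullet> U i)) \<boxplus> V i \<bullet> (s (i + 1) \<bullet> (y \<bullet> U i)))) \<boxplus>
      (q' i \<boxplus> (x' \<bullet> s' i \<boxplus> s' (i + 1) \<bullet> y'))"
      unfolding qs(3) qs'(3) x_def[symmetric] y_def[symmetric] x'_def[symmetric] y'_def[symmetric]
      using arrs by (simp add: in_Hom_iff)
    also have "V i \<bullet> (x \<bullet> (s i \<bullet> U i)) = x' \<bullet> (V (i - 1) \<bullet> (s i \<bullet> U i))"
      using assoc[of "s i \<bullet> U i" "V (i - 1)" x'] assoc[of "s i \<bullet> U i" x "V i"] comm(1) arrs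
      by (simp add: in_Hom_iff)
    also have "y \<bullet> U i = U (i + 1) \<bullet> y'" by (rule comm(2)[symmetric])
    finally have *: "Ide C (Ob A i) \<star> (v \<bullet> u \<boxplus> r)
      = (V i \<bullet> (q i \<bullet> U i) \<boxplus> (x' \<bullet> (V (i - 1) \<bullet> (s i \<bullet> U i)) \<boxplus> V i \<bullet> (s (i + 1) \<bullet> (U (i + 1) \<bullet> y')))) \<boxplus>
      (q' i \<boxplus> (x' \<bullet> s' i \<boxplus> s' (i + 1) \<bullet> y'))" .
    have "x' \<bullet> ?s i \<boxplus> ?s (i + 1) \<bullet> y' = (x' \<bullet> (V (i - 1) \<bullet> (s i \<bullet> U i)) \<boxplus> x' \<bullet> s' i) \<boxplus>
      (V i \<bullet> (s (i + 1) \<bullet> (U (i + 1) \<bullet> y')) \<boxplus> s' (i + 1) \<bullet> y')"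
      using arrs by (simp add: in_Hom_iff)
    then show ?thesis
      unfolding x'_def[symmetric] y'_def[symmetric]
      using * plus_rearrange6[of "V i \<bullet> (q i \<bullet> U i)" "Ob A i \<boxtimes> X" "Ob A i \<boxtimes> Y"
        "x' \<bullet> (V (i - 1) \<bullet> (s i \<bullet> U i))" "V i \<bullet> (s (i + 1) \<bullet> (U (i + 1) \<bullet> y'))" "q' i" "x' \<bullet> s' i"
        "s' (i + 1) \<bullet> y'"] arrs by (simp add: in_Hom_iff)
  qed
  then show ?case
    unfolding null_tensor_def
    by (intro exI[of _ "\<lambda>i. V i \<bullet> (q i \<bullet> U i) \<boxplus> q' i"] exI[of _ ?s] allI conjI)
      (use ideal_plus[OF J q qs'(1)] s in auto)
qed

text \<open>The trivial null-homotopy: the whole identity is counted as error, with homotopy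
  0.\<close>

lemma null_tensor_in_ideal:
  assumes A: "bounded_complex C A" and J: "two_sided_ideal C J"
    and id: "\<And>i. Ide C (Ob A i \<boxtimes> B) \<in> J (Ob A i \<boxtimes> B) (Ob A i \<boxtimes> B)"
  shows "null_tensor C J A B B (Ide C B)"
proof -
  have d: "Df A (i - 1) \<in> Arr C" "Dom C (Df A (i - 1)) = Ob A (i - 1)" "Cod C (Df A (i - 1)) = Ob A i"
    "Df A i \<in> Arr C" "Dom C (Df A i) = Ob A i" "Cod C (Df A i) = Ob A (i + 1)" for i
    using bounded_complexD(1,2)[OF A, of i] by (auto simp: in_Hom_iff)
  show ?thesis
    unfolding null_tensor_def
    by (intro exI[of _ "\<lambda>i. Ide C (Ob A i \<boxtimes> B)"]
        exI[of _ "\<lambda>i. Zero C (Ob A i \<boxtimes> B) (Ob A (i - 1) \<boxtimes> B)"] allI conjI)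
      (use d id in \<open>simp_all add: in_Hom_iff ten_ide\<close>)
qed

text \<open>In degree i, the product with the stalk is A^i \<otimes> B up to zero summands. The
  diagonal injections and projections are chain maps to and from the degreewise product, so
  compressing the contraction by them gives the required data.\<close>

lemma null_tensor_stalk:
  assumes A: "bounded_complex C A" and J: "two_sided_ideal C J"
    and contr: "contractible_mod C J (tensor_complex C A (stalk C B 0))"
  shows "null_tensor C J A B B (Ide C B)"
proof -
  define L where "L = stalk C B 0"
  define T where "T = tensor_complex C A L"
  have L: "bounded_complex C L" unfolding L_def by (rule bounded_stalk)
  have Ob_L: "Ob L 0 = B" and Df_L: "Df L n = Zero C (Ob L n) (Ob L (n + 1))" for n
    unfolding L_def stalk_simps by simp_all
  obtain \<iota> \<pi> where fam: "\<And>n. biproduct_family C (\<lambda>i. Ob A i \<boxtimes> Ob L (n - i)) (Ob T n) (\<iota> n) (\<pi> n)"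
    and DT: "\<And>n. Df T n \<in> Hom C (Ob T n) (Ob T (n + 1))"
    and D: "\<And>n i. Df T n \<bullet> \<iota> n i = \<iota> (n + 1) (i + 1) \<bullet> (Df A i \<star> Ide C (Ob L (n - i))) \<boxplus>
       \<iota> (n + 1) i \<bullet> sgn_mor C i (Ide C (Ob A i) \<star> Df L (n - i))"
    using tensor_complex_structure[OF A L, folded T_def] by blast
  obtain p h where h: "homotopic_to_ide C T p h" and p: "\<And>n. p n \<in> J (Ob T n) (Ob T n)"
    using contr unfolding contractible_mod_def T_def L_def by blast
  have d: "Df A i \<in> Arr C" "Dom C (Df A i) = Ob A i" "Cod C (Df A i) = Ob A (i + 1)" for i
    using bounded_complexD(1)[OF A, of i] by (auto simp: in_Hom_iff)
  have in_hom: "\<iota> n i \<in> Arr C" "Dom C (\<iota> n i) = Ob A i \<boxtimes> Ob L (n - i)" "Cod C (\<iota> n i) = Ob T n"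
    "\<pi> n i \<in> Arr C" "Cod C (\<pi> n i) = Ob A i \<boxtimes> Ob L (n - i)" "Dom C (\<pi> n i) = Ob T n" for n i
    using family_in[OF fam, of n i] family_pr[OF fam, of n i] by (auto simp: in_Hom_iff)
  have diag: "\<iota> i i \<in> Hom C (Ob A i \<boxtimes> B) (Ob T i)" "\<pi> i i \<in> Hom C (Ob T i) (Ob A i \<boxtimes> B)" for i
    using in_hom[of i i] by (simp_all add: in_Hom_iff Ob_L)
  \<comment> \<open>The differential of the stalk is 0, which removes the signed half of the
    formula.\<close>
  have D': "Df T n \<bullet> \<iota> n i = \<iota> (n + 1) (i + 1) \<bullet> (Df A i \<star> Ide C (Ob L (n - i)))" for n i
  proof -
    have n: "n - i + 1 = n + 1 - i" by simp
    have "n + 1 - (i + 1) = n - i" by simp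
    then show ?thesis
      unfolding D Df_L n using in_hom[of "n + 1" i] in_hom[of "n + 1" "i + 1"] d[of i] by simp
  qed
  \<comment> \<open>Compatibility of the diagonal projections with the differentials, checked on
    each summand of the source; off the diagonal both sides are 0.\<close>
  have \<pi>D: "\<pi> (i + 1) (i + 1) \<bullet> Df T i = (Df A i \<star> Ide C B) \<bullet> \<pi> i i" for i
  proof (rule family_ext[OF fam])
    show "\<pi> (i + 1) (i + 1) \<bullet> Df T i \<in> Hom C (Ob T i) (Ob A (i + 1) \<boxtimes> B)"
      using diag(2)[of "i + 1"] DT[of i] by (auto intro: comp_in_hom)
    show "(Df A i \<star> Ide C B) \<bullet> \<pi> i i \<in> Hom C (Ob T i) (Ob A (i + 1) \<boxtimes> B)"
      using diag(2)[of i] d[of i] by (simp add: in_Hom_iff)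
    fix j
    have l: "i + 1 - (j + 1) = i - j" by simp
    have "(\<pi> (i + 1) (i + 1) \<bullet> Df T i) \<bullet> \<iota> i j = \<pi> (i + 1) (i + 1) \<bullet> (Df T i \<bullet> \<iota> i j)"
      using DT[of i] in_hom by (intro assoc) (simp_all add: in_Hom_iff)
    also have "\<dots> = (\<pi> (i + 1) (i + 1) \<bullet> \<iota> (i + 1) (j + 1)) \<bullet> (Df A j \<star> Ide C (Ob L (i - j)))"
      unfolding D' using in_hom[of "i + 1" "j + 1"] in_hom[of "i + 1" "i + 1"] d[of j] by simp
    also have "\<dots> = (Df A i \<star> Ide C B) \<bullet> (\<pi> i i \<bullet> \<iota> i j)"
    proof (cases "j = i")
      case True
      then show ?thesis
        using family_pr_in[OF fam, of "i + 1" "i + 1"] family_pr_in[OF fam, of i i] d[of i]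
        by (simp add: Ob_L)
    next
      case False
      then show ?thesis
        using family_pr_in_neq[OF fam, of "i + 1" "j + 1" "i + 1"] family_pr_in_neq[OF fam, of i j i] d[of i] d[of j]
        by (simp add: Ob_L)
    qed
    also have "\<dots> = ((Df A i \<star> Ide C B) \<bullet> \<pi> i i) \<bullet> \<iota> i j"
      using in_hom[of i j] diag(2)[of i] d[of i] by (simp add: in_Hom_iff)
    finally show "(\<pi> (i + 1) (i + 1) \<bullet> Df T i) \<bullet> \<iota> i j = ((Df A i \<star> Ide C B) \<bullet> \<pi> i i) \<bullet> \<iota> i j" .
  qed
  let ?q = "\<lambda>i. \<pi> i i \<bullet> (p i \<bullet> \<iota> i i)" and ?s = "\<lambda>i. \<pi> (i - 1) (i - 1) \<bullet> (h i \<bullet> \<iota> i i)"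
  have q: "?q i \<in> J (Ob A i \<boxtimes> B) (Ob A i \<boxtimes> B)" for i
    using ideal_comp_left[OF J ideal_comp_right[OF J p diag(1)] diag(2)] .
  have s: "?s i \<in> Hom C (Ob A i \<boxtimes> B) (Ob A (i - 1) \<boxtimes> B)" for i
    using diag(1)[of i] diag(2)[of "i - 1"] homotopic_to_ideD(2)[OF h, of i] by (auto intro: comp_in_hom)
  have eq: "Ide C (Ob A i) \<star> Ide C B = ?q i \<boxplus>
      ((Df A (i - 1) \<star> Ide C B) \<bullet> ?s i \<boxplus> ?s (i + 1) \<bullet> (Df A i \<star> Ide C B))" for i
  proof -
    note arrs = diag[of i] diag[of "i + 1"] diag[of "i - 1"] DT[of i] bounded_complexD(2)[OF A, of i]
      d[of i] homotopic_to_ideD(1-3)[OF h, of i]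
    have DT': "Df T (i - 1) \<in> Hom C (Ob T (i - 1)) (Ob T i)" using DT[of "i - 1"] by simp
    have "Ide C (Ob A i) \<star> Ide C B = \<pi> i i \<bullet> (Ide C (Ob T i) \<bullet> \<iota> i i)"
      using family_pr_in[OF fam, of i i] arrs by (simp add: in_Hom_iff ten_ide Ob_L)
    also have "\<dots> = ?q i \<boxplus> ((\<pi> i i \<bullet> Df T (i - 1)) \<bullet> (h i \<bullet> \<iota> i i) \<boxplus> \<pi> i i \<bullet> (h (i + 1) \<bullet> (Df T i \<bullet> \<iota> i i)))"
      unfolding homotopic_to_ideD(4)[OF h, of i, symmetric] using arrs DT' by (simp add: in_Hom_iff)
    also have "\<pi> i i \<bullet> Df T (i - 1) = (Df A (i - 1) \<star> Ide C B) \<bullet> \<pi> (i - 1) (i - 1)"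
      using \<pi>D[of "i - 1"] by simp
    also have "Df T i \<bullet> \<iota> i i = \<iota> (i + 1) (i + 1) \<bullet> (Df A i \<star> Ide C B)"
      using D'[of i i] by (simp add: Ob_L)
    finally show ?thesis using arrs by (simp add: in_Hom_iff)
  qed
  show ?thesis
    unfolding null_tensor_def using q s eq by (intro exI[of _ ?q] exI[of _ ?s] allI conjI) auto
qed

text \<open>The last factor of \<open>tensor_list\<close> stands alone instead of being tensored
  with the unit. The right unitor, being natural, is an isomorphism of complexes from the degreewise
  product with the unit, and the null-homotopy is conjugated by it.\<close>

lemma contractible_mod_unit:
  assumes A: "bounded_complex C A" and J: "two_sided_ideal C J"
    and null: "null_tensor C J A (Unit C) (Unit C) (Ide C (Unit C))"
  shows "contractible_mod C J A"
proof -
  let ?U = "Unit C"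
  obtain q s where qs: "\<And>i. q i \<in> J (Ob A i \<boxtimes> ?U) (Ob A i \<boxtimes> ?U)"
    "\<And>i. s i \<in> Hom C (Ob A i \<boxtimes> ?U) (Ob A (i - 1) \<boxtimes> ?U)"
    "\<And>i. Ide C (Ob A i) \<star> Ide C ?U = q i \<boxplus> ((Df A (i - 1) \<star> Ide C ?U) \<bullet> s i \<boxplus> s (i + 1) \<bullet> (Df A i \<star> Ide C ?U))"
    using null unfolding null_tensor_def by blast
  define r where "r = (\<lambda>i. RUnit C (Ob A i))"
  have "\<exists>g. r i \<in> Hom C (Ob A i \<boxtimes> ?U) (Ob A i) \<and> g \<in> Hom C (Ob A i) (Ob A i \<boxtimes> ?U) \<and>
      g \<bullet> r i = Ide C (Ob A i \<boxtimes> ?U) \<and> r i \<bullet> g = Ide C (Ob A i)" for i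
    using runit_iso[of "Ob A i"] unfolding r_def is_iso_def by blast
  then obtain g where r: "\<And>i. r i \<in> Hom C (Ob A i \<boxtimes> ?U) (Ob A i)" "\<And>i. g i \<in> Hom C (Ob A i) (Ob A i \<boxtimes> ?U)"
    "\<And>i. g i \<bullet> r i = Ide C (Ob A i \<boxtimes> ?U)" "\<And>i. r i \<bullet> g i = Ide C (Ob A i)" by metis
  have nat: "r (i + 1) \<bullet> (Df A i \<star> Ide C ?U) = Df A i \<bullet> r i" for i
    using runit_natural[OF bounded_complexD(1)[OF A, of i]] unfolding r_def .
  have nat': "(Df A i \<star> Ide C ?U) \<bullet> g i = g (i + 1) \<bullet> Df A i" for i
  proof -
    note arrs = r(1,2)[of i] r(1,2)[of "i + 1"] bounded_complexD(1)[OF A, of i]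
    have "(Df A i \<star> Ide C ?U) \<bullet> g i = (g (i + 1) \<bullet> r (i + 1)) \<bullet> ((Df A i \<star> Ide C ?U) \<bullet> g i)"
      unfolding r(3) using arrs by (simp add: in_Hom_iff)
    also have "\<dots> = g (i + 1) \<bullet> ((r (i + 1) \<bullet> (Df A i \<star> Ide C ?U)) \<bullet> g i)"
      using arrs by (simp add: in_Hom_iff)
    also have "\<dots> = g (i + 1) \<bullet> (Df A i \<bullet> (r i \<bullet> g i))"
      unfolding nat using arrs by (simp add: in_Hom_iff)
    finally show ?thesis unfolding r(4) using arrs by (simp add: in_Hom_iff)
  qed
  let ?p = "\<lambda>i. r i \<bullet> (q i \<bullet> g i)" and ?h = "\<lambda>i. r (i - 1) \<bullet> (s i \<bullet> g i)"
  have p: "?p i \<in> J (Ob A i) (Ob A i)" for i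
    using ideal_comp_left[OF J ideal_comp_right[OF J qs(1) r(2)] r(1)] .
  moreover have "homotopic_to_ide C A ?p ?h"
    unfolding homotopic_to_ide_def
  proof (intro allI conjI)
    fix i
    show "?p i \<in> Hom C (Ob A i) (Ob A i)" by (rule ideal_in_hom[OF J p])
    show "?h i \<in> Hom C (Ob A i) (Ob A (i - 1))"
      using r(1)[of "i - 1"] r(2)[of i] qs(2)[of i] by (auto intro: comp_in_hom)
    note arrs = r(1,2)[of i] r(1,2)[of "i + 1"] r(1,2)[of "i - 1"] bounded_complexD(1,2)[OF A, of i]
      qs(2)[of i] qs(2)[of "i + 1"] ideal_in_hom[OF J qs(1)[of i]]
    have "Ide C (Ob A i) = r i \<bullet> ((Ide C (Ob A i) \<star> Ide C ?U) \<bullet> g i)"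
      using arrs r(4)[of i] by (simp add: in_Hom_iff ten_ide)
    also have "\<dots> = ?p i \<boxplus> ((r i \<bullet> (Df A (i - 1) \<star> Ide C ?U)) \<bullet> (s i \<bullet> g i)
        \<boxplus> r i \<bullet> (s (i + 1) \<bullet> ((Df A i \<star> Ide C ?U) \<bullet> g i)))"
      unfolding qs(3) using arrs by (simp add: in_Hom_iff)
    also have "r i \<bullet> (Df A (i - 1) \<star> Ide C ?U) = Df A (i - 1) \<bullet> r (i - 1)"
      using nat[of "i - 1"] by simp
    also note nat'
    finally show "Ide C (Ob A i) = ?p i \<boxplus> (Df A (i - 1) \<bullet> ?h i \<boxplus> ?h (i + 1) \<bullet> Df A i)"
      using arrs by (simp add: in_Hom_iff)
  qed
  ultimately show ?thesis unfolding contractible_mod_def by blast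
qed

end

section \<open>Cones of cell equivalences and the induction along the ordering\<close>

context graded_monoidal_krull_schmidt_category
begin

lemma bounded_cell_cone:
  assumes "bounded_complex C F" "cell_equivalence C F \<kappa> a b \<alpha>"
  shows "bounded_complex C (cone C (Sigma_shift C a b (stalk C (Unit C) 0)) F \<alpha>)"
  using assms bounded_cone[OF bounded_Sigma_shift[OF bounded_stalk] assms(1)]
  unfolding cell_equivalence_def by blast

text \<open>If \<open>Y\<close> lies in \<kappa> itself, the equivalence replaces the product by a
  complex in smaller cells, all of which belong to \<open>L\<close>. If the cell of \<open>Y\<close>
  is already in \<open>L\<close>, every chain object of the product lies in cells of
  \<open>L\<close>.\<close>

lemma null_tensor_cell_cone:
  assumes F: "bounded_complex C F" and equiv: "cell_equivalence C F \<kappa> a b \<alpha>"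
    and L: "cell_order_ideal C L" and less: "\<And>\<mu>. \<lbrakk>\<mu> \<in> cells C; cell_less C \<mu> \<kappa>\<rbrakk> \<Longrightarrow> \<mu> \<in> L"
    and Y: "Y \<in> objects_in_cells C (insert \<kappa> L)"
  shows "null_tensor C (factor_ideal C (objects_in_cells C L))
    (cone C (Sigma_shift C a b (stalk C (Unit C) 0)) F \<alpha>) Y Y (Ide C Y)"
proof -
  define A where "A = cone C (Sigma_shift C a b (stalk C (Unit C) 0)) F \<alpha>"
  let ?J = "factor_ideal C (objects_in_cells C L)"
  have A: "bounded_complex C A"
    unfolding A_def by (rule bounded_cell_cone[OF F equiv])
  have indec: "indecomposable C Y" and "cell_of C Y \<in> insert \<kappa> L"
    using Y unfolding objects_in_cells_def by auto
  then consider "cell_of C Y = \<kappa>" | "cell_of C Y \<in> L" by blast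
  then have "null_tensor C ?J A Y Y (Ide C Y)"
  proof cases
    case 1
    have "obj_in_cells C (\<lambda>\<mu>. \<mu> = \<kappa>) Y" using obj_in_own_cell[OF indec] 1 by simp
    then obtain K where K: "complex_in_cells C (\<lambda>\<mu>. cell_less C \<mu> \<kappa>) K"
      "htpy_equiv C (tensor_complex C A (stalk C Y 0)) K"
      using equiv unfolding cell_equivalence_def A_def by blast
    have "obj_in_cells C (\<lambda>\<mu>. \<mu> \<in> L) (Ob K n)" for n
      using K(1) less unfolding complex_in_cells_def obj_in_cells_def cells_def by blast
    then show ?thesis
      using contractible_mod_htpy_equiv[OF bounded_tensor_complex[OF A bounded_stalk] _ K(2)]
        null_tensor_stalk[OF A] ide_in_factor_ideal two_sided_ideal_factor_ideal by blast
  next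
    case 2
    \<comment> \<open>Tensoring from the left only goes down in the cell order, and \<open>L\<close>
      is downward closed.\<close>
    have "obj_in_cells C (\<lambda>\<mu>. \<mu> \<in> L) (Ob A i \<boxtimes> Y)" for i
      unfolding obj_in_cells_def
    proof (intro allI impI)
      fix B assume B: "indecomposable C B \<and> is_summand C B (Ob A i \<boxtimes> Y)"
      then have "cell_le C (cell_of C B) (cell_of C Y)"
        unfolding cell_le_def using le_LR_tensor in_cell_of indec by blast
      then show "cell_of C B \<in> L"
        using 2 L B unfolding cell_order_ideal_def cells_def by blast
    qed
    then show ?thesis
      using null_tensor_in_ideal[OF A two_sided_ideal_factor_ideal] ide_in_factor_ideal by blast
  qed
  then show ?thesis unfolding A_def .
qed

text \<open>Descending induction on m: the product of the factors from position m on is contractible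
  modulo the ideal of the first m cells. Positions count from 0, so the factor at
  \<open>\<kappa>s ! m\<close> leads from \<open>J (Suc m)\<close> to \<open>J m\<close>.\<close>

lemma contractible_mod_tensor_list:
  fixes \<kappa>s :: "'o set list" and T :: "'o set \<Rightarrow> ('o, 'm) cochain"
  defines "J \<equiv> \<lambda>m. factor_ideal C (objects_in_cells C (set (take m \<kappa>s)))"
  assumes bounded: "\<And>\<kappa>. \<kappa> \<in> set \<kappa>s \<Longrightarrow> bounded_complex C (T \<kappa>)"
    and null: "\<And>m Y. \<lbrakk>m < length \<kappa>s; Y \<in> objects_in_cells C (set (take (Suc m) \<kappa>s))\<rbrakk> \<Longrightarrow>
      null_tensor C (J m) (T (\<kappa>s ! m)) Y Y (Ide C Y)"
    and cells: "set \<kappa>s = cells C" and m: "m \<le> length \<kappa>s"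
  shows "bounded_complex C (tensor_list C (map T (drop m \<kappa>s))) \<and>
    contractible_mod C (J m) (tensor_list C (map T (drop m \<kappa>s)))"
  using m
proof (induction m rule: inc_induct)
  have J: "two_sided_ideal C (J m)" for m
    unfolding J_def by (rule two_sided_ideal_factor_ideal)
  \<comment> \<open>For m equal to the length, all cells are included and every identity lies in the
    ideal.\<close>
  have ide: "Ide C X \<in> J (length \<kappa>s) X X" for X
    unfolding J_def using ide_in_factor_ideal[of "cells C" X] cells
    by (auto simp: obj_in_cells_def cells_def)
  {
    case base
    let ?S = "stalk C (Unit C) 0"
    \<comment> \<open>The empty product is the unit in degree 0. It is contractible modulo
      everything: the error is the identity and the homotopy is 0.\<close>
    have "homotopic_to_ide C ?S (\<lambda>n. Ide C (Ob ?S n)) (\<lambda>n. Zero C (Ob ?S n) (Ob ?S (n - 1)))"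
      unfolding homotopic_to_ide_def using bounded_complexD(1,2)[OF bounded_stalk[of "Unit C" 0]]
      by (auto simp: in_Hom_iff)
    then show ?case
      using bounded_stalk ide unfolding contractible_mod_def by auto
  next
    case (step m)
    let ?A = "T (\<kappa>s ! m)" and ?Ks = "map T (drop (Suc m) \<kappa>s)"
    have drop: "map T (drop m \<kappa>s) = ?A # ?Ks"
      using step(2) by (simp add: Cons_nth_drop_Suc[symmetric])
    have A: "bounded_complex C ?A" using bounded step(2) by simp
    have null': "null_tensor C (J m) ?A X Y \<phi>" if "\<phi> \<in> J (Suc m) X Y" for X Y \<phi>
      using null_tensor_factor_ideal[OF A J null[OF step(2)]] that unfolding J_def by blast
    show ?case
    \<comment> \<open>The last factor needs its own case, since \<open>tensor_list\<close> of a
      singleton is the bare complex and not its product with the unit.\<close>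
    proof (cases "?Ks = []")
      case True
      then have "Suc m = length \<kappa>s" using step(2) by simp
      then have "contractible_mod C (J m) ?A"
        using contractible_mod_unit[OF A J] null' ide by metis
      then show ?thesis unfolding drop True using A by simp
    next
      case False
      then have eq: "tensor_list C (map T (drop m \<kappa>s)) = tensor_complex C ?A (tensor_list C ?Ks)"
        unfolding drop by (cases ?Ks) auto
      show ?thesis
        unfolding eq using step(3) A J null'
        by (auto intro: bounded_tensor_complex contractible_mod_tensor_complex[of ?A _ "J m" "J (Suc m)"])
    qed
  }
qed

end

theorem proposition3p41:
  fixes C :: "('o, 'm, 'g :: ab_group_add) gcat"
    and F :: "('o, 'm) cochain"
    and a :: "'o set \<Rightarrow> 'g"
    and b :: "'o set \<Rightarrow> int"
    and \<alpha> :: "'o set \<Rightarrow> int \<Rightarrow> 'm"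
    and \<kappa>s :: "'o set list"
  assumes "cell_category C"
    and "finite (cells C)"
    and "bounded_complex C F"
    and "twist_like C F" and "sharp C F" and "cell_triangular C F a b"
    and "\<forall>\<kappa>\<in>cells C. cell_equivalence C F \<kappa> (a \<kappa>) (b \<kappa>) (\<alpha> \<kappa>)"
    and "distinct \<kappa>s" and "set \<kappa>s = cells C"
    and "\<forall>m \<le> length \<kappa>s. cell_order_ideal C (set (take m \<kappa>s))"
  shows "htpy_equiv C
    (tensor_list C (map (\<lambda>\<kappa>. cone C (Sigma_shift C (a \<kappa>) (b \<kappa>) (stalk C (Unit C) 0)) F (\<alpha> \<kappa>)) \<kappa>s))
    (zero_complex C)"
proof -
  interpret cell_category C by (rule assms(1))
  let ?T = "\<lambda>\<kappa>. cone C (Sigma_shift C (a \<kappa>) (b \<kappa>) (stalk C (Unit C) 0)) F (\<alpha> \<kappa>)"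
  have bounded: "bounded_complex C (?T \<kappa>)" if "\<kappa> \<in> set \<kappa>s" for \<kappa>
    using bounded_cell_cone assms(3,7,9) that by blast
  have null: "null_tensor C (factor_ideal C (objects_in_cells C (set (take m \<kappa>s)))) (?T (\<kappa>s ! m)) Y Y (Ide C Y)"
    if m: "m < length \<kappa>s" and Y: "Y \<in> objects_in_cells C (set (take (Suc m) \<kappa>s))" for m Y
  proof (rule null_tensor_cell_cone[OF assms(3)])
    have take: "set (take (Suc m) \<kappa>s) = insert (\<kappa>s ! m) (set (take m \<kappa>s))"
      using m by (simp add: take_Suc_conv_app_nth)
    show "cell_equivalence C F (\<kappa>s ! m) (a (\<kappa>s ! m)) (b (\<kappa>s ! m)) (\<alpha> (\<kappa>s ! m))"
      using assms(7,9) m nth_mem by blast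
    show "cell_order_ideal C (set (take m \<kappa>s))" using assms(10) m by simp
    show "Y \<in> objects_in_cells C (insert (\<kappa>s ! m) (set (take m \<kappa>s)))" using Y unfolding take .
    \<comment> \<open>The longer initial segment is an ideal, so it contains every cell below
      \<open>\<kappa>s ! m\<close>; a strictly smaller cell differs from
      \<open>\<kappa>s ! m\<close> and hence already occurs before it.\<close>
    have "cell_order_ideal C (insert (\<kappa>s ! m) (set (take m \<kappa>s)))"
      using assms(10) m take by (metis Suc_leI)
    then show "\<mu> \<in> set (take m \<kappa>s)" if "\<mu> \<in> cells C" "cell_less C \<mu> (\<kappa>s ! m)" for \<mu>
      using that unfolding cell_order_ideal_def cell_less_def by blast
  qed
  have "bounded_complex C (tensor_list C (map ?T \<kappa>s))"
    and "contractible_mod C (factor_ideal C (objects_in_cells C {})) (tensor_list C (map ?T \<kappa>s))"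
    using contractible_mod_tensor_list[of \<kappa>s ?T 0, OF bounded null assms(9)] by simp_all
  \<comment> \<open>At m = 0 the ideal consists of zero morphisms only, so contractibility modulo it
    is contractibility.\<close>
  moreover have "objects_in_cells C {} = {}" by (simp add: objects_in_cells_def)
  ultimately show ?thesis
    using factor_ideal_empty unfolding contractible_mod_def
    by (intro htpy_equiv_zero_complex) (auto simp: contractible_mod_def)
qed

end
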